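(* Let $p\ge1$, $k\ge1$, $r\in\{0,\dots,p-1\}$, $q=p-r$, and suppose the model $(c,\{f_i\}_{i=0}^k)$ belongs to $\mathcal M_r$ (see context), with associated $\alpha,\mu,\theta$. For $\tau\in\mathbb N$, a state $\mathfrak z=(\mathfrak z_{(1)}^\top,\dots,\mathfrak z_{(k)}^\top)^\top\in\mathbb R^{kp}$ and $u\in\mathbb R^p$, let $z_t(u;\mathfrak z)$, $t\ge\tau$, be defined by $z_{\tau-i}=\mathfrak z_{(i)}$ for $i=1,\dots,k$ and $f_0(z_t)=c+\sum_{i=1}^kf_i(z_{t-i})+u_t$ for $t\ge\tau$, where $u_\tau=u$ and $u_t=0$ for $t\ge\tau+1$. Let $\mathscr M_\mu=\{z\in\mathbb R^p:\theta(z)=-\mu\}$ and $\bar h(\mathfrak z)=f_0(\mathfrak z_{(1)})-\sum_{i=1}^{k-1}g_i(\mathfrak z_{(i+1)})$. Then: (1) for every $(u,\mathfrak z)\in\mathbb R^p\times\mathbb R^{kp}$, as $t\to\infty$, $$z_t(u;\mathfrak z)\to z_\infty(u;\mathfrak z)\defeq\chi^{-1}\begin{bmatrix}\alpha_\perp^\top[\bar h(\mathfrak z)+u]\\-\mu\end{bmatrix}\in\mathscr M_\mu;$$ (2) for any $(z,\mathfrak z)\in\mathscr M_\mu\times\mathbb R^{kp}$, the $r$-dimensional affine subspace $\mathscr U(z;\mathfrak z)\defeq\operatorname{span}\alpha+[h(z)-\bar h(\mathfrak z)]$ is the domain of attraction for $z$, given $\mathfrak z$; and hence $\mathscr M_\mu$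 is strictly stable.
   Context: Model: for $c\in\mathbb R^p$ and maps $f_0,\dots,f_k:\mathbb R^p\to\mathbb R^p$ with $f_i(0)=0$, the nonlinear VAR($k$) is $f_0(z_t)=c+\sum_{i=1}^k f_i(z_{t-i})+u_t$. (When $k=1$, blocks indexed by $1,\dots,k-1$ are empty.) Define $g_j(z)=-\sum_{i=j+1}^k f_i(z)$ ($j=0,\dots,k-1$); $\pi(z)=-f_0(z)+\sum_{i=1}^k f_i(z)$; $\mathbf g(z)=(g_1(z)^\top,\dots,g_{k-1}(z)^\top)^\top$. $D\in\mathbb R^{p(k-1)\times p(k-1)}$ has $-I_p$ diagonal blocks, $I_p$ blocks immediately above the diagonal, zeros elsewhere; $E=(I_p,0_{p\times p(k-2)})^\top$. For $\alpha\in\mathbb R^{p\times r}$ of rank $r$, $\alpha_\perp$ is $p\times(p-r)$ of rank $p-r$ with $\alpha_\perp^\top\alpha=0$; $\boldsymbol\alpha=\begin{bmatrix}\alpha & E^\top\\ 0 & I_{p(k-1)}\end{bmatrix}$. For $\theta:\mathbb R^p\to\mathbb R^r$, $\boldsymbol\theta(z)=(\theta(z)^\top,\mathbf g(z)^\top)^\top$, $\mathbf D_0=\begin{bmatrix}0_{r\times p}&0\\0&D\end{bmatrix}$. Joint spectral radius: $\rho_{JSR}(\mathcal A)=\limsup_{t}\sup\{\rho(M_1\cdots M_t)^{1/t}:M_s\in\mathcal A\}$. Class $\mathcal M_r$: the model belongs to $\mathcal M_r$ if for some $\alpha\in\mathbb R^{p\times r}$ of rank $r$, $\bar b<\infty$,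 $\bar\rho<1$: (i) $f_0$ is a homeomorphism of $\mathbb R^p$; (ii) there exist $\mu\in\mathbb R^r$, $\theta:\mathbb R^p\to\mathbb R^r$ with $c=\alpha\mu$, $\pi=\alpha\theta$; (iii) there is a closed $\mathcal B\subset\mathbb R^{kp\times[p(k-1)+r]}$ with $\max_{\mathcal B}\|\boldsymbol\beta\|\le\bar b$ and $\rho_{JSR}(\{I+\boldsymbol\beta^\top\boldsymbol\alpha:\boldsymbol\beta\in\mathcal B\})\le\bar\rho$, such that for all $\mathbf z=(z^\top,\boldsymbol\zeta^\top)^\top,\mathbf z'=(z'^\top,\boldsymbol\zeta'^\top)^\top\in\mathbb R^{kp}$ some $\boldsymbol\beta\in\mathcal B$ satisfies $[\boldsymbol\theta(f_0^{-1}(z))+\mathbf D_0\mathbf z]-[\boldsymbol\theta(f_0^{-1}(z'))+\mathbf D_0\mathbf z']=\boldsymbol\beta^\top(\mathbf z-\mathbf z')$. Define $h(z)=f_0(z)-\sum_{i=1}^{k-1}g_i(z)$, $\psi=\alpha_\perp^\top h$, $\chi(z)=(\psi(z)^\top,\theta(z)^\top)^\top$. Stability notions (with $z_t(u;\mathfrak z)$ as in the claim): $\mathcal S\subset\mathbb R^p$ is stable if for every $(u,\mathfrak z)$ there is $z_\infty\in\mathcal S$ with $z_t(u;\mathfrak z)\to z_\infty$. $z_\infty\in\mathbb R^p$ is a non-trivial attractor if for every $\mathfrak z$ there is a non-empty set $\mathscr U(z_\infty;\mathfrak z)\subset\mathbb R^p$ with $z_t(u;\mathfrak z)\to z_\infty$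 for all $u\in\mathscr U(z_\infty;\mathfrak z)$; this set is called the domain of attraction for $z_\infty$ given $\mathfrak z$. $\mathcal S$ is strictly stable if it is stable and contains only non-trivial attractors. *)

theory Defs
  imports "HOL-Analysis.Analysis" "HOL-Library.Function_Algebras"
begin

text \<open>Conventions. A vector of R^n is a function nat => real vanishing at indices >= n
(the set Rn n); an m x n matrix is a function nat => nat => real (entries outside the
box are irrelevant or required to be 0, as stated). nat => real carries the product
topology, which on Rn n is the Euclidean topology.\<close>

definition Rn :: "nat \<Rightarrow> (nat \<Rightarrow> real) set" where
  "Rn n = {x. \<forall>i\<ge>n. x i = 0}"

definition mat_vec :: "nat \<Rightarrow> nat \<Rightarrow> (nat \<Rightarrow> nat \<Rightarrow> real) \<Rightarrow> (nat \<Rightarrow> real) \<Rightarrow> (nat \<Rightarrow> real)" where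
  "mat_vec m n A x = (\<lambda>i. if i < m then (\<Sum>j<n. A i j * x j) else 0)"

definition transp :: "(nat \<Rightarrow> nat \<Rightarrow> real) \<Rightarrow> (nat \<Rightarrow> nat \<Rightarrow> real)" where
  "transp A = (\<lambda>i j. A j i)"

definition mat_mul :: "nat \<Rightarrow> nat \<Rightarrow> nat \<Rightarrow> (nat \<Rightarrow> nat \<Rightarrow> real) \<Rightarrow> (nat \<Rightarrow> nat \<Rightarrow> real) \<Rightarrow> (nat \<Rightarrow> nat \<Rightarrow> real)" where
  "mat_mul m n l A B = (\<lambda>i j. if i < m \<and> j < l then (\<Sum>s<n. A i s * B s j) else 0)"

definition idm :: "nat \<Rightarrow> (nat \<Rightarrow> nat \<Rightarrow> real)" where
  "idm n = (\<lambda>i j. if i < n \<and> i = j then 1 else 0)"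

definition in_box :: "nat \<Rightarrow> nat \<Rightarrow> (nat \<Rightarrow> nat \<Rightarrow> real) \<Rightarrow> bool" where
  "in_box m n A \<longleftrightarrow> (\<forall>i j. (m \<le> i \<or> n \<le> j) \<longrightarrow> A i j = 0)"

definition full_col_rank :: "nat \<Rightarrow> nat \<Rightarrow> (nat \<Rightarrow> nat \<Rightarrow> real) \<Rightarrow> bool" where
  "full_col_rank m n A \<longleftrightarrow> in_box m n A \<and>
     (\<forall>y\<in>Rn n. mat_vec m n A y = 0 \<longrightarrow> y = 0)"

definition fro_norm :: "nat \<Rightarrow> nat \<Rightarrow> (nat \<Rightarrow> nat \<Rightarrow> real) \<Rightarrow> real" where
  "fro_norm m n A = sqrt (\<Sum>i<m. \<Sum>j<n. (A i j)\<^sup>2)"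

text \<open>Spectral radius of a real n x n matrix: largest modulus of a (complex) eigenvalue
(0 for n = 0).\<close>
definition spec_rad :: "nat \<Rightarrow> (nat \<Rightarrow> nat \<Rightarrow> real) \<Rightarrow> real" where
  "spec_rad n A = Sup (insert 0 {cmod l | l. \<exists>v::nat \<Rightarrow> complex. (\<exists>i<n. v i \<noteq> 0) \<and>
      (\<forall>i<n. (\<Sum>j<n. complex_of_real (A i j) * v j) = l * v i)})"

fun prodm :: "nat \<Rightarrow> nat \<Rightarrow> (nat \<Rightarrow> nat \<Rightarrow> nat \<Rightarrow> real) \<Rightarrow> (nat \<Rightarrow> nat \<Rightarrow> real)" where
  "prodm n 0 Ms = idm n"
| "prodm n (Suc t) Ms = mat_mul n n n (prodm n t Ms) (Ms t)"

definition jsr :: "nat \<Rightarrow> (nat \<Rightarrow> nat \<Rightarrow> real) set \<Rightarrow> ereal" where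
  "jsr n \<A> = limsup (\<lambda>t. SUP Ms \<in> {Ms. \<forall>s<t. Ms s \<in> \<A>}.
       ereal (spec_rad n (prodm n t Ms) powr (1 / real t)))"

definition blk :: "nat \<Rightarrow> nat \<Rightarrow> (nat \<Rightarrow> real) \<Rightarrow> (nat \<Rightarrow> real)" where
  "blk p i x = (\<lambda>l. if l < p then x (i * p + l) else 0)"

definition var_model :: "nat \<Rightarrow> nat \<Rightarrow> (nat \<Rightarrow> real) \<Rightarrow> (nat \<Rightarrow> (nat \<Rightarrow> real) \<Rightarrow> (nat \<Rightarrow> real)) \<Rightarrow> bool" where
  "var_model p k c f \<longleftrightarrow> c \<in> Rn p \<and>
     (\<forall>i\<le>k. (\<forall>z\<in>Rn p. f i z \<in> Rn p) \<and> f i 0 = 0)"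

definition gfun :: "nat \<Rightarrow> (nat \<Rightarrow> (nat \<Rightarrow> real) \<Rightarrow> (nat \<Rightarrow> real)) \<Rightarrow> nat \<Rightarrow> (nat \<Rightarrow> real) \<Rightarrow> (nat \<Rightarrow> real)" where
  "gfun k f j z = - (\<Sum>i\<in>{j+1..k}. f i z)"

definition pifun :: "nat \<Rightarrow> (nat \<Rightarrow> (nat \<Rightarrow> real) \<Rightarrow> (nat \<Rightarrow> real)) \<Rightarrow> (nat \<Rightarrow> real) \<Rightarrow> (nat \<Rightarrow> real)" where
  "pifun k f z = - f 0 z + (\<Sum>i\<in>{1..k}. f i z)"

definition hfun :: "nat \<Rightarrow> (nat \<Rightarrow> (nat \<Rightarrow> real) \<Rightarrow> (nat \<Rightarrow> real)) \<Rightarrow> (nat \<Rightarrow> real) \<Rightarrow> (nat \<Rightarrow> real)" where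
  "hfun k f z = f 0 z - (\<Sum>i\<in>{1..k-1}. gfun k f i z)"

text \<open>hbar(zz) = f0(zz_(1)) - sum_{i=1}^{k-1} g_i(zz_(i+1)), with zz_(i) = blk p (i-1) zz.\<close>
definition hbar :: "nat \<Rightarrow> nat \<Rightarrow> (nat \<Rightarrow> (nat \<Rightarrow> real) \<Rightarrow> (nat \<Rightarrow> real)) \<Rightarrow> (nat \<Rightarrow> real) \<Rightarrow> (nat \<Rightarrow> real)" where
  "hbar p k f zz = f 0 (blk p 0 zz) - (\<Sum>i\<in>{1..k-1}. gfun k f i (blk p i zz))"

definition stack :: "nat \<Rightarrow> (nat \<Rightarrow> real) \<Rightarrow> (nat \<Rightarrow> real) \<Rightarrow> (nat \<Rightarrow> real)" where
  "stack m x y = (\<lambda>i. if i < m then x i else y (i - m))"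

definition chi :: "nat \<Rightarrow> nat \<Rightarrow> nat \<Rightarrow> (nat \<Rightarrow> (nat \<Rightarrow> real) \<Rightarrow> (nat \<Rightarrow> real)) \<Rightarrow>
    (nat \<Rightarrow> nat \<Rightarrow> real) \<Rightarrow> ((nat \<Rightarrow> real) \<Rightarrow> (nat \<Rightarrow> real)) \<Rightarrow> (nat \<Rightarrow> real) \<Rightarrow> (nat \<Rightarrow> real)" where
  "chi p k r f aperp \<theta> z = stack (p - r) (mat_vec (p - r) p (transp aperp) (hfun k f z)) (\<theta> z)"

text \<open>The matrix D (size p(k-1) x p(k-1)): -I_p diagonal blocks, I_p blocks immediately
above the diagonal.\<close>
definition Dmat :: "nat \<Rightarrow> nat \<Rightarrow> (nat \<Rightarrow> nat \<Rightarrow> real)" where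
  "Dmat p k = (\<lambda>i j. if i < p * (k - 1) \<and> j < p * (k - 1) \<and> i mod p = j mod p then
       (if j div p = i div p then -1 else if j div p = i div p + 1 then 1 else 0) else 0)"

text \<open>D_0 = [[0_{r x p}, 0], [0, D]], of size (r + p(k-1)) x kp.\<close>
definition D0mat :: "nat \<Rightarrow> nat \<Rightarrow> nat \<Rightarrow> (nat \<Rightarrow> nat \<Rightarrow> real)" where
  "D0mat p k r = (\<lambda>i j. if r \<le> i \<and> p \<le> j then Dmat p k (i - r) (j - p) else 0)"

definition Emat :: "nat \<Rightarrow> nat \<Rightarrow> (nat \<Rightarrow> nat \<Rightarrow> real)" where
  "Emat p k = (\<lambda>i j. if i < p * (k - 1) \<and> j < p \<and> i = j then 1 else 0)"

text \<open>Bold alpha = [[alpha, E^T], [0, I_{p(k-1)}]], of size kp x (r + p(k-1)).\<close>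
definition balpha :: "nat \<Rightarrow> nat \<Rightarrow> nat \<Rightarrow> (nat \<Rightarrow> nat \<Rightarrow> real) \<Rightarrow> (nat \<Rightarrow> nat \<Rightarrow> real)" where
  "balpha p k r \<alpha> = (\<lambda>i j.
     if i < p \<and> j < r then \<alpha> i j
     else if i < p \<and> r \<le> j \<and> j < r + p * (k - 1) then transp (Emat p k) i (j - r)
     else if p \<le> i \<and> i < k * p \<and> r \<le> j \<and> j < r + p * (k - 1) then idm (p * (k - 1)) (i - p) (j - r)
     else 0)"

text \<open>Bold theta(z) = (theta(z)^T, g_1(z)^T, ..., g_{k-1}(z)^T)^T, length r + p(k-1).\<close>
definition btheta :: "nat \<Rightarrow> nat \<Rightarrow> nat \<Rightarrow> (nat \<Rightarrow> (nat \<Rightarrow> real) \<Rightarrow> (nat \<Rightarrow> real)) \<Rightarrow>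
    ((nat \<Rightarrow> real) \<Rightarrow> (nat \<Rightarrow> real)) \<Rightarrow> (nat \<Rightarrow> real) \<Rightarrow> (nat \<Rightarrow> real)" where
  "btheta p k r f \<theta> z = (\<lambda>l. if l < r then \<theta> z l
      else if l < r + p * (k - 1) then gfun k f (1 + (l - r) div p) z ((l - r) mod p)
      else 0)"

definition in_Mr :: "nat \<Rightarrow> nat \<Rightarrow> nat \<Rightarrow> (nat \<Rightarrow> real) \<Rightarrow> (nat \<Rightarrow> (nat \<Rightarrow> real) \<Rightarrow> (nat \<Rightarrow> real)) \<Rightarrow>
    (nat \<Rightarrow> nat \<Rightarrow> real) \<Rightarrow> (nat \<Rightarrow> real) \<Rightarrow> ((nat \<Rightarrow> real) \<Rightarrow> (nat \<Rightarrow> real)) \<Rightarrow> bool" where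
  "in_Mr p k r c f \<alpha> \<mu> \<theta> \<longleftrightarrow>
     full_col_rank p r \<alpha> \<and>
     (\<exists>g. homeomorphism (Rn p) (Rn p) (f 0) g) \<and>
     \<mu> \<in> Rn r \<and> (\<forall>z\<in>Rn p. \<theta> z \<in> Rn r) \<and>
     c = mat_vec p r \<alpha> \<mu> \<and> (\<forall>z\<in>Rn p. pifun k f z = mat_vec p r \<alpha> (\<theta> z)) \<and>
     (\<exists>(bbar::real) (rhobar::real) \<B>. rhobar < 1 \<and>
        closed \<B> \<and> (\<forall>\<beta>\<in>\<B>. in_box (k * p) (p * (k - 1) + r) \<beta>) \<and>
        (\<forall>\<beta>\<in>\<B>. fro_norm (k * p) (p * (k - 1) + r) \<beta> \<le> bbar) \<and>
        jsr (p * (k - 1) + r)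
          ((\<lambda>\<beta>. \<lambda>i j. idm (p * (k - 1) + r) i j +
                mat_mul (p * (k - 1) + r) (k * p) (p * (k - 1) + r) (transp \<beta>) (balpha p k r \<alpha>) i j) ` \<B>)
          \<le> ereal rhobar \<and>
        (\<forall>bz\<in>Rn (k * p). \<forall>bz'\<in>Rn (k * p). \<exists>\<beta>\<in>\<B>.
           (btheta p k r f \<theta> (inv_into (Rn p) (f 0) (blk p 0 bz))
              + mat_vec (p * (k - 1) + r) (k * p) (D0mat p k r) bz)
           - (btheta p k r f \<theta> (inv_into (Rn p) (f 0) (blk p 0 bz'))
              + mat_vec (p * (k - 1) + r) (k * p) (D0mat p k r) bz')
           = mat_vec (p * (k - 1) + r) (k * p) (transp \<beta>) (bz - bz')))"

definition is_perp :: "nat \<Rightarrow> nat \<Rightarrow> (nat \<Rightarrow> nat \<Rightarrow> real) \<Rightarrow> (nat \<Rightarrow> nat \<Rightarrow> real) \<Rightarrow> bool" where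
  "is_perp p r \<alpha> aperp \<longleftrightarrow> full_col_rank p (p - r) aperp \<and>
     (\<forall>i j. mat_mul (p - r) p r (transp aperp) \<alpha> i j = 0)"

definition is_traj :: "nat \<Rightarrow> nat \<Rightarrow> (nat \<Rightarrow> real) \<Rightarrow> (nat \<Rightarrow> (nat \<Rightarrow> real) \<Rightarrow> (nat \<Rightarrow> real)) \<Rightarrow>
    nat \<Rightarrow> (nat \<Rightarrow> real) \<Rightarrow> (nat \<Rightarrow> real) \<Rightarrow> (int \<Rightarrow> (nat \<Rightarrow> real)) \<Rightarrow> bool" where
  "is_traj p k c f \<tau> u zz z \<longleftrightarrow>
     (\<forall>t. int \<tau> - int k \<le> t \<longrightarrow> z t \<in> Rn p) \<and>
     (\<forall>i\<in>{1..k}. z (int \<tau> - int i) = blk p (i - 1) zz) \<and>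
     (\<forall>t. int \<tau> \<le> t \<longrightarrow>
        f 0 (z t) = c + (\<Sum>i\<in>{1..k}. f i (z (t - int i))) + (if t = int \<tau> then u else 0))"

definition conv_to :: "nat \<Rightarrow> nat \<Rightarrow> (nat \<Rightarrow> real) \<Rightarrow> (nat \<Rightarrow> (nat \<Rightarrow> real) \<Rightarrow> (nat \<Rightarrow> real)) \<Rightarrow>
    nat \<Rightarrow> (nat \<Rightarrow> real) \<Rightarrow> (nat \<Rightarrow> real) \<Rightarrow> (nat \<Rightarrow> real) \<Rightarrow> bool" where
  "conv_to p k c f \<tau> u zz zinf \<longleftrightarrow>
     (\<forall>z. is_traj p k c f \<tau> u zz z \<longrightarrow> (\<lambda>n. z (int \<tau> + int n)) \<longlonglongrightarrow> zinf)"

definition stable_set where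
  "stable_set p k c f \<tau> S \<longleftrightarrow>
     (\<forall>u\<in>Rn p. \<forall>zz\<in>Rn (k * p). \<exists>zinf\<in>S. conv_to p k c f \<tau> u zz zinf)"

definition nontrivial_attractor where
  "nontrivial_attractor p k c f \<tau> zinf \<longleftrightarrow> zinf \<in> Rn p \<and>
     (\<forall>zz\<in>Rn (k * p). \<exists>U. U \<noteq> {} \<and> U \<subseteq> Rn p \<and> (\<forall>u\<in>U. conv_to p k c f \<tau> u zz zinf))"

definition strictly_stable where
  "strictly_stable p k c f \<tau> S \<longleftrightarrow> stable_set p k c f \<tau> S \<and>
     (\<forall>z\<in>S. nontrivial_attractor p k c f \<tau> z)"

definition domain_of_attraction where
  "domain_of_attraction p k c f \<tau> zz zinf U \<longleftrightarrow>
     U \<noteq> {} \<and> U = {u \<in> Rn p. conv_to p k c f \<tau> u zz zinf}"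

end

theory Submission
  imports Defs "HOL-Complex_Analysis.Cauchy_Integral_Formula"
begin

text \<open>Follow the state \<open>x_t = (f_0(z_t), \<zeta>_t)\<close>, where \<open>\<zeta>_t\<close> stacks partial sums of the \<open>g_j\<close> at lagged values. It evolves by
  \<open>x_{t+1} = x_t + A \<xi>_t\<close> with \<open>A\<close> the bold alpha and \<open>\<xi>_t = (\<mu>, 0) + (\<theta>(z_t), g(z_t)) + D_0 x_t\<close>, and the hypothesis on increments gives
  \<open>\<xi>_{t+1} = (I + \<beta>_t^T A) \<xi>_t\<close>. If all such products decay geometrically, then \<open>x_t\<close> is Cauchy, its limit satisfies
  \<open>\<xi> = 0\<close>, i.e. \<open>\<theta> = -\<mu>\<close>, and \<open>\<alpha>_\<bottom>^T (f_0(z_t) - \<Sum> g_j(z_{t-j}))\<close>, which is constant along the path, fixes which point of the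
  steady set is reached. Running the same recursion from an arbitrary state solves \<open>\<chi>(z) = y\<close>, and a nonzero difference
  of two solutions would be a fixed vector of some \<open>I + \<beta>^T A\<close>, against the decay.

  The decay is the Berger--Wang theorem, since the joint spectral radius bounds only spectral radii of products. On a quotient
  of invariant subspaces without intermediate ones, the products normalised by the norm growth rate \<open>s\<close> are bounded. If \<open>s \<ge> 1\<close>,
  a long non-contracting orbit nearly returns to an earlier direction, so some long product nearly has the eigenvalue
  \<open>s^t\<close>; its annihilating polynomial has only small roots and excludes this. A chain of invariant subspaces gives the
  general case.\<close>

section \<open>Words and growth rates\<close>

text \<open>The order of the factors matters. Differences of states evolve by I + A \<beta>^T, which
  fixes the kernel of \<beta>^T, a space of dimension at least p - r > 0; the steady states form a
  continuum, so no contraction is possible there. Tracking \<xi> instead gives I + \<beta>^T A,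
  where these unit roots are gone. Eigenvectors of real maps are complex and do not survive
  restriction and quotients well. Small eigenvalues are therefore used only through a real
  polynomial relation for one vector at a time, which every invariant subspace inherits and which
  can be measured in any seminorm. Quotients are never formed: a norm on U / W is a seminorm
  vanishing on W. Words are sets of abstract linear maps for the same reason. The number 1/2 is a
  convenient gap below 1: spectral radii of products of length t fall below r^t for some r < 1,
  hence below 1/2 for all long words, and a monic polynomial with roots in that disc is at least
  (y/2)^d at every y at least 1. This is why the critical rate has to be at least 1 for the argument
  to bite.\<close>

primrec words :: "('a \<Rightarrow> 'a) set \<Rightarrow> nat \<Rightarrow> ('a \<Rightarrow> 'a) set" where
  "words \<A> 0 = {id}"
| "words \<A> (Suc t) = {F \<circ> P | F P. F \<in> \<A> \<and> P \<in> words \<A> t}"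

lemma words_SucI: "F \<in> \<A> \<Longrightarrow> P \<in> words \<A> t \<Longrightarrow> F \<circ> P \<in> words \<A> (Suc t)"
  by auto

lemma words_comp: "P \<in> words \<A> s \<Longrightarrow> Q \<in> words \<A> t \<Longrightarrow> P \<circ> Q \<in> words \<A> (s + t)"
proof (induction s arbitrary: P)
  case (Suc s)
  then obtain F P' where "F \<in> \<A>" "P' \<in> words \<A> s" "P = F \<circ> P'" by auto
  then show ?case using words_SucI[of F \<A> "P' \<circ> Q" "s + t"] Suc by (simp only: comp_assoc add_Suc)
qed simp

lemma words_split:
  assumes "P \<in> words \<A> (s + t)"
  obtains Q R where "Q \<in> words \<A> s" "R \<in> words \<A> t" "P = Q \<circ> R"
  using assms
proof (induction s arbitrary: P thesis)
  case (Suc s)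
  then obtain F P' where FP: "F \<in> \<A>" "P' \<in> words \<A> (s + t)" "P = F \<circ> P'" by auto
  from Suc.IH[OF _ FP(2)] obtain Q R where "Q \<in> words \<A> s" "R \<in> words \<A> t" "P' = Q \<circ> R" .
  with FP show ?case using Suc.prems(1)[of "F \<circ> Q" R] words_SucI[of F \<A> Q s] by (simp only: comp_assoc)
qed auto

lemma words_funpow: "P \<in> words \<A> t \<Longrightarrow> P ^^ j \<in> words \<A> (j * t)"
  by (induction j) (auto simp: id_def[symmetric] intro: words_comp)

text \<open>Turns a word into an orbit: \<open>R i\<close> consists of the \<open>i\<close> factors
  applied first, and the piece between two times is again a word of the right length. The near
  return of an orbit then concerns a genuine word.\<close>

lemma words_prefixes:
  assumes "P \<in> words \<A> T"
  obtains R where "R T = P" "\<And>i j. i \<le> j \<Longrightarrow> j \<le> T \<Longrightarrow> \<exists>S\<in>words \<A> (j - i). R j = S \<circ> R i" "R 0 = id"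
proof -
  have "\<exists>R. R T = P \<and> R 0 = id \<and> (\<forall>i j. i \<le> j \<longrightarrow> j \<le> T \<longrightarrow> (\<exists>S\<in>words \<A> (j - i). R j = S \<circ> R i))"
    using assms
  proof (induction T arbitrary: P)
    case 0
    then show ?case by (intro exI[of _ "\<lambda>_. id"]) auto
  next
    case (Suc T)
    then obtain F Q where FQ: "F \<in> \<A>" "Q \<in> words \<A> T" "P = F \<circ> Q" by auto
    from Suc.IH[OF FQ(2)] obtain R where R: "R T = Q" "R 0 = id"
      "\<And>i j. i \<le> j \<Longrightarrow> j \<le> T \<Longrightarrow> \<exists>S\<in>words \<A> (j - i). R j = S \<circ> R i" by blast
    define R' where "R' = R(Suc T := P)"
    have "\<exists>S\<in>words \<A> (j - i). R' j = S \<circ> R' i" if ij: "i \<le> j" "j \<le> Suc T" for i j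
    proof (cases "j = Suc T")
      case True
      show ?thesis
      proof (cases "i = Suc T")
        case True
        then show ?thesis using \<open>j = Suc T\<close> by simp
      next
        case False
        then obtain S where "S \<in> words \<A> (T - i)" "R T = S \<circ> R i" using R(3)[of i T] ij True by auto
        moreover have "Suc T - i = Suc (T - i)" using False ij True by simp
        ultimately show ?thesis using False True FQ R(1)
          using words_SucI[of F \<A> S "T - i"] by (intro bexI[of _ "F \<circ> S"]) (simp_all only: R'_def comp_assoc fun_upd_apply if_True if_False refl)
      qed
    next
      case False
      then show ?thesis using R(3)[of i j] ij by (simp add: R'_def)
    qed
    moreover have "R' (Suc T) = P" "R' 0 = id" using R(2) by (simp_all add: R'_def)
    ultimately show ?case by blast
  qed
  then show ?thesis using that by blast
qed

lemma words_linear: "\<forall>F\<in>\<A>. linear F \<Longrightarrow> P \<in> words \<A> t \<Longrightarrow> linear P"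
  by (induction t arbitrary: P) (auto simp: linear_id linear_compose)

definition preserves :: "('a \<Rightarrow> 'a) set \<Rightarrow> 'a set \<Rightarrow> bool" where
  "preserves \<A> U \<longleftrightarrow> (\<forall>F\<in>\<A>. \<forall>x\<in>U. F x \<in> U)"

lemma words_preserve:
  "preserves \<A> U \<Longrightarrow> P \<in> words \<A> t \<Longrightarrow> x \<in> U \<Longrightarrow> P x \<in> U"
  by (induction t arbitrary: P) (auto simp: preserves_def)

lemma words_crude_bound:
  fixes N :: "'a \<Rightarrow> real"
  assumes "preserves \<A> U"
    and "\<forall>F\<in>\<A>. \<forall>x\<in>U. N (F x) \<le> m * N x" and "0 \<le> m"
  shows "P \<in> words \<A> t \<Longrightarrow> x \<in> U \<Longrightarrow> N (P x) \<le> m ^ t * N x"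
proof (induction t arbitrary: P)
  case (Suc t)
  then obtain F Q where FQ: "F \<in> \<A>" "Q \<in> words \<A> t" "P = F \<circ> Q" by auto
  have "Q x \<in> U" using words_preserve[OF assms(1) FQ(2)] Suc.prems by blast
  then have "N (P x) \<le> m * N (Q x)" using assms(2) FQ by simp
  also have "\<dots> \<le> m * (m ^ t * N x)" using Suc.IH[OF FQ(2) Suc.prems(2)] assms(3) by (rule mult_left_mono)
  finally show ?case by (simp add: mult_ac)
qed auto

section \<open>Seminorms and uniform growth rates\<close>

definition seminorm :: "('v::real_vector \<Rightarrow> real) \<Rightarrow> bool" where
  "seminorm N \<longleftrightarrow> (\<forall>x y. N (x + y) \<le> N x + N y) \<and> (\<forall>c x. N (c *\<^sub>R x) = \<bar>c\<bar> * N x)"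

lemma seminormI: "(\<And>x y. N (x + y) \<le> N x + N y) \<Longrightarrow> (\<And>c x. N (c *\<^sub>R x) = \<bar>c\<bar> * N x) \<Longrightarrow> seminorm N"
  by (simp add: seminorm_def)

lemma seminorm_add: "seminorm N \<Longrightarrow> N (x + y) \<le> N x + N y"
  and seminorm_scale: "seminorm N \<Longrightarrow> N (c *\<^sub>R x) = \<bar>c\<bar> * N x"
  by (auto simp: seminorm_def)

lemma seminorm_zero: "seminorm N \<Longrightarrow> N 0 = 0"
  using seminorm_scale[of N 0 0] by simp

lemma seminorm_minus: "seminorm N \<Longrightarrow> N (- x) = N x"
  using seminorm_scale[of N "-1" x] by simp

lemma seminorm_minus_commute: "seminorm N \<Longrightarrow> N (x - y) = N (y - x)"
  using seminorm_minus[of N "x - y"] by simp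

lemma seminorm_nonneg: "seminorm N \<Longrightarrow> 0 \<le> N x"
  using seminorm_add[of N x "- x"] by (simp add: seminorm_zero seminorm_minus)

lemma seminorm_diff: "seminorm N \<Longrightarrow> N x \<le> N y + N (x - y)"
  using seminorm_add[of N y "x - y"] by simp

lemma seminorm_sum: "seminorm N \<Longrightarrow> N (\<Sum>i\<in>I. f i) \<le> (\<Sum>i\<in>I. N (f i))"
proof (induction I rule: infinite_finite_induct)
  case (insert i I)
  then show ?case using seminorm_add[of N "f i" "sum f I"] by simp
qed (auto simp: seminorm_zero)

lemma seminorm_linear_comp: "seminorm N \<Longrightarrow> linear F \<Longrightarrow> seminorm (\<lambda>x. N (F x))"
  by (auto simp: seminorm_def linear_add linear_scale)

lemma seminorm_add_scaled:
  assumes "seminorm N1" "seminorm N2" "0 \<le> k"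
  shows "seminorm (\<lambda>x. k * N1 x + N2 x)"
proof (rule seminormI)
  fix x y
  show "k * N1 (x + y) + N2 (x + y) \<le> k * N1 x + N2 x + (k * N1 y + N2 y)"
    using mult_left_mono[OF seminorm_add[OF assms(1), of x y] assms(3)] seminorm_add[OF assms(2), of x y]
    by (simp add: algebra_simps)
qed (simp add: seminorm_scale assms algebra_simps)

text \<open>The same seminorm stands on both sides, so vectors of \<open>U\<close> that are null for
  \<open>N\<close> stay null under all words; on a quotient this is what well-definedness amounts
  to.\<close>

definition grow :: "('v::real_vector \<Rightarrow> 'v) set \<Rightarrow> 'v set \<Rightarrow> ('v \<Rightarrow> real) \<Rightarrow> real \<Rightarrow> real \<Rightarrow> bool" where
  "grow \<A> U N C s \<longleftrightarrow> (\<forall>t. \<forall>P\<in>words \<A> t. \<forall>x\<in>U. N (P x) \<le> C * s ^ t * N x)"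

lemma growD: "grow \<A> U N C s \<Longrightarrow> P \<in> words \<A> t \<Longrightarrow> x \<in> U \<Longrightarrow> N (P x) \<le> C * s ^ t * N x"
  by (auto simp: grow_def)

text \<open>Cut a word into blocks of length \<open>T\<close>, each contributing
  \<open>s ^ T\<close>, and a remainder of fewer than \<open>T\<close> factors, which costs only a
  constant.\<close>

lemma contraction_imp_grow:
  assumes inv: "preserves \<A> U" and N: "seminorm N"
    and crude: "\<forall>F\<in>\<A>. \<forall>x\<in>U. N (F x) \<le> m * N x"
    and T: "1 \<le> T" and s: "0 < s"
    and contr: "\<forall>P\<in>words \<A> T. \<forall>x\<in>U. N (P x) \<le> s ^ T * N x"
  shows "\<exists>C\<ge>1. grow \<A> U N C s"
proof -
  define m' where "m' = max m 0"
  have crude': "\<forall>F\<in>\<A>. \<forall>x\<in>U. N (F x) \<le> m' * N x"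
  proof (intro ballI)
    fix F x assume "F \<in> \<A>" "x \<in> U"
    then have "N (F x) \<le> m * N x" using crude by blast
    also have "\<dots> \<le> m' * N x" using seminorm_nonneg[OF N] by (intro mult_right_mono) (auto simp: m'_def)
    finally show "N (F x) \<le> m' * N x" .
  qed
  \<comment> \<open>Chosen so that one factor costs at most \<open>k * s\<close>: the remainder then
    also runs at rate \<open>s\<close>, up to \<open>k ^ T\<close>.\<close>
  define k where "k = max 1 (m' / s)"
  have k1: "1 \<le> k" and mk: "m' \<le> k * s" using s by (auto simp: k_def max_def field_simps)
  have m0: "0 \<le> m'" by (simp add: m'_def)
  have multi: "N (P x) \<le> s ^ (i * T) * N x" if "P \<in> words \<A> (i * T)" "x \<in> U" for P x i
    using that
  proof (induction i arbitrary: P)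
    case (Suc i)
    then obtain Q R where QR: "Q \<in> words \<A> T" "R \<in> words \<A> (i * T)" "P = Q \<circ> R"
      using words_split[of P \<A> T "i * T"] by auto
    have "R x \<in> U" using words_preserve[OF inv QR(2)] Suc.prems by blast
    then have "N (P x) \<le> s ^ T * N (R x)" using contr QR by simp
    also have "\<dots> \<le> s ^ T * (s ^ (i * T) * N x)" using Suc.IH[OF QR(2)] Suc.prems s by (intro mult_left_mono) auto
    finally show ?case by (simp add: power_add mult_ac)
  qed simp
  have "N (P x) \<le> k ^ T * s ^ t * N x" if P: "P \<in> words \<A> t" and x: "x \<in> U" for P t x
  proof -
    have "t = (t div T) * T + t mod T" by simp
    then obtain Q R where QR: "Q \<in> words \<A> (t div T * T)" "R \<in> words \<A> (t mod T)" "P = Q \<circ> R"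
      using words_split[of P \<A> "t div T * T" "t mod T"] P by metis
    have Rx: "R x \<in> U" using words_preserve[OF inv QR(2)] x by blast
    have "N (R x) \<le> m' ^ (t mod T) * N x"
      by (rule words_crude_bound[OF inv crude' m0 QR(2) x])
    also have "\<dots> \<le> (k * s) ^ (t mod T) * N x"
      using mk m0 seminorm_nonneg[OF N] by (intro mult_right_mono power_mono) auto
    also have "\<dots> = k ^ (t mod T) * (s ^ (t mod T) * N x)" by (simp add: power_mult_distrib)
    also have "\<dots> \<le> k ^ T * (s ^ (t mod T) * N x)"
      using k1 T s seminorm_nonneg[OF N] by (intro mult_right_mono power_increasing) (auto intro: less_imp_le)
    finally have R: "N (R x) \<le> k ^ T * (s ^ (t mod T) * N x)" .
    have "N (P x) \<le> s ^ (t div T * T) * N (R x)" using multi[OF QR(1) Rx] QR(3) by simp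
    also have "\<dots> \<le> s ^ (t div T * T) * (k ^ T * (s ^ (t mod T) * N x))"
      using R s by (intro mult_left_mono) auto
    also have "\<dots> = k ^ T * (s ^ (t div T * T) * s ^ (t mod T)) * N x" by (simp add: mult_ac)
    also have "s ^ (t div T * T) * s ^ (t mod T) = s ^ t" by (simp flip: power_add)
    finally show ?thesis .
  qed
  moreover have "1 \<le> k ^ T" using k1 by simp
  ultimately show ?thesis unfolding grow_def by blast
qed

text \<open>Replacing \<open>S\<close> by the scalar \<open>y\<close> in the annihilating polynomial costs a multiple of the residual \<open>S v - y v\<close>, while the polynomial is
  large at \<open>y\<close>.\<close>
lemma almost_eigenvector_bound:
  fixes S :: "'v::real_vector \<Rightarrow> 'v" and y C e :: real
  assumes S: "linear S" and N: "seminorm N" and y: "1 \<le> y" and C: "0 \<le> C" and e: "0 \<le> e"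
    and inv: "\<And>w. w \<in> U \<Longrightarrow> S w \<in> U" and U: "subspace U"
    and bound: "\<And>w j. w \<in> U \<Longrightarrow> N ((S ^^ j) w) \<le> C * y ^ j * N w"
    and v: "v \<in> U" and close: "N (S v - y *\<^sub>R v) \<le> e * y"
    and d: "d \<le> n" and a: "\<And>j. j \<le> d \<Longrightarrow> \<bar>a j\<bar> \<le> 2 ^ n"
    and q: "(y / 2) ^ d \<le> \<bar>\<Sum>j\<le>d. a j * y ^ j\<bar>"
    and ann: "(\<Sum>j\<le>d. a j *\<^sub>R (S ^^ j) v) = 0"
  shows "(1/2) ^ n * N v \<le> (real n + 1) * real n * 2 ^ n * C * e"
proof -
  have lin: "linear (S ^^ j)" for j
  proof (induction j)
    case (Suc j)
    then show ?case using linear_compose[OF Suc S] by (simp only: funpow.simps)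
  qed (simp add: linear_id[unfolded id_def])
  have Sv: "S v - y *\<^sub>R v \<in> U" using U inv[OF v] v by (intro subspace_diff subspace_scale) auto
  \<comment> \<open>The residual enters once per factor and each time is transported by a power of
    \<open>S\<close> bounded at rate \<open>y\<close>; hence the growth in \<open>j\<close> is only
    linear beyond \<open>y ^ j\<close>.\<close>
  have diff: "N ((S ^^ j) v - y ^ j *\<^sub>R v) \<le> j * C * e * y ^ j" for j
  proof (induction j)
    case 0
    then show ?case using seminorm_zero[OF N] by simp
  next
    case (Suc j)
    have "(S ^^ Suc j) v - y ^ Suc j *\<^sub>R v = (S ^^ j) (S v - y *\<^sub>R v) + y *\<^sub>R ((S ^^ j) v - y ^ j *\<^sub>R v)"
      by (simp add: linear_diff[OF lin] linear_scale[OF lin] funpow_swap1 scaleR_right_diff_distrib)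
    then have "N ((S ^^ Suc j) v - y ^ Suc j *\<^sub>R v) \<le> N ((S ^^ j) (S v - y *\<^sub>R v)) + y * N ((S ^^ j) v - y ^ j *\<^sub>R v)"
      using seminorm_add[OF N, of "(S ^^ j) (S v - y *\<^sub>R v)" "y *\<^sub>R ((S ^^ j) v - y ^ j *\<^sub>R v)"] y
      by (simp add: seminorm_scale[OF N])
    also have "\<dots> \<le> C * y ^ j * (e * y) + y * (j * C * e * y ^ j)"
    proof (intro add_mono mult_left_mono Suc.IH)
      have "N ((S ^^ j) (S v - y *\<^sub>R v)) \<le> C * y ^ j * N (S v - y *\<^sub>R v)" by (rule bound[OF Sv])
      also have "\<dots> \<le> C * y ^ j * (e * y)" using C y close by (intro mult_left_mono) auto
      finally show "N ((S ^^ j) (S v - y *\<^sub>R v)) \<le> C * y ^ j * (e * y)" .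
    qed (use y in auto)
    also have "\<dots> = real (Suc j) * C * e * y ^ Suc j" by (simp add: algebra_simps)
    finally show ?case .
  qed
  have Nv: "0 \<le> N v" by (rule seminorm_nonneg[OF N])
  have "(\<Sum>j\<le>d. a j * y ^ j) *\<^sub>R v = (\<Sum>j\<le>d. - a j *\<^sub>R ((S ^^ j) v - y ^ j *\<^sub>R v)) + (\<Sum>j\<le>d. a j *\<^sub>R (S ^^ j) v)"
    by (simp add: scaleR_sum_left scaleR_right_diff_distrib sum_subtractf sum_negf)
  then have eq: "(\<Sum>j\<le>d. a j * y ^ j) *\<^sub>R v = (\<Sum>j\<le>d. - a j *\<^sub>R ((S ^^ j) v - y ^ j *\<^sub>R v))"
    using ann by simp
  have "(y / 2) ^ d * N v \<le> \<bar>\<Sum>j\<le>d. a j * y ^ j\<bar> * N v" using q Nv by (rule mult_right_mono)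
  also have "\<dots> = N (\<Sum>j\<le>d. - a j *\<^sub>R ((S ^^ j) v - y ^ j *\<^sub>R v))"
    by (subst eq[symmetric]) (simp add: seminorm_scale[OF N])
  also have "\<dots> \<le> (\<Sum>j\<le>d. \<bar>a j\<bar> * N ((S ^^ j) v - y ^ j *\<^sub>R v))"
    by (rule order_trans[OF seminorm_sum[OF N]]) (simp only: seminorm_scale[OF N] abs_minus_cancel order_refl)
  also have "\<dots> \<le> (\<Sum>j\<le>d. 2 ^ n * (n * C * e * y ^ d))"
  proof (intro sum_mono mult_mono)
    fix j assume j: "j \<in> {..d}"
    have "N ((S ^^ j) v - y ^ j *\<^sub>R v) \<le> j * C * e * y ^ j" by (rule diff)
    also have "\<dots> \<le> n * C * e * y ^ d"
      using j d C e y by (intro mult_mono power_increasing) auto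
    finally show "N ((S ^^ j) v - y ^ j *\<^sub>R v) \<le> n * C * e * y ^ d" .
  qed (use a seminorm_nonneg[OF N] in auto)
  also have "\<dots> = (real d + 1) * (2 ^ n * real n * C * e) * y ^ d" by simp
  also have "\<dots> \<le> (real n + 1) * (2 ^ n * real n * C * e) * y ^ d"
    using d C e y by (intro mult_right_mono) auto
  \<comment> \<open>Both sides carry \<open>y ^ d\<close>. Its cancellation makes the bound uniform
    in \<open>y\<close>, which will be \<open>s ^ t\<close> with \<open>t\<close> unbounded.\<close>
  finally have "(1/2) ^ d * N v * y ^ d \<le> (real n + 1) * real n * 2 ^ n * C * e * y ^ d"
    by (simp add: power_divide mult_ac)
  then have "(1/2) ^ d * N v \<le> (real n + 1) * real n * 2 ^ n * C * e"
    using y by (simp add: mult_le_cancel_right)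
  moreover have "(1/2) ^ n * N v \<le> (1/2) ^ d * N v"
    using d Nv by (intro mult_right_mono power_decreasing) auto
  ultimately show ?thesis by linarith
qed

section \<open>The Berger--Wang theorem\<close>

text \<open>A real stand-in for "all eigenvalues of \<open>S\<close> have modulus at most 1/2" that survives passing to seminorms of quotients:
  the polynomial kills \<open>x\<close>, and the two bounds are those of a monic polynomial of degree \<open>d\<close> with all roots in that disc.\<close>
definition annihilated :: "nat \<Rightarrow> ('v::real_vector \<Rightarrow> 'v) \<Rightarrow> 'v \<Rightarrow> bool" where
  "annihilated n S x \<longleftrightarrow> (\<exists>d\<le>n. \<exists>a::nat \<Rightarrow> real. (\<forall>j\<le>d. \<bar>a j\<bar> \<le> 2 ^ n) \<and>
     (\<forall>y\<ge>1. (y / 2) ^ d \<le> \<bar>\<Sum>j\<le>d. a j * y ^ j\<bar>) \<and> (\<Sum>j\<le>d. a j *\<^sub>R (S ^^ j) x) = 0)"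

text \<open>Stated as a pigeonhole principle with \<open>m\<close> depending only on
  \<open>R\<close> and \<open>\<epsilon>\<close>, so that the length of a word can be fixed before
  the word and its orbit are known.\<close>

definition totally_bounded :: "'v::real_vector set \<Rightarrow> ('v \<Rightarrow> real) \<Rightarrow> bool" where
  "totally_bounded U N \<longleftrightarrow> (\<forall>R \<epsilon>. 0 < \<epsilon> \<longrightarrow> (\<exists>m. \<forall>y::nat \<Rightarrow> 'v. (\<forall>i\<le>m. y i \<in> U \<and> N (y i) \<le> R) \<longrightarrow>
     (\<exists>i j. i < j \<and> j \<le> m \<and> N (y j - y i) \<le> \<epsilon>)))"

text \<open>Otherwise some orbit, rescaled to \<open>y_i = x_i / s^i\<close>, stays in an annulus; by the pigeonhole principle two of its points at
  times at least \<open>L\<close> apart are close, and the word between them has an almost eigenvector for \<open>s^t\<close>.\<close>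
lemma grow_imp_contraction:
  fixes \<A> :: "('v::real_vector \<Rightarrow> 'v) set" and s :: real
  assumes lin: "\<forall>F\<in>\<A>. linear F" and U: "subspace U" and inv: "preserves \<A> U"
    and N: "seminorm N" and tb: "totally_bounded U N"
    and ann: "\<forall>t\<ge>L. \<forall>P\<in>words \<A> t. \<forall>x\<in>U. annihilated n P x"
    and gr: "grow \<A> U N C s" and s: "1 \<le> s"
  shows "\<exists>T\<ge>1. \<forall>P\<in>words \<A> T. \<forall>x\<in>U. N (P x) \<le> 1/2 * s ^ T * N x"
proof (rule ccontr)
  assume neg: "\<not> ?thesis"
  define C' where "C' = max C 1"
  have C': "1 \<le> C'" "C \<le> C'" by (auto simp: C'_def)
  have bnd: "N (P x) \<le> C' * s ^ t * N x" if "P \<in> words \<A> t" "x \<in> U" for P t x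
  proof -
    have "C * (s ^ t * N x) \<le> C' * (s ^ t * N x)"
      using C'(2) s seminorm_nonneg[OF N, of x] by (intro mult_right_mono) auto
    then show ?thesis using growD[OF gr that] by (simp add: mult.assoc)
  qed
  \<comment> \<open>\<open>K * \<epsilon>\<close> is the error bound for an almost eigenvector with
    residual \<open>\<epsilon>\<close>; \<open>\<epsilon>\<close> is tuned so that
    \<open>K * \<epsilon>\<close> is below \<open>(1/2) ^ n / (4 * C')\<close>, while orbit points
    have size at least \<open>1 / (2 * C')\<close>. The \<open>+ 1\<close> covers
    \<open>K = 0\<close>.\<close>
  define K where "K = (real n + 1) * n * 2 ^ n * C'"
  define \<epsilon> where "\<epsilon> = (1/2) ^ n / (4 * C' * (K + 1))"
  have K: "0 \<le> K" using C' by (simp add: K_def)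
  have \<epsilon>: "0 < \<epsilon>" using C' K by (simp add: \<epsilon>_def)
  obtain m where m: "\<forall>y::nat \<Rightarrow> 'v. (\<forall>i\<le>m. y i \<in> U \<and> N (y i) \<le> C') \<longrightarrow> (\<exists>i j. i < j \<and> j \<le> m \<and> N (y j - y i) \<le> \<epsilon>)"
    using tb[unfolded totally_bounded_def, THEN spec, of C', THEN spec, of \<epsilon>, THEN mp, OF \<epsilon>] by (rule exE)
  \<comment> \<open>Sampling the orbit only at multiples of \<open>L'\<close> makes the word between
    two samples long enough for its annihilating polynomials to be available.\<close>
  define L' where "L' = max L 1"
  define T where "T = (m + 1) * L'"
  have "1 \<le> T" by (simp add: T_def L'_def)
  with neg obtain P x where P: "P \<in> words \<A> T" and x: "x \<in> U" and big: "1/2 * s ^ T * N x < N (P x)"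
    by (metis not_le)
  have Nx: "0 < N x"
  proof (rule ccontr)
    assume "\<not> 0 < N x"
    then have "N x = 0" using seminorm_nonneg[OF N, of x] by simp
    then show False using big bnd[OF P x] by simp
  qed
  from words_prefixes[OF P] obtain R where R: "R T = P" "R 0 = id"
    "\<And>i j. i \<le> j \<Longrightarrow> j \<le> T \<Longrightarrow> \<exists>S\<in>words \<A> (j - i). R j = S \<circ> R i" by metis
  have Rw: "R i \<in> words \<A> i" if "i \<le> T" for i using R(3)[of 0 i] R(2) that by auto
  have RU: "R i x \<in> U" if "i \<le> T" for i using words_preserve[OF inv Rw[OF that] x] .
  define y where "y = (\<lambda>i. (1 / (s ^ i * N x)) *\<^sub>R R i x)"
  have yU: "y i \<in> U" if "i \<le> T" for i using RU[OF that] U by (auto simp: y_def intro: subspace_scale)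
  have Ny: "N (y i) = N (R i x) / (s ^ i * N x)" for i
    using Nx s by (simp add: y_def seminorm_scale[OF N])
  have y_up: "N (y i) \<le> C'" if "i \<le> T" for i
    using bnd[OF Rw[OF that] x] Nx s by (simp add: Ny divide_le_eq mult_ac)
  \<comment> \<open>The rest of the word enlarges \<open>R i x\<close> by at most
    \<open>C' * s ^ (T - i)\<close>, so an orbit that ends large cannot have been small
    earlier.\<close>
  have y_low: "1 / (2 * C') \<le> N (y i)" if i: "i \<le> T" for i
  proof -
    obtain S where S: "S \<in> words \<A> (T - i)" "R T = S \<circ> R i" using R(3)[OF i order_refl] by auto
    have "1/2 * s ^ T * N x < N (S (R i x))" using big S R(1) by simp
    also have "\<dots> \<le> C' * s ^ (T - i) * N (R i x)" by (rule bnd[OF S(1) RU[OF i]])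
    finally have "s ^ T * N x < 2 * C' * s ^ (T - i) * N (R i x)" by simp
    moreover have "s ^ T = s ^ (T - i) * s ^ i" using i by (simp flip: power_add)
    ultimately have "s ^ (T - i) * (s ^ i * N x) < s ^ (T - i) * (2 * C' * N (R i x))" by (simp add: mult_ac)
    then have "s ^ i * N x < 2 * C' * N (R i x)" using s by (simp add: mult_less_cancel_left)
    then show ?thesis using C' Nx s by (simp add: Ny field_simps)
  qed
  have le: "i * L' \<le> T" if "i \<le> m" for i using that unfolding T_def by (intro mult_right_mono) auto
  obtain i j where ij: "i < j" "j \<le> m" "N (y (j * L') - y (i * L')) \<le> \<epsilon>"
    using m[THEN spec, of "\<lambda>i. y (i * L')"] yU y_up le by blast
  define a b where "a = i * L'" and "b = j * L'"
  have ab: "a \<le> b" "b \<le> T" using ij le by (auto simp: a_def b_def)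
  have aT: "a \<le> T" using ab by simp
  have len: "L \<le> b - a"
  proof -
    have "Suc i * L' \<le> j * L'" using ij by (intro mult_right_mono) auto
    then show ?thesis by (simp add: a_def b_def L'_def)
  qed
  obtain S where S: "S \<in> words \<A> (b - a)" "R b = S \<circ> R a" using R(3)[OF ab] by auto
  have linS: "linear S" by (rule words_linear[OF lin S(1)])
  have sb: "s ^ b = s ^ (b - a) * s ^ a" using ab by (simp flip: power_add)
  have Sy: "S (y a) = s ^ (b - a) *\<^sub>R y b"
    using S(2) s by (simp add: y_def linear_scale[OF linS] sb)
  have close: "N (S (y a) - s ^ (b - a) *\<^sub>R y a) \<le> \<epsilon> * s ^ (b - a)"
  proof -
    have "S (y a) - s ^ (b - a) *\<^sub>R y a = s ^ (b - a) *\<^sub>R (y b - y a)"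
      by (simp add: Sy scaleR_right_diff_distrib)
    then have "N (S (y a) - s ^ (b - a) *\<^sub>R y a) = s ^ (b - a) * N (y b - y a)"
      using s by (simp add: seminorm_scale[OF N])
    then show ?thesis using ij(3) s by (simp add: a_def b_def mult.commute)
  qed
  obtain d c where dc: "d \<le> n" "\<And>j. j \<le> d \<Longrightarrow> \<bar>c j\<bar> \<le> 2 ^ n"
    "\<And>y::real. 1 \<le> y \<Longrightarrow> (y / 2) ^ d \<le> \<bar>\<Sum>j\<le>d. c j * y ^ j\<bar>" "(\<Sum>j\<le>d. c j *\<^sub>R (S ^^ j) (y a)) = 0"
    using ann len S(1) yU[OF aT] unfolding annihilated_def by blast
  have powb: "N ((S ^^ j) w) \<le> C' * (s ^ (b - a)) ^ j * N w" if "w \<in> U" for j w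
    using bnd[OF words_funpow[OF S(1)] that, of j] by (simp add: power_mult mult.commute[of j])
  have "(1/2) ^ n * N (y a) \<le> (real n + 1) * n * 2 ^ n * C' * \<epsilon>"
    using almost_eigenvector_bound[OF linS N _ _ _ _ U powb yU[OF aT] close dc(1,2) dc(3) dc(4)]
      words_preserve[OF inv S(1)] C' \<epsilon> s by simp
  then have "(1/2) ^ n * (1 / (2 * C')) \<le> K * \<epsilon>"
    using mult_left_mono[OF y_low[OF aT], of "(1/2) ^ n"] by (simp add: K_def)
  also have "\<dots> < (K + 1) * \<epsilon>" using \<epsilon> by simp
  also have "\<dots> = (1/2) ^ n * (1 / (4 * C'))"
  proof -
    have "K + 1 \<noteq> 0" using K by simp
    then show ?thesis by (simp add: \<epsilon>_def)
  qed
  finally have "1 / (2 * C') < 1 / (4 * C')" by (subst (asm) mult_less_cancel_left_pos) auto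
  then show False using C' by (simp add: field_simps)
qed

text \<open>A rate of at least 1 that is attained with a constant is never optimal: the factor 1/2
  gained over \<open>T\<close> steps, spread evenly, lowers \<open>s\<close> to
  \<open>s * root T (1/2)\<close>. This is the contradiction at the critical rate.\<close>

lemma grow_improve:
  fixes \<A> :: "('v::real_vector \<Rightarrow> 'v) set" and s :: real
  assumes lin: "\<forall>F\<in>\<A>. linear F" and U: "subspace U" and inv: "preserves \<A> U"
    and N: "seminorm N" and tb: "totally_bounded U N"
    and crude: "\<forall>F\<in>\<A>. \<forall>x\<in>U. N (F x) \<le> m * N x"
    and ann: "\<forall>t\<ge>L. \<forall>P\<in>words \<A> t. \<forall>x\<in>U. annihilated n P x"
    and gr: "grow \<A> U N C s" and s: "1 \<le> s"
  shows "\<exists>s'. 0 < s' \<and> s' < s \<and> (\<exists>C\<ge>1. grow \<A> U N C s')"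
proof -
  obtain T where T: "1 \<le> T" "\<forall>P\<in>words \<A> T. \<forall>x\<in>U. N (P x) \<le> 1/2 * s ^ T * N x"
    using grow_imp_contraction[OF lin U inv N tb ann gr s] by blast
  define s' where "s' = s * root T (1/2)"
  have r: "0 < root T (1/2)" "root T (1/2) < 1" using T real_root_lt_1_iff[of T "1/2"] by auto
  have pw: "s' ^ T = 1/2 * s ^ T" using T by (simp add: s'_def power_mult_distrib)
  have "\<exists>C\<ge>1. grow \<A> U N C s'"
  proof (rule contraction_imp_grow[OF inv N crude T(1)])
    show "0 < s'" using s r by (simp add: s'_def)
    show "\<forall>P\<in>words \<A> T. \<forall>x\<in>U. N (P x) \<le> s' ^ T * N x" using T(2) unfolding pw .
  qed
  moreover have "0 < s'" "s' < s" using s r by (auto simp: s'_def)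
  ultimately show ?thesis by blast
qed

section \<open>Coordinates on a finite-dimensional quotient\<close>

lemma complement_coordinates:
  fixes U W :: "'v::real_vector set"
  assumes B: "finite B" "U \<subseteq> span B" and U: "subspace U" and W: "subspace W" "W \<subseteq> U"
  obtains D :: "'v set" and c :: "'v \<Rightarrow> 'v \<Rightarrow> real" where
    "finite D" "D \<subseteq> U" "\<And>b. linear (c b)"
    "\<And>b b'. b \<in> D \<Longrightarrow> b' \<in> D \<Longrightarrow> c b b' = (if b = b' then 1 else 0)"
    "\<And>b x. b \<in> D \<Longrightarrow> x \<in> W \<Longrightarrow> c b x = 0"
    "\<And>x. x \<in> U \<Longrightarrow> x - (\<Sum>b\<in>D. c b x *\<^sub>R b) \<in> W"
proof -
  \<comment> \<open>A basis of \<open>W\<close> is extended to one of \<open>U\<close> and then to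
    one of the whole space. The last extension makes the coordinate functionals linear everywhere;
    \<open>D\<close> consists of the basis vectors added between \<open>W\<close> and
    \<open>U\<close>.\<close>
  obtain B1 where B1: "B1 \<subseteq> W" "independent B1" "W \<subseteq> span B1" using maximal_independent_subset[of W] .
  obtain B2 where B2: "B1 \<subseteq> B2" "B2 \<subseteq> U" "independent B2" "U \<subseteq> span B2"
    using maximal_independent_subset_extend[of B1 U] B1(1,2) W(2) by blast
  have fB2: "finite B2" using independent_span_bound[of B B2] B B2 by blast
  define E where "E = extend_basis B2"
  have E: "B2 \<subseteq> E" "independent E" "span E = UNIV"
    using B2(3) by (auto simp: E_def extend_basis_superset independent_extend_basis)
  define c where "c = (\<lambda>b x. representation E x b)"
  define D where "D = B2 - B1"
  show ?thesis
  proof (rule that[of D c])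
    show "finite D" using fB2 by (simp add: D_def)
    show "D \<subseteq> U" using B2 by (auto simp: D_def)
    show "linear (c b)" for b
      by (rule linearI) (simp_all add: c_def E representation_add representation_scale)
    show "c b b' = (if b = b' then 1 else 0)" if "b \<in> D" "b' \<in> D" for b b'
      using that E B2 by (auto simp: c_def D_def representation_basis)
    show "c b x = 0" if "b \<in> D" "x \<in> W" for b x
    proof -
      have "representation E x = representation B1 x"
        using that B1 B2 E by (intro representation_extend) auto
      then show ?thesis using that representation_ne_zero[of B1 x b] by (auto simp: c_def D_def)
    qed
    show "x - (\<Sum>b\<in>D. c b x *\<^sub>R b) \<in> W" if x: "x \<in> U" for x
    proof -
      have "representation E x = representation B2 x"
        using x B2 E by (intro representation_extend) auto
      then have "x = (\<Sum>b\<in>B2. c b x *\<^sub>R b)"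
        using sum_representation_eq[of B2 x B2] x B2 fB2 by (auto simp: c_def)
      also have "\<dots> = (\<Sum>b\<in>D. c b x *\<^sub>R b) + (\<Sum>b\<in>B1. c b x *\<^sub>R b)"
        unfolding D_def using fB2 B2(1) by (rule sum.subset_diff[rotated])
      finally have "x - (\<Sum>b\<in>D. c b x *\<^sub>R b) = (\<Sum>b\<in>B1. c b x *\<^sub>R b)" by (metis add_diff_cancel_left')
      also have "\<dots> \<in> W" using B1 W by (intro subspace_sum subspace_scale) auto
      finally show ?thesis .
    qed
  qed
qed

lemma seminorm_coordinates:
  assumes "\<And>b. linear (c b)"
  shows "seminorm (\<lambda>x. \<Sum>b\<in>D. \<bar>c b x\<bar> :: real)"
  using assms
  by (intro seminormI)
    (auto simp: linear_add linear_scale abs_mult sum_distrib_left simp flip: sum.distrib intro!: sum_mono abs_triangle_ineq)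

text \<open>Points of the ball fall into finitely many cells of a grid of mesh
  \<open>\<delta>\<close>; two in the same cell differ by at most \<open>\<delta>\<close> in each
  coordinate.\<close>

lemma totally_bounded_coordinates:
  fixes c :: "'b \<Rightarrow> 'v::real_vector \<Rightarrow> real"
  assumes lin: "\<And>b. linear (c b)" and D: "finite D"
  shows "totally_bounded U (\<lambda>x. \<Sum>b\<in>D. \<bar>c b x\<bar>)"
  unfolding totally_bounded_def
proof (intro allI impI)
  fix R \<epsilon> :: real assume \<epsilon>: "0 < \<epsilon>"
  \<comment> \<open>The \<open>+ 1\<close> keeps the mesh positive and well defined when
    \<open>D\<close> is empty.\<close>
  define \<delta> where "\<delta> = \<epsilon> / (card D + 1)"
  have \<delta>: "0 < \<delta>" using \<epsilon> by (simp add: \<delta>_def)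
  define S where "S = PiE D (\<lambda>_. {\<lfloor>- R / \<delta>\<rfloor>..\<lfloor>R / \<delta>\<rfloor>})"
  have fS: "finite S" using D by (simp add: S_def finite_PiE)
  show "\<exists>m. \<forall>y::nat \<Rightarrow> 'v. (\<forall>i\<le>m. y i \<in> U \<and> (\<Sum>b\<in>D. \<bar>c b (y i)\<bar>) \<le> R) \<longrightarrow>
     (\<exists>i j. i < j \<and> j \<le> m \<and> (\<Sum>b\<in>D. \<bar>c b (y j - y i)\<bar>) \<le> \<epsilon>)"
  proof (rule exI[of _ "card S"], intro allI impI)
    fix y :: "nat \<Rightarrow> 'v" assume y: "\<forall>i\<le>card S. y i \<in> U \<and> (\<Sum>b\<in>D. \<bar>c b (y i)\<bar>) \<le> R"
    define cell where "cell i = (\<lambda>b\<in>D. \<lfloor>c b (y i) / \<delta>\<rfloor>)" for i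
    have "cell ` {..card S} \<subseteq> S"
    proof (rule image_subsetI)
      fix i assume i: "i \<in> {..card S}"
      have "- R \<le> c b (y i) \<and> c b (y i) \<le> R" if "b \<in> D" for b
      proof -
        have "\<bar>c b (y i)\<bar> \<le> (\<Sum>b\<in>D. \<bar>c b (y i)\<bar>)" using that D by (intro member_le_sum) auto
        then show ?thesis using y i by auto
      qed
      then have "- R / \<delta> \<le> c b (y i) / \<delta> \<and> c b (y i) / \<delta> \<le> R / \<delta>" if "b \<in> D" for b
        using that \<delta> by (intro conjI divide_right_mono) auto
      then show "cell i \<in> S" by (simp add: cell_def S_def PiE_iff floor_mono)
    qed
    then have "card (cell ` {..card S}) < card {..card S}"
      using card_mono[OF fS] by (metis card_atMost le_imp_less_Suc)
    then have "\<not> inj_on cell {..card S}" by (rule pigeonhole)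
    then obtain i j where ij: "i < j" "j \<le> card S" "cell i = cell j"
      by (metis atMost_iff inj_onI linorder_neqE_nat)
    have "\<bar>c b (y j - y i)\<bar> \<le> \<delta>" if b: "b \<in> D" for b
    proof -
      have fl: "\<lfloor>c b (y i) / \<delta>\<rfloor> = \<lfloor>c b (y j) / \<delta>\<rfloor>"
        using fun_cong[OF ij(3), of b] b by (simp add: cell_def)
      have "\<bar>c b (y j) / \<delta> - c b (y i) / \<delta>\<bar> \<le> 1" using fl by linarith
      then have "\<bar>(c b (y j) - c b (y i)) / \<delta>\<bar> \<le> 1" by (simp add: diff_divide_distrib)
      then show ?thesis using \<delta> by (simp add: linear_diff[OF lin] abs_divide)
    qed
    then have "(\<Sum>b\<in>D. \<bar>c b (y j - y i)\<bar>) \<le> (\<Sum>b\<in>D. \<delta>)" by (rule sum_mono)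
    also have "\<dots> \<le> \<epsilon>" using \<epsilon> by (simp add: \<delta>_def field_simps)
    finally show "\<exists>i j. i < j \<and> j \<le> card S \<and> (\<Sum>b\<in>D. \<bar>c b (y j - y i)\<bar>) \<le> \<epsilon>" using ij by blast
  qed
qed

lemma common_convergent_subsequence:
  fixes f :: "'b \<Rightarrow> nat \<Rightarrow> real"
  assumes "finite I" and "\<And>i j. i \<in> I \<Longrightarrow> \<bar>f i j\<bar> \<le> R"
  shows "\<exists>r l. strict_mono (r :: nat \<Rightarrow> nat) \<and> (\<forall>i\<in>I. (\<lambda>j. f i (r j)) \<longlonglongrightarrow> l i)"
  using assms
proof (induction I)
  case empty
  then show ?case by (auto intro!: exI[of _ id] strict_mono_id)
next
  case (insert i I)
  then obtain r l where r: "strict_mono r" "\<And>i. i \<in> I \<Longrightarrow> (\<lambda>j. f i (r j)) \<longlonglongrightarrow> l i" by (metis insert_iff)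
  have "bounded (range (\<lambda>j. f i (r j)))" using insert.prems by (auto simp: bounded_iff)
  then obtain l' r' where r': "strict_mono r'" "((\<lambda>j. f i (r j)) \<circ> r') \<longlonglongrightarrow> l'"
    using bounded_imp_convergent_subsequence by blast
  have "(\<lambda>j. f i' ((r \<circ> r') j)) \<longlonglongrightarrow> (l(i := l')) i'" if "i' \<in> insert i I" for i'
    using LIMSEQ_subseq_LIMSEQ[OF r(2) r'(1), of i'] r'(2) that by (auto simp: o_def)
  then show ?case using strict_mono_o[OF r(1) r'(1)] by blast
qed

text \<open>Compactness of balls in the quotient. The limit is lifted into the span of
  \<open>D\<close>; convergence is claimed only in the coordinates, that is modulo the subspace they
  vanish on.\<close>

lemma coordinates_compact:
  fixes c :: "'v \<Rightarrow> 'v::real_vector \<Rightarrow> real"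
  assumes lin: "\<And>b. linear (c b)" and D: "finite D" "D \<subseteq> U" and U: "subspace U"
    and dual: "\<And>b b'. b \<in> D \<Longrightarrow> b' \<in> D \<Longrightarrow> c b b' = (if b = b' then 1 else 0)"
    and x: "\<And>j. (\<Sum>b\<in>D. \<bar>c b (x j)\<bar>) \<le> R"
  obtains l r where "l \<in> U" "strict_mono (r :: nat \<Rightarrow> nat)" "(\<lambda>j. \<Sum>b\<in>D. \<bar>c b (x (r j) - l)\<bar>) \<longlonglongrightarrow> 0"
proof -
  have "\<bar>c b (x j)\<bar> \<le> R" if "b \<in> D" for b j
    using member_le_sum[of b D "\<lambda>b. \<bar>c b (x j)\<bar>"] that D x[of j] by simp
  then obtain r l where r: "strict_mono r" "\<And>b. b \<in> D \<Longrightarrow> (\<lambda>j. c b (x (r j))) \<longlonglongrightarrow> l b"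
    using common_convergent_subsequence[OF D(1), of "\<lambda>b j. c b (x j)" R] by blast
  define z where "z = (\<Sum>b\<in>D. l b *\<^sub>R b)"
  have zU: "z \<in> U" using D U by (auto simp: z_def intro!: subspace_sum subspace_scale)
  have cz: "c b z = l b" if "b \<in> D" for b
    using that D by (simp add: z_def linear_sum[OF lin] linear_scale[OF lin] dual if_distrib cong: if_cong)
  have "(\<lambda>j. \<Sum>b\<in>D. \<bar>c b (x (r j) - z)\<bar>) \<longlonglongrightarrow> (\<Sum>b\<in>D. \<bar>l b - c b z\<bar>)"
    unfolding linear_diff[OF lin] by (intro tendsto_intros r(2)) auto
  then show ?thesis using that[OF zU r(1)] cz by simp
qed

text \<open>The ambient space may be infinite-dimensional, as it is for functions on nat; the finite
  spanning set \<open>B\<close> is what makes \<open>dim\<close> strictly monotone.\<close>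

lemma dim_psubset_finite:
  fixes U W :: "'v::real_vector set"
  assumes "finite B" "U \<subseteq> span B" "subspace W" "W \<subset> U"
  shows "dim W < dim U"
proof -
  obtain B1 where B1: "B1 \<subseteq> W" "independent B1" "W \<subseteq> span B1" using maximal_independent_subset[of W] .
  obtain B2 where B2: "B1 \<subseteq> B2" "B2 \<subseteq> U" "independent B2" "U \<subseteq> span B2"
    using maximal_independent_subset_extend[of B1 U] B1(1,2) assms(4) by blast
  have "finite B2" using independent_span_bound[of B B2] assms B2 by blast
  moreover have "span B1 \<subseteq> W" using B1(1) assms(3) by (rule span_minimal)
  then have "B1 \<noteq> B2" using B2(4) assms(4) by auto
  ultimately have "card B1 < card B2" using B2(1) by (intro psubset_card_mono) auto
  then show ?thesis using dim_unique[OF B1(1,3,2) refl] dim_unique[OF B2(2,4,3) refl] by simp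
qed

text \<open>\<open>N\<close> is the norm of \<open>U / W\<close>. At the critical rate \<open>s0\<close> the vectors with bounded rescaled orbit form an invariant subspace, hence
  \<open>U\<close> or \<open>W\<close>. In the first case all words are bounded at rate \<open>s0\<close> and the rate can be improved. In the second case compactness of the
  sphere yields a uniform escape time, so orbits also grow faster than some rate above \<open>s0\<close>.\<close>
lemma irreducible_quotient_decay:
  fixes \<A> :: "('v::real_vector \<Rightarrow> 'v) set" and c :: "'v \<Rightarrow> 'v \<Rightarrow> real"
  assumes lin: "\<forall>F\<in>\<A>. linear F"
    and U: "subspace U" "preserves \<A> U" and W: "preserves \<A> W" "W \<subset> U"
    and maximal: "\<And>W'. subspace W' \<Longrightarrow> preserves \<A> W' \<Longrightarrow> W \<subseteq> W' \<Longrightarrow> W' \<subset> U \<Longrightarrow> W' = W"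
    and D: "finite D" "D \<subseteq> U" and clin: "\<And>b. linear (c b)"
    and dual: "\<And>b b'. b \<in> D \<Longrightarrow> b' \<in> D \<Longrightarrow> c b b' = (if b = b' then 1 else 0)"
    and cW: "\<And>b x. b \<in> D \<Longrightarrow> x \<in> W \<Longrightarrow> c b x = 0"
    and proj: "\<And>x. x \<in> U \<Longrightarrow> x - (\<Sum>b\<in>D. c b x *\<^sub>R b) \<in> W"
    and N_def: "N = (\<lambda>x. \<Sum>b\<in>D. \<bar>c b x\<bar>)"
    and crude: "\<forall>F\<in>\<A>. \<forall>x\<in>U. N (F x) \<le> m * N x"
    and ann: "\<forall>t\<ge>L. \<forall>P\<in>words \<A> t. \<forall>x\<in>U. annihilated n P x"
  shows "\<exists>s C. 0 < s \<and> s < 1 \<and> 1 \<le> C \<and> grow \<A> U N C s"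
proof (rule ccontr)
  assume neg: "\<not> ?thesis"
  have N: "seminorm N" unfolding N_def by (rule seminorm_coordinates[OF clin])
  note N0 = seminorm_nonneg[OF N]
  have tb: "totally_bounded U N" unfolding N_def by (rule totally_bounded_coordinates[OF clin D(1)])
  have NW: "N w = 0" if "w \<in> W" for w using that by (simp add: N_def cW)
  define m' where "m' = max m 1"
  have m': "1 \<le> m'" by (simp add: m'_def)
  have m'0: "0 \<le> m'" using m' by simp
  have crude': "\<forall>F\<in>\<A>. \<forall>x\<in>U. N (F x) \<le> m' * N x"
  proof (intro ballI)
    fix F x assume "F \<in> \<A>" "x \<in> U"
    then have "N (F x) \<le> m * N x" using crude by blast
    also have "\<dots> \<le> m' * N x" using N0 by (intro mult_right_mono) (auto simp: m'_def)
    finally show "N (F x) \<le> m' * N x" .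
  qed
  note wcrude = words_crude_bound[OF U(2) crude' m'0]
  define \<S> where "\<S> = {s. 0 < s \<and> (\<exists>C\<ge>1. grow \<A> U N C s)}"
  \<comment> \<open>The negated goal leaves no admissible rate below 1, so the infimum
    \<open>s0\<close> lies in the range where rates can be improved.\<close>
  have ge1: "1 \<le> s" if "s \<in> \<S>" for s using neg that by (auto simp: \<S>_def not_less[symmetric])
  have "grow \<A> U N 1 m'" unfolding grow_def using wcrude by simp
  then have "m' \<in> \<S>" using m' by (auto simp: \<S>_def)
  then have ne: "\<S> \<noteq> {}" by auto
  have bdd: "bdd_below \<S>" using ge1 by (meson bdd_belowI)
  define s0 where "s0 = Inf \<S>"
  have s0: "1 \<le> s0" unfolding s0_def using ne ge1 by (rule cInf_greatest)
  have above: "\<exists>C\<ge>1. grow \<A> U N C s" if s: "s0 < s" for s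
  proof -
    obtain s1 where s1: "s1 \<in> \<S>" "s1 < s" using s cInf_less_iff[OF ne bdd, of s] unfolding s0_def by blast
    then obtain C where C: "1 \<le> C" "grow \<A> U N C s1" "0 < s1" by (auto simp: \<S>_def)
    have "grow \<A> U N C s" unfolding grow_def
    proof (intro allI ballI)
      fix t P x assume "P \<in> words \<A> t" "x \<in> U"
      then have "N (P x) \<le> C * s1 ^ t * N x" using growD[OF C(2)] by blast
      also have "\<dots> \<le> C * s ^ t * N x"
        using C s1 N0 by (intro mult_right_mono mult_left_mono power_mono) auto
      finally show "N (P x) \<le> C * s ^ t * N x" .
    qed
    then show ?thesis using C by blast
  qed
  have not0: "\<not> grow \<A> U N C s0" if "1 \<le> C" for C
  proof
    assume "grow \<A> U N C s0"
    from grow_improve[OF lin U N tb crude ann this s0] obtain s' where "s' \<in> \<S>" "s' < s0"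
      by (auto simp: \<S>_def)
    then show False using cInf_lower[OF _ bdd, of s'] by (simp add: s0_def)
  qed
  have wlin: "linear P" if "P \<in> words \<A> t" for P t by (rule words_linear[OF lin that])
  define U' where "U' = {x \<in> U. \<exists>K. \<forall>t. \<forall>P\<in>words \<A> t. N (P x) \<le> K * s0 ^ t}"
  have U'_sub: "subspace U'"
  proof (rule subspaceI)
    have "N (P 0) \<le> 0 * s0 ^ t" if "P \<in> words \<A> t" for P t
      using linear_0[OF wlin[OF that]] seminorm_zero[OF N] by simp
    then show "0 \<in> U'" using subspace_0[OF U(1)] unfolding U'_def by blast
  next
    fix x y assume "x \<in> U'" "y \<in> U'"
    then obtain K K' where xy: "x \<in> U" "y \<in> U" and
      K: "\<And>t P. P \<in> words \<A> t \<Longrightarrow> N (P x) \<le> K * s0 ^ t" and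
      K': "\<And>t P. P \<in> words \<A> t \<Longrightarrow> N (P y) \<le> K' * s0 ^ t" unfolding U'_def by blast
    have "N (P (x + y)) \<le> (K + K') * s0 ^ t" if P: "P \<in> words \<A> t" for P t
      using seminorm_add[OF N, of "P x" "P y"] K[OF P] K'[OF P]
      by (simp add: linear_add[OF wlin[OF P]] distrib_right)
    then show "x + y \<in> U'" using subspace_add[OF U(1)] xy unfolding U'_def by blast
  next
    fix a x assume "x \<in> U'"
    then obtain K where x: "x \<in> U" and
      K: "\<And>t P. P \<in> words \<A> t \<Longrightarrow> N (P x) \<le> K * s0 ^ t" unfolding U'_def by blast
    have "N (P (a *\<^sub>R x)) \<le> (\<bar>a\<bar> * K) * s0 ^ t" if P: "P \<in> words \<A> t" for P t
      using mult_left_mono[OF K[OF P], of "\<bar>a\<bar>"]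
      by (simp add: linear_scale[OF wlin[OF P]] seminorm_scale[OF N] mult.assoc)
    then show "a *\<^sub>R x \<in> U'" using subspace_scale[OF U(1)] x unfolding U'_def by blast
  qed
  have U'_inv: "preserves \<A> U'" unfolding preserves_def
  proof (intro ballI)
    fix F x assume F: "F \<in> \<A>" and "x \<in> U'"
    then obtain K where x: "x \<in> U" and
      K: "\<And>t P. P \<in> words \<A> t \<Longrightarrow> N (P x) \<le> K * s0 ^ t" unfolding U'_def by blast
    have "N (P (F x)) \<le> (K * s0) * s0 ^ t" if P: "P \<in> words \<A> t" for P t
    proof -
      have "F \<circ> id \<in> words \<A> 1" using F words_SucI[of F \<A> id 0] by simp
      then have "P \<circ> F \<in> words \<A> (t + 1)" using words_comp[OF P, of F 1] by simp
      from K[OF this] show ?thesis by simp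
    qed
    moreover have "F x \<in> U" using U(2) F x by (simp add: preserves_def)
    ultimately show "F x \<in> U'" unfolding U'_def by blast
  qed
  have "W \<subseteq> U'"
  proof
    fix w assume w: "w \<in> W"
    have "N (P w) \<le> 0 * s0 ^ t" if "P \<in> words \<A> t" for P t
      using NW[OF words_preserve[OF W(1) that w]] by simp
    then show "w \<in> U'" using w W(2) unfolding U'_def by blast
  qed
  then consider "U' = U" | "U' = W" using maximal[OF U'_sub U'_inv] unfolding U'_def by blast
  then show False
  proof cases
    case 1
    \<comment> \<open>Bounds on single orbits become uniform because modulo \<open>W\<close> every
      vector is a combination of the finitely many elements of \<open>D\<close>.\<close>
    have "\<exists>K. \<forall>t. \<forall>P\<in>words \<A> t. N (P b) \<le> K * s0 ^ t" if "b \<in> D" for b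
      using that D 1 unfolding U'_def by blast
    then obtain K where K: "\<And>b t P. b \<in> D \<Longrightarrow> P \<in> words \<A> t \<Longrightarrow> N (P b) \<le> K b * s0 ^ t" by metis
    define C where "C = max 1 (\<Sum>b\<in>D. \<bar>K b\<bar>)"
    have KC: "K b \<le> C" if "b \<in> D" for b
      using member_le_sum[of b D "\<lambda>b. \<bar>K b\<bar>"] that D by (auto simp: C_def)
    have "grow \<A> U N C s0" unfolding grow_def
    proof (intro allI ballI)
      fix t P x assume P: "P \<in> words \<A> t" and x: "x \<in> U"
      define w where "w = x - (\<Sum>b\<in>D. c b x *\<^sub>R b)"
      have w: "w \<in> W" unfolding w_def by (rule proj[OF x])
      have "P x = P w + P (\<Sum>b\<in>D. c b x *\<^sub>R b)" by (simp add: w_def flip: linear_add[OF wlin[OF P]])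
      also have "P (\<Sum>b\<in>D. c b x *\<^sub>R b) = (\<Sum>b\<in>D. c b x *\<^sub>R P b)"
        by (simp add: linear_sum[OF wlin[OF P]] linear_scale[OF wlin[OF P]])
      finally have "N (P x) \<le> N (P w) + N (\<Sum>b\<in>D. c b x *\<^sub>R P b)" using seminorm_add[OF N] by simp
      also have "N (P w) = 0" by (rule NW[OF words_preserve[OF W(1) P w]])
      also have "0 + N (\<Sum>b\<in>D. c b x *\<^sub>R P b) \<le> (\<Sum>b\<in>D. N (c b x *\<^sub>R P b))"
        using seminorm_sum[OF N] by simp
      also have "\<dots> \<le> (\<Sum>b\<in>D. \<bar>c b x\<bar> * (C * s0 ^ t))"
      proof (rule sum_mono)
        fix b assume b: "b \<in> D"
        have "N (P b) \<le> K b * s0 ^ t" by (rule K[OF b P])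
        also have "\<dots> \<le> C * s0 ^ t" using KC[OF b] s0 by (intro mult_right_mono) auto
        finally show "N (c b x *\<^sub>R P b) \<le> \<bar>c b x\<bar> * (C * s0 ^ t)"
          by (simp add: seminorm_scale[OF N] mult_left_mono)
      qed
      also have "\<dots> = C * s0 ^ t * N x" by (simp add: N_def sum_distrib_left mult_ac)
      finally show "N (P x) \<le> C * s0 ^ t * N x" .
    qed
    then show False using not0[of C] by (simp add: C_def)
  next
    case 2
    have escape: "\<exists>t. \<exists>P\<in>words \<A> t. 2 * s0 ^ t < N (P x)" if "x \<in> U" "1 \<le> N x" for x
    proof (rule ccontr)
      assume "\<not> ?thesis"
      then have "x \<in> U'" using that unfolding U'_def by (auto simp: not_less)
      then show False using 2 NW[of x] that by simp
    qed
    \<comment> \<open>Vectors escaping ever later would accumulate at some \<open>l\<close> that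
      still escapes beyond 2; a fixed word is continuous, so nearby vectors escape beyond 3/2, which
      is the threshold kept.\<close>
    have "\<exists>T. \<forall>x\<in>U. N x = 1 \<longrightarrow> (\<exists>t\<le>T. \<exists>P\<in>words \<A> t. 3/2 * s0 ^ t \<le> N (P x))"
    proof (rule ccontr)
      assume "\<not> ?thesis"
      then have "\<forall>T. \<exists>x\<in>U. N x = 1 \<and> (\<forall>t\<le>T. \<forall>P\<in>words \<A> t. N (P x) < 3/2 * s0 ^ t)"
        by (meson not_le)
      then obtain x where x: "\<And>T. x T \<in> U" "\<And>T. N (x T) = 1"
        "\<And>T t P. t \<le> T \<Longrightarrow> P \<in> words \<A> t \<Longrightarrow> N (P (x T)) < 3/2 * s0 ^ t" by metis
      have sphere: "(\<Sum>b\<in>D. \<bar>c b (x j)\<bar>) \<le> 1" for j using x(2)[of j] by (simp add: N_def)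
      obtain l and r :: "nat \<Rightarrow> nat" where
        l: "l \<in> U" "strict_mono r" and lim: "(\<lambda>j. N (x (r j) - l)) \<longlonglongrightarrow> 0"
      proof (rule coordinates_compact[OF clin D U(1) dual sphere])
        fix l and r :: "nat \<Rightarrow> nat"
        assume "l \<in> U" "strict_mono r" "(\<lambda>j. \<Sum>b\<in>D. \<bar>c b (x (r j) - l)\<bar>) \<longlonglongrightarrow> 0"
        then show thesis by (intro that[of l r]) (simp_all add: N_def)
      qed
      have "1 - N l \<le> N (x (r j) - l)" for j using seminorm_diff[OF N, of "x (r j)" l] x(2)[of "r j"] by linarith
      then have "1 - N l \<le> 0" by (intro LIMSEQ_le_const[OF lim]) auto
      then have "1 \<le> N l" by simp
      from escape[OF l(1) this] obtain t P where P: "P \<in> words \<A> t" "2 * s0 ^ t < N (P l)" by blast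
      have "(\<lambda>j. m' ^ t * N (x (r j) - l)) \<longlonglongrightarrow> m' ^ t * 0" by (intro tendsto_intros lim)
      then have "eventually (\<lambda>j. m' ^ t * N (x (r j) - l) < 1/2 * s0 ^ t) sequentially"
        using s0 by (intro order_tendstoD(2)) auto
      then have "eventually (\<lambda>j. t \<le> j \<and> m' ^ t * N (x (r j) - l) < 1/2 * s0 ^ t) sequentially"
        using eventually_ge_at_top[of t] by eventually_elim auto
      then obtain j where j: "t \<le> j" "m' ^ t * N (x (r j) - l) < 1/2 * s0 ^ t"
        unfolding eventually_sequentially by blast
      have "N (P (x (r j))) < 3/2 * s0 ^ t"
        using x(3)[OF _ P(1)] j(1) seq_suble[OF l(2), of j] by simp
      moreover have "N (P l) \<le> N (P (x (r j))) + N (P (x (r j)) - P l)"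
        using seminorm_diff[OF N, of "P l" "P (x (r j))"] seminorm_minus_commute[OF N] by metis
      moreover have "N (P (x (r j)) - P l) \<le> m' ^ t * N (x (r j) - l)"
        using wcrude[OF P(1) subspace_diff[OF U(1) x(1) l(1)]] by (simp add: linear_diff[OF wlin[OF P(1)]])
      ultimately show False using j(2) P(2) by linarith
    qed
    then obtain T where T: "\<And>x. x \<in> U \<Longrightarrow> N x = 1 \<Longrightarrow> \<exists>t\<le>T. \<exists>P\<in>words \<A> t. 3/2 * s0 ^ t \<le> N (P x)"
      by blast
    \<comment> \<open>Since 3/2 = (5/4)(6/5) and escape takes at most \<open>T\<close> steps, the
      factor 6/5 pays for raising the rate from \<open>s0\<close> to \<open>s0 * g\<close>, and a
      gain of 5/4 per escape is left over. Iterated, that gain defeats the constant available at the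
      larger rate.\<close>
    define g where "g = root (Suc T) (6/5)"
    have g: "1 < g" "g ^ Suc T = 6/5" by (auto simp: g_def simp del: power_Suc)
    define s where "s = s0 * g"
    have s: "s0 < s" "0 < s" using s0 g by (auto simp: s_def)
    have step: "\<exists>t. \<exists>P\<in>words \<A> t. 5/4 * s ^ t * N x \<le> N (P x)" if x: "x \<in> U" for x
    proof (cases "N x = 0")
      case True
      have "id \<in> words \<A> 0" by simp
      then show ?thesis using True by (intro exI[of _ 0] bexI[of _ id]) auto
    next
      case False
      then have pos: "0 < N x" using N0[of x] by simp
      define y where "y = (1 / N x) *\<^sub>R x"
      have "N y = 1" using pos by (simp add: y_def seminorm_scale[OF N])
      moreover have "y \<in> U" using x U(1) by (simp add: y_def subspace_scale)
      ultimately obtain t P where P: "t \<le> T" "P \<in> words \<A> t" "3/2 * s0 ^ t \<le> N (P y)" using T by blast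
      have "g ^ t \<le> g ^ Suc T" using P(1) g by (intro power_increasing) auto
      then have "g ^ t \<le> 6/5" using g by simp
      then have "s0 ^ t * g ^ t \<le> s0 ^ t * (6/5)" using s0 by (intro mult_left_mono) auto
      then have "5/4 * s ^ t \<le> 3/2 * s0 ^ t" by (simp add: s_def power_mult_distrib mult_ac)
      also have "\<dots> \<le> N (P x) / N x"
        using P(3) pos by (simp add: y_def linear_scale[OF wlin[OF P(2)]] seminorm_scale[OF N])
      finally have "5/4 * s ^ t * N x \<le> N (P x)" using pos by (simp add: pos_le_divide_eq)
      then show ?thesis using P(2) by blast
    qed
    have iter: "\<exists>t. \<exists>P\<in>words \<A> t. (5/4) ^ i * s ^ t * N x \<le> N (P x)" if x: "x \<in> U" for x and i :: nat
    proof (induction i)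
      case 0
      have "id \<in> words \<A> 0" by simp
      then show ?case by (intro exI[of _ 0] bexI[of _ id]) auto
    next
      case (Suc i)
      then obtain t P where P: "P \<in> words \<A> t" "(5/4) ^ i * s ^ t * N x \<le> N (P x)" by blast
      obtain t' Q where Q: "Q \<in> words \<A> t'" "5/4 * s ^ t' * N (P x) \<le> N (Q (P x))"
        using step[OF words_preserve[OF U(2) P(1) x]] by blast
      have "5/4 * s ^ t' * ((5/4) ^ i * s ^ t * N x) \<le> 5/4 * s ^ t' * N (P x)"
        using P(2) s by (intro mult_left_mono) auto
      then have "(5/4) ^ Suc i * s ^ (t' + t) * N x \<le> N ((Q \<circ> P) x)"
        using Q(2) by (simp add: power_add mult_ac)
      then show ?case using words_comp[OF Q(1) P(1)] by blast
    qed
    obtain x where x: "x \<in> U" "x \<notin> W" using W(2) by blast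
    have "N x \<noteq> 0"
    proof
      assume "N x = 0"
      then have "\<forall>b\<in>D. c b x = 0" using D by (simp add: N_def sum_nonneg_eq_0_iff)
      then have "x - (\<Sum>b\<in>D. c b x *\<^sub>R b) = x" by simp
      then show False using proj[OF x(1)] x(2) by simp
    qed
    then have Nx: "0 < N x" using N0[of x] by simp
    obtain C where C: "1 \<le> C" "grow \<A> U N C s" using above[OF s(1)] by blast
    obtain i where i: "C < (5/4) ^ i" using real_arch_pow[of "5/4" C] by auto
    obtain t P where P: "P \<in> words \<A> t" "(5/4) ^ i * s ^ t * N x \<le> N (P x)" using iter[OF x(1)] by blast
    have "(5/4) ^ i * (s ^ t * N x) \<le> C * (s ^ t * N x)"
      using P(2) growD[OF C(2) P(1) x(1)] by (simp add: mult.assoc)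
    then have "(5/4) ^ i \<le> C" using s Nx by (simp add: mult_le_cancel_right)
    then show False using i by simp
  qed
qed

text \<open>In the splitting of \<open>U\<close> into \<open>W\<close> and the span of
  \<open>D\<close>, words are block triangular with decaying diagonal blocks. A weighted sum of the
  two seminorms then contracts after \<open>T\<close> steps. Hypothesis \<open>dom\<close> makes
  \<open>G\<close> dominate every seminorm on \<open>V\<close>, the form in which equivalence of
  norms is used.\<close>

lemma extension_decay:
  fixes \<A> :: "('v::real_vector \<Rightarrow> 'v) set" and c :: "'v \<Rightarrow> 'v \<Rightarrow> real" and G :: "'v \<Rightarrow> real"
  assumes lin: "\<forall>F\<in>\<A>. linear F"
    and V: "subspace V" "preserves \<A> V" and U: "subspace U" "U \<subseteq> V" "preserves \<A> U"
    and W: "preserves \<A> W" "W \<subseteq> U"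
    and G: "seminorm G" and dom: "\<And>N. seminorm N \<Longrightarrow> \<exists>K. \<forall>x\<in>V. N x \<le> K * G x"
    and crude: "\<forall>F\<in>\<A>. \<forall>x\<in>V. G (F x) \<le> m * G x"
    and D: "finite D" "D \<subseteq> U" and clin: "\<And>b. linear (c b)"
    and cW: "\<And>b x. b \<in> D \<Longrightarrow> x \<in> W \<Longrightarrow> c b x = 0"
    and proj: "\<And>x. x \<in> U \<Longrightarrow> x - (\<Sum>b\<in>D. c b x *\<^sub>R b) \<in> W"
    and N_def: "N = (\<lambda>x. \<Sum>b\<in>D. \<bar>c b x\<bar>)"
    and quot: "0 < s" "s < 1" "grow \<A> U N C s"
    and M: "seminorm M" and sub: "0 < s'" "s' < 1" "grow \<A> W M C' s'" "\<forall>x\<in>W. G x \<le> K * M x"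
  shows "\<exists>N' s C K. seminorm N' \<and> 0 < s \<and> s < 1 \<and> grow \<A> U N' C s \<and> (\<forall>x\<in>U. G x \<le> K * N' x)"
proof -
  have N: "seminorm N" unfolding N_def by (rule seminorm_coordinates[OF clin])
  note N0 = seminorm_nonneg[OF N] and M0 = seminorm_nonneg[OF M] and G0 = seminorm_nonneg[OF G]
  define \<pi> where "\<pi> x = (\<Sum>b\<in>D. c b x *\<^sub>R b)" for x
  define \<rho> where "\<rho> x = x - \<pi> x" for x
  have \<pi>lin: "linear \<pi>" unfolding \<pi>_def
    by (intro linear_compose_sum ballI linearI) (simp_all add: linear_add[OF clin] linear_scale[OF clin] scaleR_add_left)
  have \<rho>lin: "linear \<rho>" unfolding \<rho>_def by (intro linear_compose_sub linear_id[unfolded id_def] \<pi>lin)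
  have \<rho>W: "\<rho> x \<in> W" if "x \<in> U" for x using proj[OF that] by (simp add: \<rho>_def \<pi>_def)
  have \<rho>fix: "\<rho> x = x" if "x \<in> W" for x using cW that by (simp add: \<rho>_def \<pi>_def)
  have \<pi>U: "\<pi> x \<in> U" for x using D U(1) by (auto simp: \<pi>_def intro!: subspace_sum subspace_scale)
  define G1 where "G1 = (\<Sum>b\<in>D. G b)"
  have G1: "0 \<le> G1" unfolding G1_def using G0 by (intro sum_nonneg) auto
  have G\<pi>: "G (\<pi> x) \<le> G1 * N x" for x
  proof -
    have "G (\<pi> x) \<le> (\<Sum>b\<in>D. \<bar>c b x\<bar> * G b)"
      unfolding \<pi>_def by (rule order_trans[OF seminorm_sum[OF G]]) (simp add: seminorm_scale[OF G])
    also have "\<dots> \<le> (\<Sum>b\<in>D. \<bar>c b x\<bar> * G1)"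
      unfolding G1_def using D G0 by (intro sum_mono mult_left_mono member_le_sum) auto
    finally show ?thesis by (simp add: N_def sum_distrib_left mult.commute)
  qed
  define m' where "m' = max m 0"
  have crude': "\<forall>F\<in>\<A>. \<forall>x\<in>V. G (F x) \<le> m' * G x"
  proof (intro ballI)
    fix F x assume "F \<in> \<A>" "x \<in> V"
    then have "G (F x) \<le> m * G x" using crude by blast
    also have "\<dots> \<le> m' * G x" using G0 by (intro mult_right_mono) (auto simp: m'_def)
    finally show "G (F x) \<le> m' * G x" .
  qed
  have m'0: "0 \<le> m'" by (simp add: m'_def)
  note wcrude = words_crude_bound[OF V(2) crude' m'0]
  obtain T where T: "1 \<le> T" "\<bar>C\<bar> * s ^ T \<le> 1/4" "\<bar>C'\<bar> * s' ^ T \<le> 1/4"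
  proof -
    have ev: "eventually (\<lambda>T. \<bar>a\<bar> * b ^ T < 1/4) sequentially" if "0 < b" "b < 1" for a b :: real
    proof (rule order_tendstoD(2))
      show "(\<lambda>T. \<bar>a\<bar> * b ^ T) \<longlonglongrightarrow> \<bar>a\<bar> * 0"
        using that by (intro tendsto_intros LIMSEQ_realpow_zero) auto
    qed simp
    from ev[OF quot(1,2), of C] ev[OF sub(1,2), of C'] have "eventually (\<lambda>T. 1 \<le> T \<and> \<bar>C\<bar> * s ^ T < 1/4 \<and> \<bar>C'\<bar> * s' ^ T < 1/4) sequentially"
      using eventually_ge_at_top[of 1] by eventually_elim auto
    then obtain T where "1 \<le> T \<and> \<bar>C\<bar> * s ^ T < 1/4 \<and> \<bar>C'\<bar> * s' ^ T < 1/4"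
      unfolding eventually_sequentially by blast
    then show ?thesis by (intro that[of T]) auto
  qed
  have quarter: "a * N' \<le> 1/4 * N'" if "\<bar>a'\<bar> * b \<le> 1/4" "a = a' * b" "0 \<le> b" "0 \<le> N'" for a a' b N' :: real
  proof -
    have "a \<le> \<bar>a'\<bar> * b" using that by (simp add: mult_right_mono)
    then show ?thesis using that by (intro mult_right_mono) auto
  qed
  have M\<rho>: "seminorm (\<lambda>x. M (\<rho> x))" by (rule seminorm_linear_comp[OF M \<rho>lin])
  obtain K1 where K1: "\<And>x. x \<in> V \<Longrightarrow> M (\<rho> x) \<le> K1 * G x" using dom[OF M\<rho>] by blast
  \<comment> \<open>Bounds the leakage into \<open>W\<close>: \<open>G1\<close> lifts a quotient
    vector back to \<open>U\<close>, \<open>m' ^ T\<close> carries it through \<open>T\<close>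
    steps, and \<open>K1\<close> measures its component in \<open>W\<close>.\<close>
  define k where "k = 1 + \<bar>K1\<bar> * m' ^ T * G1"
  have k: "1 \<le> k" using m'0 G1 by (simp add: k_def)
  \<comment> \<open>The quotient part is weighted so heavily that its leakage into \<open>W\<close> during \<open>T\<close> steps is absorbed.\<close>
  define N' where "N' x = (4 * k) * N x + M (\<rho> x)" for x
  have N': "seminorm N'" unfolding N'_def using k by (intro seminorm_add_scaled N M\<rho>) auto
  note N'0 = seminorm_nonneg[OF N']
  have contr: "N' (P x) \<le> 1/2 * N' x" if P: "P \<in> words \<A> T" and x: "x \<in> U" for P x
  proof -
    have Plin: "linear P" by (rule words_linear[OF lin P])
    have PU: "P y \<in> U" if "y \<in> U" for y using words_preserve[OF U(3) P that] .
    have "N (P x) \<le> C * s ^ T * N x" using growD[OF quot(3) P x] .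
    also have "\<dots> \<le> 1/4 * N x" using quarter[OF T(2) refl] quot N0 by simp
    finally have 1: "N (P x) \<le> 1/4 * N x" .
    have "P (\<rho> x) \<in> W" using words_preserve[OF W(1) P \<rho>W[OF x]] .
    moreover have "P x = P (\<pi> x) + P (\<rho> x)" by (simp add: \<rho>_def flip: linear_add[OF Plin])
    ultimately have "\<rho> (P x) = \<rho> (P (\<pi> x)) + P (\<rho> x)" by (simp add: linear_add[OF \<rho>lin] \<rho>fix)
    then have "M (\<rho> (P x)) \<le> M (\<rho> (P (\<pi> x))) + M (P (\<rho> x))" using seminorm_add[OF M] by simp
    also have "M (P (\<rho> x)) \<le> C' * s' ^ T * M (\<rho> x)" using growD[OF sub(3) P \<rho>W[OF x]] .
    also have "\<dots> \<le> 1/4 * M (\<rho> x)" using quarter[OF T(3) refl] sub M0 by simp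
    also have "M (\<rho> (P (\<pi> x))) \<le> k * N x"
    proof -
      have "M (\<rho> (P (\<pi> x))) \<le> K1 * G (P (\<pi> x))" using K1 PU[OF \<pi>U] U(2) by blast
      also have "\<dots> \<le> \<bar>K1\<bar> * G (P (\<pi> x))" using G0 by (intro mult_right_mono) auto
      also have "\<dots> \<le> \<bar>K1\<bar> * (m' ^ T * G (\<pi> x))"
        using wcrude[OF P] \<pi>U U(2) by (intro mult_left_mono) auto
      also have "\<dots> \<le> \<bar>K1\<bar> * (m' ^ T * (G1 * N x))" using G\<pi> m'0 by (intro mult_left_mono) auto
      also have "\<dots> \<le> k * N x" using N0[of x] by (simp add: k_def distrib_right mult.assoc)
      finally show ?thesis .
    qed
    finally have 2: "M (\<rho> (P x)) \<le> k * N x + 1/4 * M (\<rho> x)" by simp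
    have "4 * k * N (P x) \<le> 4 * k * (1/4 * N x)" using 1 k by (intro mult_left_mono) auto
    then show ?thesis using 2 M0[of "\<rho> x"] unfolding N'_def by simp
  qed
  define K' where "K' = max G1 \<bar>K\<bar>"
  have GN': "G x \<le> K' * N' x" if x: "x \<in> U" for x
  proof -
    have "G x \<le> G (\<pi> x) + G (\<rho> x)" using seminorm_add[OF G, of "\<pi> x" "\<rho> x"] by (simp add: \<rho>_def)
    also have "G (\<rho> x) \<le> K * M (\<rho> x)" using sub(4) \<rho>W[OF x] by blast
    also have "\<dots> \<le> K' * M (\<rho> x)" using M0 by (intro mult_right_mono) (auto simp: K'_def)
    also have "G (\<pi> x) \<le> G1 * N x" by (rule G\<pi>)
    also have "\<dots> \<le> K' * ((4 * k) * N x)"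
      using N0[of x] k G1 by (intro mult_mono) (auto simp: K'_def mult_le_cancel_right1)
    finally show ?thesis by (simp add: N'_def distrib_left)
  qed
  obtain K2 where K2: "\<And>x. x \<in> V \<Longrightarrow> N' x \<le> K2 * G x" using dom[OF N'] by blast
  have crudeN': "\<forall>F\<in>\<A>. \<forall>x\<in>U. N' (F x) \<le> (\<bar>K2\<bar> * m' * K') * N' x"
  proof (intro ballI)
    fix F x assume F: "F \<in> \<A>" and x: "x \<in> U"
    have xV: "x \<in> V" using x U(2) by blast
    have FV: "F x \<in> V" using V(2) F xV by (simp add: preserves_def)
    have "N' (F x) \<le> K2 * G (F x)" by (rule K2[OF FV])
    also have "\<dots> \<le> \<bar>K2\<bar> * G (F x)" using G0 by (intro mult_right_mono) auto
    also have "\<dots> \<le> \<bar>K2\<bar> * (m' * G x)" using crude' F xV by (intro mult_left_mono) auto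
    also have "\<dots> \<le> \<bar>K2\<bar> * (m' * (K' * N' x))" using GN'[OF x] m'0 by (intro mult_left_mono) auto
    finally show "N' (F x) \<le> (\<bar>K2\<bar> * m' * K') * N' x" by (simp add: mult.assoc)
  qed
  define \<sigma> where "\<sigma> = root T (1/2)"
  have \<sigma>: "0 < \<sigma>" "\<sigma> < 1" "\<sigma> ^ T = 1/2" using T real_root_lt_1_iff[of T "1/2"] by (auto simp: \<sigma>_def)
  have "\<exists>C\<ge>1. grow \<A> U N' C \<sigma>"
  proof (rule contraction_imp_grow[OF U(3) N' crudeN' T(1) \<sigma>(1)])
    show "\<forall>P\<in>words \<A> T. \<forall>x\<in>U. N' (P x) \<le> \<sigma> ^ T * N' x"
      unfolding \<sigma>(3) using contr by blast
  qed
  then show ?thesis using N' \<sigma> GN' by blast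
qed

text \<open>Induction on the dimension of an invariant subspace: a proper invariant subspace of
  largest dimension has an irreducible quotient above it and falls under the induction hypothesis
  itself.\<close>

lemma annihilated_imp_decay:
  fixes \<A> :: "('v::real_vector \<Rightarrow> 'v) set" and G :: "'v \<Rightarrow> real"
  assumes lin: "\<forall>F\<in>\<A>. linear F" and B: "finite B" "V \<subseteq> span B"
    and V: "subspace V" "preserves \<A> V"
    and G: "seminorm G" and dom: "\<And>N. seminorm N \<Longrightarrow> \<exists>K. \<forall>x\<in>V. N x \<le> K * G x"
    and crude: "\<forall>F\<in>\<A>. \<forall>x\<in>V. G (F x) \<le> m * G x"
    and ann: "\<forall>t\<ge>L. \<forall>P\<in>words \<A> t. \<forall>x\<in>V. annihilated n P x"
  shows "\<exists>s C. 0 < s \<and> s < 1 \<and> grow \<A> V G C s"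
proof -
  \<comment> \<open>The seminorm is allowed to vary with \<open>U\<close>; the clause bounding
    \<open>G\<close> by a multiple of \<open>N\<close> keeps it comparable to \<open>G\<close> and
    allows the return to \<open>G\<close> at the end.\<close>
  have main: "\<exists>N s C K. seminorm N \<and> 0 < s \<and> s < 1 \<and> grow \<A> U N C s \<and> (\<forall>x\<in>U. G x \<le> K * N x)"
    if "subspace U" "U \<subseteq> V" "preserves \<A> U" for U
    using that
  proof (induction "dim U" arbitrary: U rule: less_induct)
    case less
    note U = less.prems
    show ?case
    proof (cases "U = {0}")
      case True
      have "seminorm (\<lambda>x::'v. 0)" by (simp add: seminorm_def)
      moreover have "grow \<A> U (\<lambda>x. 0) 1 (1/2)" by (simp add: grow_def)
      ultimately show ?thesis using True seminorm_zero[OF G]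
        by (intro exI[of _ "\<lambda>x. 0"] exI[of _ "1/2"] exI[of _ 1]) auto
    next
      case False
      have UB: "U \<subseteq> span B" using U(2) B(2) by blast
      define Q where "Q W \<longleftrightarrow> subspace W \<and> preserves \<A> W \<and> W \<subset> U" for W
      have "preserves \<A> {0}" using lin by (auto simp: preserves_def linear_0)
      then have "Q {0}" using False subspace_0[OF U(1)] by (auto simp: Q_def)
      moreover have "dim W \<le> card B" if "Q W" for W
        using that UB B(1) by (intro dim_le_card) (auto simp: Q_def)
      then have "\<forall>W. Q W \<longrightarrow> dim W < Suc (card B)" by (simp add: less_Suc_eq_le)
      ultimately obtain W where W: "Q W" "\<And>W'. Q W' \<Longrightarrow> dim W' \<le> dim W"
        using ex_has_greatest_nat[of Q "{0}" dim "Suc (card B)"] by blast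
      have W': "subspace W" "preserves \<A> W" "W \<subset> U" "W \<subseteq> U" using W(1) by (auto simp: Q_def)
      have maximal: "W' = W" if "subspace W'" "preserves \<A> W'" "W \<subseteq> W'" "W' \<subset> U" for W'
      proof (rule ccontr)
        assume "W' \<noteq> W"
        then have "dim W < dim W'" using that UB B(1) W' by (intro dim_psubset_finite) auto
        then show False using W(2)[of W'] that by (simp add: Q_def)
      qed
      obtain D c where D: "finite D" "D \<subseteq> U" and clin: "\<And>b. linear (c b)"
        and dual: "\<And>b b'. b \<in> D \<Longrightarrow> b' \<in> D \<Longrightarrow> c b b' = (if b = b' then 1 else 0::real)"
        and cW: "\<And>b x. b \<in> D \<Longrightarrow> x \<in> W \<Longrightarrow> c b x = 0"
        and proj: "\<And>x. x \<in> U \<Longrightarrow> x - (\<Sum>b\<in>D. c b x *\<^sub>R b) \<in> W"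
      proof (rule complement_coordinates[OF B(1) UB U(1) W'(1,4)])
        fix D :: "'v set" and c :: "'v \<Rightarrow> 'v \<Rightarrow> real"
        assume a: "finite D" "D \<subseteq> U" "\<And>b. linear (c b)"
          "\<And>b b'. b \<in> D \<Longrightarrow> b' \<in> D \<Longrightarrow> c b b' = (if b = b' then 1 else 0)"
          "\<And>b x. b \<in> D \<Longrightarrow> x \<in> W \<Longrightarrow> c b x = 0"
          "\<And>x. x \<in> U \<Longrightarrow> x - (\<Sum>b\<in>D. c b x *\<^sub>R b) \<in> W"
        show thesis by (rule that) (fact a)+
      qed
      define N where "N = (\<lambda>x. \<Sum>b\<in>D. \<bar>c b x\<bar>)"
      have N: "seminorm N" unfolding N_def by (rule seminorm_coordinates[OF clin])
      note N0 = seminorm_nonneg[OF N] and G0 = seminorm_nonneg[OF G]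
      obtain K where K: "\<And>x. x \<in> V \<Longrightarrow> N x \<le> K * G x" using dom[OF N] by blast
      define k where "k = \<bar>K\<bar> * \<bar>m\<bar>"
      \<comment> \<open>\<open>N\<close> does not dominate \<open>G\<close> in general, so the bound
        on \<open>G\<close> does not transfer directly. The part of \<open>x\<close> in
        \<open>W\<close> stays in \<open>W\<close>, where \<open>N\<close> vanishes, and only the
        images of the elements of \<open>D\<close> count.\<close>
      have crudeN: "\<forall>F\<in>\<A>. \<forall>x\<in>U. N (F x) \<le> (k * (\<Sum>b\<in>D. G b)) * N x"
      proof (intro ballI)
        fix F x assume F: "F \<in> \<A>" and x: "x \<in> U"
        define w where "w = x - (\<Sum>b\<in>D. c b x *\<^sub>R b)"
        have Flin: "linear F" using lin F by blast
        have "w \<in> W" unfolding w_def by (rule proj[OF x])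
        then have "F w \<in> W" using W'(2) F by (simp add: preserves_def)
        then have Nw: "N (F w) = 0" by (simp add: N_def cW)
        have Nb: "N (F b) \<le> k * G b" if "b \<in> D" for b
        proof -
          have bV: "b \<in> V" using that D U(2) by blast
          then have FV: "F b \<in> V" using V(2) F by (simp add: preserves_def)
          have "N (F b) \<le> K * G (F b)" by (rule K[OF FV])
          also have "\<dots> \<le> \<bar>K\<bar> * G (F b)" using G0 by (intro mult_right_mono) auto
          also have "\<dots> \<le> \<bar>K\<bar> * (m * G b)" using crude F bV by (intro mult_left_mono) auto
          also have "\<dots> \<le> \<bar>K\<bar> * (\<bar>m\<bar> * G b)" using G0 by (intro mult_left_mono mult_right_mono) auto
          finally show ?thesis by (simp add: k_def mult.assoc)
        qed
        have "F x = F w + F (\<Sum>b\<in>D. c b x *\<^sub>R b)" by (simp add: w_def flip: linear_add[OF Flin])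
        also have "F (\<Sum>b\<in>D. c b x *\<^sub>R b) = (\<Sum>b\<in>D. c b x *\<^sub>R F b)"
          by (simp add: linear_sum[OF Flin] linear_scale[OF Flin])
        finally have "N (F x) \<le> N (F w) + N (\<Sum>b\<in>D. c b x *\<^sub>R F b)" using seminorm_add[OF N] by simp
        also have "\<dots> \<le> (\<Sum>b\<in>D. N (c b x *\<^sub>R F b))" using seminorm_sum[OF N] Nw by simp
        also have "\<dots> \<le> (\<Sum>b\<in>D. \<bar>c b x\<bar> * (k * (\<Sum>b\<in>D. G b)))"
        proof (rule sum_mono)
          fix b assume b: "b \<in> D"
          have "N (F b) \<le> k * G b" by (rule Nb[OF b])
          also have "\<dots> \<le> k * (\<Sum>b\<in>D. G b)"
            using b D G0 by (intro mult_left_mono member_le_sum) (auto simp: k_def)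
          finally show "N (c b x *\<^sub>R F b) \<le> \<bar>c b x\<bar> * (k * (\<Sum>b\<in>D. G b))"
            by (simp add: seminorm_scale[OF N] mult_left_mono)
        qed
        also have "\<dots> = (k * (\<Sum>b\<in>D. G b)) * N x" by (simp add: N_def sum_distrib_right[symmetric])
        finally show "N (F x) \<le> (k * (\<Sum>b\<in>D. G b)) * N x" .
      qed
      have annU: "\<forall>t\<ge>L. \<forall>P\<in>words \<A> t. \<forall>x\<in>U. annihilated n P x" using ann U(2) by blast
      have "\<exists>s C. 0 < s \<and> s < 1 \<and> 1 \<le> C \<and> grow \<A> U N C s"
        by (rule irreducible_quotient_decay[OF lin U(1,3) W'(2,3) maximal D clin dual cW proj N_def crudeN annU])
      then obtain s C where sC: "0 < s" "s < 1" "grow \<A> U N C s" by blast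
      have WV: "W \<subseteq> V" using W'(4) U(2) by blast
      have "dim W < dim U" using UB B(1) W' by (intro dim_psubset_finite) auto
      from less.hyps[OF this W'(1) WV W'(2)] obtain M s' C' K' where
        M: "seminorm M" "0 < s'" "s' < 1" "grow \<A> W M C' s'" "\<forall>x\<in>W. G x \<le> K' * M x" by blast
      show ?thesis
        by (rule extension_decay[OF lin V U W'(2,4) G dom crude D clin cW proj N_def sC M])
    qed
  qed
  obtain N s C K where N: "seminorm N" "0 < s" "s < 1" "grow \<A> V N C s" "\<forall>x\<in>V. G x \<le> K * N x"
    using main[OF V(1) order_refl V(2)] by blast
  obtain K1 where K1: "\<And>x. x \<in> V \<Longrightarrow> N x \<le> K1 * G x" using dom[OF N(1)] by blast
  have "G (P x) \<le> (\<bar>K\<bar> * \<bar>C\<bar> * \<bar>K1\<bar>) * s ^ t * G x" if P: "P \<in> words \<A> t" and x: "x \<in> V" for P t x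
  proof -
    have "G (P x) \<le> K * N (P x)" using N(5) words_preserve[OF V(2) P x] by blast
    also have "\<dots> \<le> \<bar>K\<bar> * N (P x)" using seminorm_nonneg[OF N(1)] by (intro mult_right_mono) auto
    also have "\<dots> \<le> \<bar>K\<bar> * (C * s ^ t * N x)" using growD[OF N(4) P x] by (intro mult_left_mono) auto
    also have "\<dots> \<le> \<bar>K\<bar> * (\<bar>C\<bar> * s ^ t * (\<bar>K1\<bar> * G x))"
    proof (intro mult_left_mono mult_mono)
      have "N x \<le> K1 * G x" by (rule K1[OF x])
      also have "\<dots> \<le> \<bar>K1\<bar> * G x" using seminorm_nonneg[OF G] by (intro mult_right_mono) auto
      finally show "N x \<le> \<bar>K1\<bar> * G x" .
    qed (use N(2) seminorm_nonneg[OF N(1)] in auto)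
    finally show ?thesis by (simp add: mult_ac)
  qed
  then show ?thesis using N(2,3) unfolding grow_def by blast
qed

section \<open>Matrices acting on Rn\<close>

text \<open>Vectors are functions here; pointwise scaling makes the abstract results on subspaces
  and linear maps applicable to \<open>Rn n\<close>.\<close>

instantiation "fun" :: (type, real_vector) real_vector
begin

definition scaleR_fun :: "real \<Rightarrow> ('a \<Rightarrow> 'b) \<Rightarrow> 'a \<Rightarrow> 'b" where
  "scaleR_fun c f = (\<lambda>x. c *\<^sub>R f x)"

instance
  by standard (auto simp: scaleR_fun_def fun_eq_iff scaleR_add_right scaleR_add_left)

end

lemma scaleR_fun_apply [simp]: "(c *\<^sub>R f) x = c *\<^sub>R f x"
  by (simp add: scaleR_fun_def)

lemma sum_fun_apply [simp]: "(\<Sum>i\<in>I. f i) x = (\<Sum>i\<in>I. f i x)"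
  by (induction I rule: infinite_finite_induct) auto

lemma subspace_Rn: "subspace (Rn n)"
  by (auto simp: subspace_def Rn_def)

lemma in_RnI: "(\<And>i. n \<le> i \<Longrightarrow> x i = 0) \<Longrightarrow> x \<in> Rn n"
  by (simp add: Rn_def)

lemma Rn_ge: "x \<in> Rn n \<Longrightarrow> n \<le> i \<Longrightarrow> x i = 0"
  by (simp add: Rn_def)

lemma Rn_eqI: "x \<in> Rn n \<Longrightarrow> y \<in> Rn n \<Longrightarrow> (\<And>i. i < n \<Longrightarrow> x i = y i) \<Longrightarrow> x = y"
  by (rule ext) (metis Rn_ge not_le)

definition unit_vec :: "nat \<Rightarrow> nat \<Rightarrow> real" where
  "unit_vec i = (\<lambda>j. if j = i then 1 else 0)"

lemma Rn_decompose: "x \<in> Rn n \<Longrightarrow> x = (\<Sum>i<n. x i *\<^sub>R unit_vec i)"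
  by (rule ext) (auto simp: unit_vec_def Rn_def if_distrib not_le cong: if_cong)

lemma Rn_span: "Rn n \<subseteq> span (unit_vec ` {..<n})"
proof
  fix x assume "x \<in> Rn n"
  then have "x = (\<Sum>i<n. x i *\<^sub>R unit_vec i)" by (rule Rn_decompose)
  also have "\<dots> \<in> span (unit_vec ` {..<n})"
    by (intro span_sum span_scale span_base) auto
  finally show "x \<in> span (unit_vec ` {..<n})" .
qed

lemma Rn_independent_bound:
  assumes "independent S" "S \<subseteq> Rn n"
  shows "finite S \<and> card S \<le> n"
proof -
  have "S \<subseteq> span (unit_vec ` {..<n})" using assms(2) Rn_span by blast
  from independent_span_bound[OF _ assms(1) this] show ?thesis
    using card_image_le[of "{..<n}" unit_vec] by auto
qed

definition l1norm :: "nat \<Rightarrow> (nat \<Rightarrow> real) \<Rightarrow> real" where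
  "l1norm n x = (\<Sum>i<n. \<bar>x i\<bar>)"

lemma seminorm_l1norm: "seminorm (l1norm n)"
  by (rule seminormI)
    (auto simp: l1norm_def abs_mult sum_distrib_left simp flip: sum.distrib intro!: sum_mono abs_triangle_ineq)

lemma component_le_l1norm: "x \<in> Rn n \<Longrightarrow> \<bar>x i\<bar> \<le> l1norm n x"
  using member_le_sum[of i "{..<n}" "\<lambda>i. \<bar>x i\<bar>"]
  by (cases "i < n") (auto simp: l1norm_def Rn_def sum_nonneg)

lemma seminorm_le_l1norm:
  assumes N: "seminorm N"
  shows "\<exists>K. \<forall>x\<in>Rn n. N x \<le> K * l1norm n x"
proof (intro exI ballI)
  fix x assume "x \<in> Rn n"
  then have "N x = N (\<Sum>i<n. x i *\<^sub>R unit_vec i)" using Rn_decompose by metis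
  also have "\<dots> \<le> (\<Sum>i<n. \<bar>x i\<bar> * N (unit_vec i))"
    by (rule order_trans[OF seminorm_sum[OF N]]) (simp add: seminorm_scale[OF N])
  also have "\<dots> \<le> (\<Sum>i<n. \<bar>x i\<bar> * (\<Sum>j<n. N (unit_vec j)))"
    by (intro sum_mono mult_left_mono member_le_sum) (auto simp: seminorm_nonneg[OF N])
  also have "\<dots> = (\<Sum>j<n. N (unit_vec j)) * l1norm n x"
    by (simp add: l1norm_def sum_distrib_right[symmetric])
  finally show "N x \<le> (\<Sum>j<n. N (unit_vec j)) * l1norm n x" .
qed

lemma mat_vec_in_Rn [simp]: "mat_vec m n A x \<in> Rn m"
  by (simp add: mat_vec_def Rn_def)

lemma linear_mat_vec: "linear (mat_vec m n A)"
  by (rule linearI)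
    (auto simp: mat_vec_def fun_eq_iff distrib_left sum.distrib sum_distrib_left mult_ac)

lemma mat_vec_mat_mul: "mat_vec m l (mat_mul m n l A B) x = mat_vec m n A (mat_vec n l B x)"
proof (rule ext)
  fix i
  have "(\<Sum>j<l. (\<Sum>s<n. A i s * B s j) * x j) = (\<Sum>s<n. A i s * (\<Sum>j<l. B s j * x j))"
    by (simp add: sum_distrib_left sum_distrib_right mult.assoc) (rule sum.swap)
  then show "mat_vec m l (mat_mul m n l A B) x i = mat_vec m n A (mat_vec n l B x) i"
    by (simp add: mat_vec_def mat_mul_def)
qed

lemma mat_vec_idm: "x \<in> Rn n \<Longrightarrow> mat_vec n n (idm n) x = x"
  by (rule ext) (auto simp: mat_vec_def idm_def Rn_def if_distrib[of "\<lambda>a. a * _"] cong: if_cong)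

section \<open>Spectral radius and annihilating polynomials\<close>

lemma eigenvalue_le_spec_rad:
  fixes v :: "nat \<Rightarrow> complex"
  assumes v: "i < n" "v i \<noteq> 0"
    and eig: "\<And>i. i < n \<Longrightarrow> (\<Sum>j<n. complex_of_real (A i j) * v j) = l * v i"
  shows "cmod l \<le> spec_rad n A"
proof -
  define S where "S = {cmod l | l. \<exists>v::nat \<Rightarrow> complex. (\<exists>i<n. v i \<noteq> 0) \<and>
      (\<forall>i<n. (\<Sum>j<n. complex_of_real (A i j) * v j) = l * v i)}"
  \<comment> \<open>A real supremum is informative only for a bounded set. The bound comes from the
    row at which the eigenvector has its largest component.\<close>
  have "x \<le> (\<Sum>i<n. \<Sum>j<n. \<bar>A i j\<bar>)" if "x \<in> S" for x
  proof -
    from that obtain l and v :: "nat \<Rightarrow> complex" and i where x: "x = cmod l" and i: "i < n" "v i \<noteq> 0"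
      and eig: "\<And>i. i < n \<Longrightarrow> (\<Sum>j<n. complex_of_real (A i j) * v j) = l * v i"
      unfolding S_def by blast
    define m where "m = Max ((\<lambda>i. cmod (v i)) ` {..<n})"
    have "m \<in> (\<lambda>i. cmod (v i)) ` {..<n}" unfolding m_def using i by (intro Max_in) auto
    then obtain k where k: "k < n" "m = cmod (v k)" by auto
    have le: "cmod (v j) \<le> m" if "j < n" for j unfolding m_def using that by (intro Max_ge) auto
    have m: "0 < m" using le[OF i(1)] i(2) by (auto intro: less_le_trans[of 0 "cmod (v i)"])
    have "cmod l * m = cmod (\<Sum>j<n. complex_of_real (A k j) * v j)" by (simp add: eig k norm_mult)
    also have "\<dots> \<le> (\<Sum>j<n. \<bar>A k j\<bar> * cmod (v j))"
      by (rule order_trans[OF norm_sum]) (simp add: norm_mult)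
    also have "\<dots> \<le> (\<Sum>j<n. \<bar>A k j\<bar> * m)" using le by (intro sum_mono mult_left_mono) auto
    also have "\<dots> = (\<Sum>j<n. \<bar>A k j\<bar>) * m" by (simp add: sum_distrib_right)
    finally have "cmod l \<le> (\<Sum>j<n. \<bar>A k j\<bar>)" using m by simp
    also have "\<dots> \<le> (\<Sum>i<n. \<Sum>j<n. \<bar>A i j\<bar>)"
      using k by (intro member_le_sum[of k "{..<n}" "\<lambda>i. \<Sum>j<n. \<bar>A i j\<bar>"]) (auto intro: sum_nonneg)
    finally show ?thesis using x by simp
  qed
  then have bdd: "bdd_above (insert 0 S)" unfolding bdd_above_insert by (meson bdd_aboveI)
  have "cmod l \<in> insert 0 S" using v eig unfolding S_def by blast
  then show ?thesis unfolding spec_rad_def S_def[symmetric] using bdd by (rule cSup_upper)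
qed

lemma monic_complex_factorization:
  fixes Q :: "complex poly"
  assumes "degree Q = d" "coeff Q d = 1"
  shows "\<exists>M. size M = d \<and> Q = (\<Prod>l\<in>#M. [:-l, 1:])"
  using assms
proof (induction d arbitrary: Q)
  case 0
  then show ?case by (auto elim!: degree_eq_zeroE)
next
  case (Suc d)
  have "\<exists>i\<in>{1..Suc d}. coeff Q i \<noteq> 0" using Suc.prems(2) by (intro bexI[of _ "Suc d"]) auto
  then obtain l where "(\<Sum>i\<le>Suc d. coeff Q i * l ^ i) = 0"
    using fundamental_theorem_of_algebra[of "coeff Q" "Suc d"] by blast
  then have "poly Q l = 0" by (simp only: poly_altdef Suc.prems(1))
  then obtain R where R: "Q = [:-l, 1:] * R" by (auto simp: poly_eq_0_iff_dvd)
  have "R \<noteq> 0" using Suc.prems(2) R by auto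
  then have deg: "degree R = d" using Suc.prems(1) unfolding R by (subst (asm) degree_mult_eq) auto
  have "coeff R d = 1" using Suc.prems(2) deg by (simp add: R coeff_eq_0)
  from Suc.IH[OF deg this] obtain M where "size M = d" "R = (\<Prod>l\<in>#M. [:-l, 1:])" by blast
  then show ?case using R by (intro exI[of _ "add_mset l M"]) simp
qed

text \<open>Factor by factor: multiplication by X - l with l in the disc at most doubles the
  coefficient bound, and at y at least 1 the factor has modulus at least y - 1/2, hence at least
  y/2. These are the constants in \<open>annihilated\<close>.\<close>

lemma monic_small_roots:
  fixes M :: "complex multiset"
  assumes "\<And>l. l \<in># M \<Longrightarrow> cmod l \<le> 1/2"
  defines "Q \<equiv> \<Prod>l\<in>#M. [:-l, 1:]"
  shows "cmod (coeff Q j) \<le> 2 ^ size M" and "1 \<le> y \<Longrightarrow> (y / 2) ^ size M \<le> cmod (poly Q (complex_of_real y))"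
proof -
  have "cmod (coeff Q j) \<le> 2 ^ size M \<and> (1 \<le> y \<longrightarrow> (y / 2) ^ size M \<le> cmod (poly Q (complex_of_real y)))" for j y
    using assms(1) unfolding Q_def
  proof (induction M arbitrary: j)
    case empty
    then show ?case by (auto simp: coeff_1)
  next
    case (add l M)
    define R where "R = (\<Prod>l\<in>#M. [:-l, 1:])"
    have l: "cmod l \<le> 1/2" using add.prems by simp
    have IH: "cmod (coeff R j) \<le> 2 ^ size M" "1 \<le> y \<longrightarrow> (y / 2) ^ size M \<le> cmod (poly R (complex_of_real y))" for j
      using add unfolding R_def by auto
    have prod: "(\<Prod>l\<in>#add_mset l M. [:-l, 1:]) = [:-l, 1:] * R" by (simp add: R_def)
    have "cmod (coeff ([:-l, 1:] * R) j) \<le> cmod l * cmod (coeff R j) + cmod (coeff (pCons 0 R) j)"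
      using norm_triangle_ineq4[of "coeff (pCons 0 R) j" "l * coeff R j"] by (simp add: norm_mult)
    also have "\<dots> \<le> 1 * 2 ^ size M + 2 ^ size M"
      using l IH(1) by (intro add_mono mult_mono) (auto simp: coeff_pCons split: nat.split)
    finally have 1: "cmod (coeff ([:-l, 1:] * R) j) \<le> 2 ^ size (add_mset l M)" by simp
    have 2: "(y / 2) ^ size (add_mset l M) \<le> cmod (poly ([:-l, 1:] * R) (complex_of_real y))" if y: "1 \<le> y"
    proof -
      have "y / 2 \<le> cmod (complex_of_real y) - cmod l" using y l by simp
      also have "\<dots> \<le> cmod (complex_of_real y - l)" by (rule norm_triangle_ineq2)
      finally have "(y / 2) * (y / 2) ^ size M \<le> cmod (complex_of_real y - l) * cmod (poly R (complex_of_real y))"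
        using IH(2) y by (intro mult_mono) auto
      moreover have "poly ([:-l, 1:] * R) (complex_of_real y) = (complex_of_real y - l) * poly R (complex_of_real y)"
        by (simp add: algebra_simps)
      ultimately show ?thesis by (simp only: norm_mult size_add_mset power_Suc)
    qed
    show ?case unfolding prod using 1 2 by blast
  qed
  then show "cmod (coeff Q j) \<le> 2 ^ size M" "1 \<le> y \<Longrightarrow> (y / 2) ^ size M \<le> cmod (poly Q (complex_of_real y))"
    by blast+
qed

lemma span_image_lessThan:
  fixes v :: "nat \<Rightarrow> 'v::real_vector"
  assumes "y \<in> span (v ` {..<d})"
  obtains b :: "nat \<Rightarrow> real" where "y = (\<Sum>j<d. b j *\<^sub>R v j)"
proof -
  have "\<exists>b::nat \<Rightarrow> real. y = (\<Sum>j<d. b j *\<^sub>R v j)"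
    using assms
  proof (induction rule: span_induct_alt)
    case base
    show ?case by (intro exI[of _ "\<lambda>_. 0"]) simp
  next
    case (step c x y)
    then obtain i b where i: "i < d" "x = v i" and y: "y = (\<Sum>j<d. b j *\<^sub>R v j)" by auto
    have "c *\<^sub>R x = (\<Sum>j<d. (if j = i then c else 0) *\<^sub>R v j)"
      using i by (simp add: if_distrib[of "\<lambda>a. a *\<^sub>R _"] cong: if_cong)
    then have "c *\<^sub>R x + y = (\<Sum>j<d. ((if j = i then c else 0) + b j) *\<^sub>R v j)"
      using y by (simp add: scaleR_add_left sum.distrib)
    then show ?case by (intro exI[of _ "\<lambda>j. (if j = i then c else 0) + b j"])
  qed
  then show ?thesis using that by blast
qed

text \<open>Of \<open>n + 1\<close> vectors in \<open>Rn n\<close>, taken in order, some one depends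
  on its predecessors. A sequence rather than a set is used so that repeated vectors count as
  dependent.\<close>

lemma dependent_iterate:
  assumes "\<And>j. v j \<in> Rn n"
  shows "\<exists>d\<le>n. v d \<in> span (v ` {..<d})"
proof (rule ccontr)
  assume "\<not> ?thesis"
  then have new: "v d \<notin> span (v ` {..<d})" if "d \<le> n" for d using that by blast
  have "independent (v ` {..<m}) \<and> card (v ` {..<m}) = m" if "m \<le> Suc n" for m
    using that
  proof (induction m)
    case (Suc m)
    have "v m \<notin> span (v ` {..<m})" using new Suc.prems by simp
    moreover from this have "v m \<notin> v ` {..<m}" using span_base[of "v m" "v ` {..<m}"] by blast
    ultimately show ?case using Suc by (simp add: lessThan_Suc independent_insert)
  qed (simp add: independent_empty)
  then have "independent (v ` {..<Suc n})" "card (v ` {..<Suc n}) = Suc n" by blast+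
  moreover have "v ` {..<Suc n} \<subseteq> Rn n" using assms by blast
  ultimately show False using Rn_independent_bound[of "v ` {..<Suc n}" n] by simp
qed

text \<open>For a root \<open>l\<close> of the annihilating polynomial of least degree, the cofactor of \<open>X - l\<close> maps \<open>x\<close> to an eigenvector for \<open>l\<close>.\<close>
lemma small_spec_rad_annihilated:
  assumes P: "\<And>y. y \<in> Rn n \<Longrightarrow> P y = mat_vec n n A y" and small: "spec_rad n A \<le> 1/2" and x: "x \<in> Rn n"
  shows "annihilated n P x"
proof -
  define v where "v j = (P ^^ j) x" for j
  have vR: "v j \<in> Rn n" for j
    by (induction j) (use x P in \<open>auto simp: v_def\<close>)
  have vSuc: "v (Suc j) = mat_vec n n A (v j)" for j using P[OF vR[of j]] by (simp add: v_def)
  define d where "d = (LEAST d. v d \<in> span (v ` {..<d}))"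
  obtain d0 where d0: "d0 \<le> n" "v d0 \<in> span (v ` {..<d0})" using dependent_iterate[of v n] vR by blast
  have d: "v d \<in> span (v ` {..<d})" unfolding d_def using d0(2) by (rule LeastI)
  have "d \<le> d0" unfolding d_def using d0(2) by (rule Least_le)
  then have dn: "d \<le> n" using d0(1) by simp
  have least: "v e \<notin> span (v ` {..<e})" if "e < d" for e
    using that not_less_Least unfolding d_def by blast
  obtain b where b: "v d = (\<Sum>j<d. b j *\<^sub>R v j)" using span_image_lessThan[OF d] .
  define a where "a j = (if j = d then 1 else - b j)" for j
  have ann: "(\<Sum>j\<le>d. a j *\<^sub>R v j) = 0"
    by (simp add: a_def b flip: lessThan_Suc_atMost sum.distrib)
  define Q where "Q = (\<Sum>j\<le>d. monom (complex_of_real (a j)) j)"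
  have cQ: "coeff Q j = (if j \<le> d then complex_of_real (a j) else 0)" for j
    by (simp add: Q_def coeff_sum)
  have degQ: "degree Q = d"
    by (rule antisym[OF degree_le le_degree]) (simp_all add: cQ a_def)
  have Q0: "Q \<noteq> 0" using cQ[of d] by (auto simp: a_def)
  have root: "cmod l \<le> 1/2" if l: "poly Q l = 0" for l
  proof -
    obtain R where R: "Q = [:-l, 1:] * R" using l by (auto simp: poly_eq_0_iff_dvd)
    have R0: "R \<noteq> 0" using Q0 R by auto
    have "d = Suc (degree R)" using degQ R0 unfolding R by (subst (asm) degree_mult_eq) auto
    then obtain e where e: "d = Suc e" "degree R = e" by auto
    have cQ0: "coeff Q 0 = - l * coeff R 0" and cQS: "coeff Q (Suc j) = coeff R j - l * coeff R (Suc j)" for j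
      by (simp_all add: R)
    have Re: "coeff R e = 1"
      using cQS[of e] cQ[of "Suc e"] e by (simp add: coeff_eq_0 a_def)
    define u where "u i = (\<Sum>j\<le>e. coeff R j * complex_of_real (v j i))" for i
    have "\<exists>i<n. u i \<noteq> 0"
    proof (rule ccontr)
      assume "\<not> ?thesis"
      then have u0: "u i = 0" for i
        by (cases "i < n") (auto simp: u_def Rn_ge[OF vR])
      \<comment> \<open>The vectors \<open>v j\<close> are real, so the real part is a relation
        among them; the leading coefficient 1 would make \<open>v e\<close> depend on earlier
        iterates, against the minimality of \<open>d\<close>.\<close>
      have "(\<Sum>j\<le>e. Re (coeff R j) *\<^sub>R v j) = 0"
      proof (rule ext)
        fix i
        have "Re (u i) = 0" using u0 by simp
        then show "(\<Sum>j\<le>e. Re (coeff R j) *\<^sub>R v j) i = 0 i" by (simp add: u_def)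
      qed
      then have "v e + (\<Sum>j<e. Re (coeff R j) *\<^sub>R v j) = 0"
        by (simp add: Re add.commute flip: lessThan_Suc_atMost)
      then have "v e = - (\<Sum>j<e. Re (coeff R j) *\<^sub>R v j)" by (simp add: eq_neg_iff_add_eq_0)
      also have "\<dots> \<in> span (v ` {..<e})"
        by (intro span_neg span_sum span_scale span_base) auto
      finally show False using least[of e] e by simp
    qed
    then obtain i where i: "i < n" "u i \<noteq> 0" by blast
    have "(\<Sum>k<n. complex_of_real (A i k) * u k) = l * u i" if "i < n" for i
    proof -
      have "(\<Sum>k<n. complex_of_real (A i k) * u k)
          = (\<Sum>j\<le>e. coeff R j * (\<Sum>k<n. complex_of_real (A i k) * complex_of_real (v j k)))"
        unfolding u_def sum_distrib_left by (subst sum.swap) (simp add: mult_ac)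
      also have "\<dots> = (\<Sum>j\<le>e. coeff R j * complex_of_real (v (Suc j) i))"
        using that by (simp add: vSuc mat_vec_def)
      finally have Au: "(\<Sum>k<n. complex_of_real (A i k) * u k) = (\<Sum>j\<le>e. coeff R j * complex_of_real (v (Suc j) i))" .
      have "(\<Sum>j\<le>d. a j * v j i) = 0" using fun_cong[OF ann, of i] by simp
      then have "(\<Sum>j\<le>Suc e. coeff Q j * complex_of_real (v j i)) = 0"
        using e by (simp add: cQ flip: of_real_mult of_real_sum)
      \<comment> \<open>From Q = (X - l) R and Q(P) x = 0, shifting the index by one gives P u = l u
        in every component.\<close>
      then have "(\<Sum>j\<le>e. coeff R j * complex_of_real (v (Suc j) i))
          = l * (\<Sum>j\<le>Suc e. coeff R j * complex_of_real (v j i))"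
        unfolding sum.atMost_Suc_shift[of _ e] cQ0 cQS
        by (simp add: algebra_simps sum_subtractf sum_distrib_left)
      also have "(\<Sum>j\<le>Suc e. coeff R j * complex_of_real (v j i)) = u i"
        using e by (simp add: u_def coeff_eq_0)
      finally show ?thesis using Au by simp
    qed
    from eigenvalue_le_spec_rad[OF i this] show ?thesis using small by simp
  qed
  obtain M where M: "size M = d" "Q = (\<Prod>l\<in>#M. [:-l, 1:])"
    using monic_complex_factorization[OF degQ] cQ[of d] by (auto simp: a_def)
  have roots: "cmod l \<le> 1/2" if "l \<in># M" for l
    using root[of l] that by (auto simp: M(2) poly_prod_mset image_iff)
  note bounds = monic_small_roots[of M, OF roots, folded M(2), unfolded M(1)]
  show ?thesis unfolding annihilated_def
  proof (intro exI[of _ d] exI[of _ a] conjI allI impI)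
    fix j assume "j \<le> d"
    then have "\<bar>a j\<bar> = cmod (coeff Q j)" by (simp add: cQ)
    also have "\<dots> \<le> 2 ^ d" using bounds(1) by blast
    also have "\<dots> \<le> 2 ^ n" using dn by simp
    finally show "\<bar>a j\<bar> \<le> 2 ^ n" .
  next
    fix y :: real assume y: "1 \<le> y"
    have "poly Q (complex_of_real y) = complex_of_real (\<Sum>j\<le>d. a j * y ^ j)"
      by (simp add: poly_altdef degQ cQ)
    then show "(y / 2) ^ d \<le> \<bar>\<Sum>j\<le>d. a j * y ^ j\<bar>"
      using bounds(2)[OF _ y] by (metis norm_of_real real_norm_def)
  qed (use dn ann in \<open>simp_all add: v_def\<close>)
qed

section \<open>From the joint spectral radius to decay\<close>

lemma prodm_cong: "(\<And>s. s < t \<Longrightarrow> Ms s = Ms' s) \<Longrightarrow> prodm n t Ms = prodm n t Ms'"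
  by (induction t) auto

text \<open>Words grow on the left and \<open>prodm\<close> on the right, so the induction splits
  off the factor applied first. Equality holds on \<open>Rn n\<close> only, because
  \<open>idm n\<close> cuts off the coordinates beyond \<open>n\<close>.\<close>

lemma words_prodm:
  assumes "P \<in> words (mat_vec n n ` \<M>) t"
  shows "\<exists>Ms. (\<forall>s<t. Ms s \<in> \<M>) \<and> (\<forall>x\<in>Rn n. P x = mat_vec n n (prodm n t Ms) x)"
  using assms
proof (induction t arbitrary: P)
  case 0
  then show ?case by (simp add: mat_vec_idm)
next
  case (Suc t)
  have "P \<in> words (mat_vec n n ` \<M>) (t + 1)" using Suc.prems by simp
  from words_split[OF this] obtain Q R where Q: "Q \<in> words (mat_vec n n ` \<M>) t"
    and R: "R \<in> words (mat_vec n n ` \<M>) 1" and P: "P = Q \<circ> R" .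
  from R obtain M where M: "M \<in> \<M>" "R = mat_vec n n M" by auto
  from Suc.IH[OF Q] obtain Ms where Ms: "\<forall>s<t. Ms s \<in> \<M>"
    "\<forall>x\<in>Rn n. Q x = mat_vec n n (prodm n t Ms) x" by blast
  have "prodm n t (Ms(t := M)) = prodm n t Ms" by (rule prodm_cong) simp
  then have "\<forall>x\<in>Rn n. P x = mat_vec n n (prodm n (Suc t) (Ms(t := M))) x"
    using Ms M P by (simp add: mat_vec_mat_mul)
  moreover have "\<forall>s<Suc t. (Ms(t := M)) s \<in> \<M>" using Ms M by (auto simp: less_Suc_eq)
  ultimately show ?case by blast
qed

lemma jsr_less_one_imp_decay:
  assumes jsr: "jsr n \<M> \<le> ereal \<rho>" and \<rho>: "\<rho> < 1"
    and bounded: "\<And>A i j. A \<in> \<M> \<Longrightarrow> i < n \<Longrightarrow> j < n \<Longrightarrow> \<bar>A i j\<bar> \<le> b"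
  shows "\<exists>s C. 0 < s \<and> s < 1 \<and> grow (mat_vec n n ` \<M>) (Rn n) (l1norm n) C s"
proof -
  \<comment> \<open>A number strictly between \<open>\<rho>\<close> and 1; the maximum keeps it
    positive if the bound \<open>\<rho>\<close> is negative.\<close>
  define r where "r = (max \<rho> 0 + 1) / 2"
  have r: "\<rho> < r" "0 < r" "r < 1" using \<rho> by (auto simp: r_def max_def)
  define J where "J t = (SUP Ms \<in> {Ms. \<forall>s<t. Ms s \<in> \<M>}.
       ereal (spec_rad n (prodm n t Ms) powr (1 / real t)))" for t
  have "jsr n \<M> < ereal r" using jsr r(1) by (auto intro: le_less_trans)
  then have "eventually (\<lambda>t. J t < ereal r) sequentially"
    unfolding jsr_def J_def by (rule Limsup_lessD)
  moreover have "eventually (\<lambda>t. r ^ t < 1/2) sequentially"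
    using r by (intro order_tendstoD(2)[OF LIMSEQ_realpow_zero]) auto
  ultimately have "eventually (\<lambda>t. 1 \<le> t \<and> J t < ereal r \<and> r ^ t < 1/2) sequentially"
    using eventually_ge_at_top[of "1::nat"] by eventually_elim auto
  then have "\<exists>L. \<forall>t\<ge>L. 1 \<le> t \<and> J t < ereal r \<and> r ^ t < 1/2"
    by (simp only: eventually_sequentially)
  then obtain L where L: "\<forall>t\<ge>L. 1 \<le> t \<and> J t < ereal r \<and> r ^ t < 1/2" ..
  have small: "spec_rad n (prodm n t Ms) \<le> 1/2" if t: "L \<le> t" and Ms: "\<forall>s<t. Ms s \<in> \<M>" for t Ms
  proof (cases "0 < spec_rad n (prodm n t Ms)")
    case True
    define \<sigma> where "\<sigma> = spec_rad n (prodm n t Ms)"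
    have Lt: "1 \<le> t" "J t < ereal r" "r ^ t < 1/2" using L t by auto
    have "ereal (\<sigma> powr (1 / real t)) \<le> J t"
      unfolding \<sigma>_def J_def using Ms by (intro SUP_upper) auto
    also note Lt(2)
    finally have "\<sigma> powr (1 / real t) < r" by simp
    then have "(\<sigma> powr (1 / real t)) ^ t \<le> r ^ t" by (intro power_mono) auto
    moreover have "(\<sigma> powr (1 / real t)) ^ t = \<sigma>"
      using True Lt(1) by (simp add: \<sigma>_def powr_powr flip: powr_realpow)
    ultimately show ?thesis using Lt(3) unfolding \<sigma>_def by linarith
  qed simp
  have ann: "\<forall>t\<ge>L. \<forall>P\<in>words (mat_vec n n ` \<M>) t. \<forall>x\<in>Rn n. annihilated n P x"
  proof (intro allI impI ballI)
    fix t P x assume t: "L \<le> t" and P: "P \<in> words (mat_vec n n ` \<M>) t" and x: "x \<in> Rn n"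
    from words_prodm[OF P] obtain Ms where Ms: "\<forall>s<t. Ms s \<in> \<M>"
      "\<forall>x\<in>Rn n. P x = mat_vec n n (prodm n t Ms) x" by blast
    show "annihilated n P x"
      by (rule small_spec_rad_annihilated[OF _ small[OF t Ms(1)] x]) (use Ms in blast)
  qed
  have crude: "\<forall>F\<in>mat_vec n n ` \<M>. \<forall>x\<in>Rn n. l1norm n (F x) \<le> (n * b) * l1norm n x"
  proof (intro ballI, elim imageE, hypsubst)
    fix x A assume x: "x \<in> Rn n" and A: "A \<in> \<M>"
    have "l1norm n (mat_vec n n A x) \<le> (\<Sum>i<n. \<Sum>j<n. \<bar>A i j\<bar> * \<bar>x j\<bar>)"
      unfolding l1norm_def mat_vec_def
      by (intro sum_mono) (auto simp: abs_mult intro!: order_trans[OF sum_abs])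
    also have "\<dots> \<le> (\<Sum>i<n. \<Sum>j<n. b * \<bar>x j\<bar>)"
      using bounded[OF A] by (intro sum_mono mult_right_mono) auto
    also have "\<dots> = (n * b) * l1norm n x" by (simp add: l1norm_def sum_distrib_left mult_ac)
    finally show "l1norm n (mat_vec n n A x) \<le> (n * b) * l1norm n x" .
  qed
  show ?thesis
  proof (rule annihilated_imp_decay[OF _ _ Rn_span subspace_Rn _ seminorm_l1norm _ crude ann])
    show "\<exists>K. \<forall>x\<in>Rn n. N x \<le> K * l1norm n x" if "seminorm N" for N
      using that by (rule seminorm_le_l1norm)
  qed (auto simp: linear_mat_vec preserves_def)
qed

section \<open>Orthogonal complements and block vectors\<close>

text \<open>Among the images of the unit vectors followed by \<open>y\<close>, some vector depends
  on its predecessors. Injectivity rules this out for the images, so it is \<open>y\<close>.\<close>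

lemma linear_injective_imp_surjective_Rn:
  assumes F: "linear F" "\<And>x. x \<in> Rn n \<Longrightarrow> F x \<in> Rn n"
    and inj: "\<And>x. x \<in> Rn n \<Longrightarrow> F x = 0 \<Longrightarrow> x = 0" and y: "y \<in> Rn n"
  shows "\<exists>x\<in>Rn n. F x = y"
proof -
  define v where "v j = (if j < n then F (unit_vec j) else y)" for j
  have unit: "unit_vec j \<in> Rn m" if "j < m" for j m using that by (auto simp: unit_vec_def Rn_def)
  have "v j \<in> Rn n" for j using F(2) unit y by (auto simp: v_def)
  then obtain d where d: "d \<le> n" "v d \<in> span (v ` {..<d})" using dependent_iterate[of v n] by blast
  have "v ` {..<d} \<subseteq> F ` Rn d" using d(1) unit by (auto simp: v_def)
  then have "span (v ` {..<d}) \<subseteq> F ` Rn d"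
    by (rule span_minimal) (rule linear_subspace_image[OF F(1) subspace_Rn])
  then obtain w where w: "w \<in> Rn d" "v d = F w" using d(2) by blast
  have wn: "w \<in> Rn n" using w(1) d(1) by (auto simp: Rn_def)
  show ?thesis
  proof (cases "d < n")
    case True
    then have "F (unit_vec d - w) = 0" using w(2) by (simp add: v_def linear_diff[OF F(1)])
    then have "unit_vec d - w = 0" using inj subspace_diff[OF subspace_Rn unit[OF True] wn] by blast
    then have "(unit_vec d - w) d = 0" by simp
    then have "w d = 1" by (simp add: unit_vec_def)
    then show ?thesis using w(1) by (simp add: Rn_def)
  next
    case False
    then show ?thesis using w(2) wn by (auto simp: v_def)
  qed
qed

lemma full_col_rankD: "full_col_rank m n A \<Longrightarrow> y \<in> Rn n \<Longrightarrow> mat_vec m n A y = 0 \<Longrightarrow> y = 0"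
  by (simp add: full_col_rank_def)

lemma mat_vec_zero [simp]: "mat_vec m n A 0 = 0"
  by (rule linear_0[OF linear_mat_vec])

text \<open>Pairing the hypothesis with \<open>w\<close> gives the sum of squares of
  \<open>A w\<close>.\<close>

lemma gram_injective:
  assumes A: "full_col_rank m n A" and w: "w \<in> Rn n"
    and z: "mat_vec n m (transp A) (mat_vec m n A w) = 0"
  shows "w = 0"
proof -
  define x where "x = mat_vec m n A w"
  have "(\<Sum>i<m. (x i)\<^sup>2) = (\<Sum>i<m. \<Sum>j<n. w j * (A i j * x i))"
    unfolding power2_eq_square
    by (rule sum.cong[OF refl], subst (1) x_def) (simp add: mat_vec_def sum_distrib_right sum_distrib_left mult_ac)
  also have "\<dots> = (\<Sum>j<n. w j * (\<Sum>i<m. A i j * x i))"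
    by (subst sum.swap) (simp add: sum_distrib_left)
  also have "\<dots> = (\<Sum>j<n. w j * mat_vec n m (transp A) x j)"
    by (simp add: mat_vec_def transp_def)
  also have "\<dots> = 0" using z by (simp add: x_def)
  finally have "\<forall>i<m. x i = 0" by (simp add: sum_nonneg_eq_0_iff)
  then have "x = 0" by (intro Rn_eqI[of x m 0]) (auto simp: x_def Rn_def mat_vec_def)
  then show ?thesis using full_col_rankD[OF A w] by (simp add: x_def)
qed

lemma is_perp_annihilates:
  assumes "is_perp p r \<alpha> aperp"
  shows "mat_vec (p - r) p (transp aperp) (mat_vec p r \<alpha> y) = 0"
proof -
  have "mat_vec (p - r) p (transp aperp) (mat_vec p r \<alpha> y) = mat_vec (p - r) r (mat_mul (p - r) p r (transp aperp) \<alpha>) y"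
    by (rule mat_vec_mat_mul[symmetric])
  also have "\<dots> = 0" using assms by (auto simp: is_perp_def mat_vec_def fun_eq_iff)
  finally show ?thesis .
qed

text \<open>Already the range of \<open>aperp\<close> suffices: there the map is the Gram matrix,
  injective and hence onto.\<close>

lemma is_perp_surjective:
  assumes "is_perp p r \<alpha> aperp" "y \<in> Rn (p - r)"
  shows "\<exists>x\<in>Rn p. mat_vec (p - r) p (transp aperp) x = y"
proof -
  have rank: "full_col_rank p (p - r) aperp" using assms(1) by (simp add: is_perp_def)
  define F where "F = (\<lambda>w. mat_vec (p - r) p (transp aperp) (mat_vec p (p - r) aperp w))"
  have "linear F" using linear_compose[OF linear_mat_vec linear_mat_vec] unfolding F_def o_def .
  then have "\<exists>w\<in>Rn (p - r). F w = y"
    by (rule linear_injective_imp_surjective_Rn) (use gram_injective[OF rank] assms(2) in \<open>auto simp: F_def\<close>)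
  then show ?thesis unfolding F_def by (meson mat_vec_in_Rn)
qed

text \<open>The columns of \<open>aperp\<close> and \<open>\<alpha>\<close> together form an
  invertible square matrix, so \<open>x\<close> is a sum of one vector from each range; the kernel
  condition kills the first. A vector \<open>v\<close> of length \<open>p\<close> carries both
  coefficient vectors, \<open>a v\<close> in front and \<open>b v\<close> behind.\<close>

lemma is_perp_kernel:
  assumes perp: "is_perp p r \<alpha> aperp" and \<alpha>: "full_col_rank p r \<alpha>" and r: "r \<le> p"
    and x: "x \<in> Rn p" "mat_vec (p - r) p (transp aperp) x = 0"
  shows "\<exists>y\<in>Rn r. x = mat_vec p r \<alpha> y"
proof -
  have rank: "full_col_rank p (p - r) aperp" using perp by (simp add: is_perp_def)
  define a b where "a = (\<lambda>v::nat \<Rightarrow> real. \<lambda>j. if j < p - r then v j else 0)" and "b = (\<lambda>v::nat \<Rightarrow> real. \<lambda>j. v (p - r + j))"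
  define F where "F v = mat_vec p (p - r) aperp (a v) + mat_vec p r \<alpha> (b v)" for v
  have aR: "a v \<in> Rn (p - r)" for v by (simp add: a_def Rn_def)
  have bR: "b v \<in> Rn r" if "v \<in> Rn p" for v using that r by (auto simp: b_def Rn_def)
  have la: "linear a" and lb: "linear b" by (auto intro!: linearI simp: a_def b_def)
  have F: "linear F" unfolding F_def
    using linear_compose[OF la linear_mat_vec] linear_compose[OF lb linear_mat_vec]
    by (intro linear_compose_add) (simp_all add: o_def)
  have perpF: "mat_vec (p - r) p (transp aperp) (F v) = mat_vec (p - r) p (transp aperp) (mat_vec p (p - r) aperp (a v))" for v
    by (simp add: F_def linear_add[OF linear_mat_vec] is_perp_annihilates[OF perp])
  have "\<exists>v\<in>Rn p. F v = x"
  proof (rule linear_injective_imp_surjective_Rn[OF F _ _ x(1)])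
    show "F v \<in> Rn p" for v unfolding F_def by (intro subspace_add subspace_Rn mat_vec_in_Rn)
  next
    fix v assume v: "v \<in> Rn p" "F v = 0"
    then have a0: "a v = 0" using gram_injective[OF rank aR] perpF[of v] by simp
    then have "b v = 0" using full_col_rankD[OF \<alpha> bR[OF v(1)]] v(2) by (simp add: F_def)
    show "v = 0"
    proof (rule ext)
      fix j
      show "v j = 0 j" using fun_cong[OF a0, of j] fun_cong[OF \<open>b v = 0\<close>, of "j - (p - r)"]
        by (auto simp: a_def b_def split: if_splits)
    qed
  qed
  then obtain v where v: "v \<in> Rn p" "F v = x" by blast
  then have "a v = 0" using gram_injective[OF rank aR] perpF[of v] x(2) by simp
  then show ?thesis using v bR by (auto simp: F_def intro!: bexI[of _ "b v"])
qed

section \<open>Block vectors and componentwise limits\<close>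

lemma tendsto_fun_iff:
  fixes f :: "'a \<Rightarrow> 'b \<Rightarrow> real"
  shows "(f \<longlongrightarrow> l) F \<longleftrightarrow> (\<forall>i. ((\<lambda>c. f c i) \<longlongrightarrow> l i) F)"
  using limitin_componentwise[of "\<lambda>_. euclidean" UNIV f l F]
  by (simp add: euclidean_product_topology)

lemma blk_apply: "m < p \<Longrightarrow> blk p i x m = x (i * p + m)"
  by (simp add: blk_def)

lemma blk_in_Rn [simp]: "blk p i x \<in> Rn p"
  by (simp add: blk_def Rn_def)

definition join_blocks :: "nat \<Rightarrow> nat \<Rightarrow> (nat \<Rightarrow> nat \<Rightarrow> real) \<Rightarrow> (nat \<Rightarrow> real)" where
  "join_blocks p k F = (\<lambda>j. if j < k * p then F (j div p) (j mod p) else 0)"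

lemma join_blocks_in_Rn [simp]: "join_blocks p k F \<in> Rn (k * p)"
  by (simp add: join_blocks_def Rn_def)

lemma block_index_less: "i < k \<Longrightarrow> m < p \<Longrightarrow> i * p + m < k * (p::nat)"
proof -
  assume "i < k" "m < p"
  then have "i * p + m < Suc i * p" by simp
  also have "\<dots> \<le> k * p" using \<open>i < k\<close> by (intro mult_le_mono1) auto
  finally show ?thesis .
qed

lemma join_blocks_apply: "i < k \<Longrightarrow> m < p \<Longrightarrow> join_blocks p k F (i * p + m) = F i m"
  using block_index_less[of i k m p] by (simp add: join_blocks_def)

lemma blk_join_blocks: "i < k \<Longrightarrow> F i \<in> Rn p \<Longrightarrow> blk p i (join_blocks p k F) = F i"
  by (rule ext) (auto simp: blk_def join_blocks_apply Rn_def not_less)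

lemma block_eqI:
  assumes "x \<in> Rn (k * p)" "y \<in> Rn (k * p)" "\<And>i m. i < k \<Longrightarrow> m < p \<Longrightarrow> x (i * p + m) = y (i * p + m)"
  shows "x = y"
proof (rule Rn_eqI[OF assms(1,2)])
  fix j assume j: "j < k * p"
  then have "0 < p" by (cases p) auto
  then have "j div p < k" "j mod p < p" using j by (auto simp: less_mult_imp_div_less)
  from assms(3)[OF this] show "x j = y j" by simp
qed

section \<open>The companion form\<close>

lemma mat_vec_D0mat_top:
  assumes "l < r"
  shows "mat_vec m n (D0mat p k r) x l = 0"
  using assms by (simp add: mat_vec_def D0mat_def)

text \<open>Rows are counted from the first row of D, columns from block 0 of the state, hence the
  shift by one. For the last block row, block \<open>i + 2\<close> lies outside the state and reads
  as 0.\<close>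

lemma mat_vec_D0mat_block:
  assumes i: "Suc i < k" and m: "m < p" and x: "x \<in> Rn (k * p)"
  shows "mat_vec (p * (k - 1) + r) (k * p) (D0mat p k r) x (r + i * p + m) = x ((i + 2) * p + m) - x ((i + 1) * p + m)"
proof -
  define a b where "a = (i + 1) * p + m" and "b = (i + 2) * p + m"
  have row: "i * p + m < p * (k - 1)" using block_index_less[of i "k - 1" m p] i m by (simp add: mult.commute)
  have entry: "D0mat p k r (r + i * p + m) j = (if j = b then 1 else 0) - (if j = a then 1 else 0)"
    if j: "j < k * p" for j
  proof (cases "p \<le> j")
    case True
    define J where "J = j - p"
    have "j = p + J" using True by (simp add: J_def)
    have J: "J < p * (k - 1)" using j True i by (cases k) (auto simp: J_def algebra_simps)
    have 1: "J mod p = m \<and> J div p = i' \<longleftrightarrow> J = i' * p + m" for i'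
      using m by (metis add.commute div_mult_mod_eq div_mult_self3 div_less mod_less mod_mult_self3 add_0_right gr_implies_not0)
    have "D0mat p k r (r + i * p + m) j = Dmat p k (i * p + m) J"
      using True by (simp add: D0mat_def J_def add.assoc)
    also have "\<dots> = (if J mod p = m \<and> J div p = i then -1 else if J mod p = m \<and> J div p = i + 1 then 1 else 0)"
      using row J m by (auto simp: Dmat_def)
    also have "\<dots> = (if J = i * p + m then -1 else if J = (i + 1) * p + m then 1 else 0)" unfolding 1 ..
    also have "\<dots> = (if j = b then 1 else 0) - (if j = a then 1 else 0)"
      using \<open>j = p + J\<close> m by (auto simp: a_def b_def)
    finally show ?thesis .
  qed (auto simp: D0mat_def a_def b_def)
  have "mat_vec (p * (k - 1) + r) (k * p) (D0mat p k r) x (r + i * p + m)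
      = (\<Sum>j<k * p. D0mat p k r (r + i * p + m) j * x j)"
    using row by (simp add: mat_vec_def)
  also have "\<dots> = (\<Sum>j<k * p. (if j = b then x j else 0) - (if j = a then x j else 0))"
    by (rule sum.cong) (auto simp: entry)
  also have "\<dots> = (if b < k * p then x b else 0) - (if a < k * p then x a else 0)"
    by (simp add: sum_subtractf)
  also have "\<dots> = x b - x a" using Rn_ge[OF x] by auto
  finally show ?thesis by (simp add: a_def b_def)
qed

lemma mat_vec_balpha:
  assumes v: "v \<in> Rn (p * (k - 1) + r)" and k: "1 \<le> k" and l: "l < k * p"
  shows "mat_vec (k * p) (p * (k - 1) + r) (balpha p k r \<alpha>) v l
    = (if l < p then mat_vec p r \<alpha> v l + v (r + l) else v (r + (l - p)))"
proof -
  define n where "n = p * (k - 1)"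
  have kp: "k * p = p + n" using k by (cases k) (auto simp: n_def)
  have "mat_vec (k * p) (n + r) (balpha p k r \<alpha>) v l = (\<Sum>j<r + n. balpha p k r \<alpha> l j * v j)"
    using l by (simp add: mat_vec_def add.commute)
  also have "\<dots> = (\<Sum>j<r. balpha p k r \<alpha> l j * v j) + (\<Sum>j<n. balpha p k r \<alpha> l (r + j) * v (r + j))"
    unfolding lessThan_atLeast0 by (subst sum.atLeastLessThan_concat[of 0 r "r + n", symmetric])
      (auto simp: sum.shift_bounds_nat_ivl[of _ 0 r n, simplified] add.commute)
  also have "\<dots> = (if l < p then mat_vec p r \<alpha> v l + v (r + l) else v (r + (l - p)))"
  proof (cases "l < p")
    case True
    have "(\<Sum>j<r. balpha p k r \<alpha> l j * v j) = mat_vec p r \<alpha> v l"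
      using True by (simp add: balpha_def mat_vec_def)
    moreover have "(\<Sum>j<n. balpha p k r \<alpha> l (r + j) * v (r + j)) = (\<Sum>j<n. if j = l then v (r + j) else 0)"
      using True by (intro sum.cong) (auto simp: balpha_def transp_def Emat_def n_def)
    moreover have "(\<Sum>j<n. if j = l then v (r + j) else 0) = v (r + l)"
      using Rn_ge[OF v, of "r + l"] by (simp add: n_def)
    ultimately show ?thesis using True by simp
  next
    case False
    have "(\<Sum>j<r. balpha p k r \<alpha> l j * v j) = 0"
      using False by (simp add: balpha_def)
    moreover have "(\<Sum>j<n. balpha p k r \<alpha> l (r + j) * v (r + j)) = (\<Sum>j<n. if j = l - p then v (r + j) else 0)"
      using False l kp by (intro sum.cong) (auto simp: balpha_def idm_def n_def)
    moreover have "(\<Sum>j<n. if j = l - p then v (r + j) else 0) = v (r + (l - p))"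
      using l kp False by (simp add: n_def)
    ultimately show ?thesis using False by simp
  qed
  finally show ?thesis by (simp add: n_def)
qed

text \<open>\<open>w i\<close> stands for z at lag \<open>i\<close>. Summation by parts with f_i =
  g_i - g_(i-1) gives the error-correction form: g_k is an empty sum, and g_0 at lag 1 is rewritten
  by \<pi> = \<alpha> \<theta>.\<close>

lemma var_identity:
  fixes w :: "nat \<Rightarrow> nat \<Rightarrow> real"
  assumes k: "1 \<le> k" and w1: "pifun k f (w 1) = mat_vec p r \<alpha> (\<theta> (w 1))"
    and eq: "f 0 (w 0) = mat_vec p r \<alpha> \<mu> + (\<Sum>i\<in>{1..k}. f i (w i)) + u"
  shows "f 0 (w 0) - (\<Sum>j\<in>{1..k-1}. gfun k f j (w j))
    = f 0 (w 1) - (\<Sum>j\<in>{1..k-1}. gfun k f j (w (j + 1))) + mat_vec p r \<alpha> (\<theta> (w 1) + \<mu>) + u"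
proof -
  have diff: "f i x = gfun k f i x - gfun k f (i - 1) x" if "i \<in> {1..k}" for i x
  proof -
    have "{i - 1 + 1..k} = insert i {i + 1..k}" using that by auto
    then show ?thesis by (simp add: gfun_def)
  qed
  obtain k' where k': "k = Suc k'" using k by (cases k) auto
  have "(\<Sum>i\<in>{1..k}. f i (w i)) = (\<Sum>i\<in>{1..k}. gfun k f i (w i) - gfun k f (i - 1) (w i))"
    by (rule sum.cong[OF refl diff])
  also have "\<dots> = (\<Sum>i\<in>{1..k}. gfun k f i (w i)) - (\<Sum>i\<in>{1..k}. gfun k f (i - 1) (w i))"
    by (rule sum_subtractf)
  also have "(\<Sum>i\<in>{1..k}. gfun k f i (w i)) = (\<Sum>i\<in>{1..k-1}. gfun k f i (w i))"
    by (simp add: k' gfun_def)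
  also have "(\<Sum>i\<in>{1..k}. gfun k f (i - 1) (w i)) = (\<Sum>i\<in>{0..k'}. gfun k f i (w (Suc i)))"
    unfolding k' One_nat_def sum.shift_bounds_cl_Suc_ivl by simp
  also have "\<dots> = gfun k f 0 (w 1) + (\<Sum>j\<in>{1..k-1}. gfun k f j (w (j + 1)))"
    by (simp add: sum.atLeast_Suc_atMost k')
  finally have "(\<Sum>i\<in>{1..k}. f i (w i)) = (\<Sum>i\<in>{1..k-1}. gfun k f i (w i))
    - (gfun k f 0 (w 1) + (\<Sum>j\<in>{1..k-1}. gfun k f j (w (j + 1))))" .
  moreover have "gfun k f 0 (w 1) = - f 0 (w 1) - mat_vec p r \<alpha> (\<theta> (w 1))"
    unfolding w1[symmetric] by (simp add: gfun_def pifun_def)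
  ultimately show ?thesis unfolding eq by (simp add: linear_add[OF linear_mat_vec])
qed

lemma l1norm_mat_vec_le: "l1norm m (mat_vec m n A x) \<le> (\<Sum>i<m. \<Sum>j<n. \<bar>A i j\<bar>) * l1norm n x"
proof -
  have "l1norm m (mat_vec m n A x) \<le> (\<Sum>i<m. \<Sum>j<n. \<bar>A i j\<bar> * \<bar>x j\<bar>)"
    unfolding l1norm_def mat_vec_def
    by (intro sum_mono) (auto simp: abs_mult intro!: order_trans[OF sum_abs])
  also have "\<dots> \<le> (\<Sum>i<m. \<Sum>j<n. \<bar>A i j\<bar> * l1norm n x)"
    unfolding l1norm_def by (intro sum_mono mult_left_mono member_le_sum) auto
  finally show ?thesis by (simp add: sum_distrib_right)
qed

lemma entry_le_fro_norm:
  assumes "i < m" "j < n"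
  shows "\<bar>A i j\<bar> \<le> fro_norm m n A"
proof -
  have "(A i j)\<^sup>2 \<le> (\<Sum>j<n. (A i j)\<^sup>2)" using assms by (intro member_le_sum) auto
  also have "\<dots> \<le> (\<Sum>i<m. \<Sum>j<n. (A i j)\<^sup>2)"
    using assms by (intro member_le_sum[of i "{..<m}" "\<lambda>i. \<Sum>j<n. (A i j)\<^sup>2"]) (auto intro: sum_nonneg)
  finally show ?thesis unfolding fro_norm_def by (metis real_sqrt_abs real_sqrt_le_mono)
qed

section \<open>The error-correction state and its convergence\<close>

locale cointegrated_var =
  fixes p k r :: nat and c \<mu> :: "nat \<Rightarrow> real"
    and f :: "nat \<Rightarrow> (nat \<Rightarrow> real) \<Rightarrow> (nat \<Rightarrow> real)"
    and \<theta> :: "(nat \<Rightarrow> real) \<Rightarrow> (nat \<Rightarrow> real)" and \<alpha> :: "nat \<Rightarrow> nat \<Rightarrow> real"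
  assumes k: "1 \<le> k" and r_less: "r < p" and model: "var_model p k c f" and Mr: "in_Mr p k r c f \<alpha> \<mu> \<theta>"
begin

abbreviation n :: nat where "n \<equiv> p * (k - 1) + r"
abbreviation finv :: "(nat \<Rightarrow> real) \<Rightarrow> nat \<Rightarrow> real" where "finv \<equiv> inv_into (Rn p) (f 0)"
abbreviation ba :: "(nat \<Rightarrow> real) \<Rightarrow> nat \<Rightarrow> real" where "ba \<equiv> mat_vec (k * p) n (balpha p k r \<alpha>)"

text \<open>Along a path, block 0 of \<open>bz\<close> is \<open>f_0(z_t)\<close> and block \<open>i \<ge> 1\<close> is the sum of \<open>g_j(z_{t-1-(j-i)})\<close> over \<open>j = i, ..., k-1\<close>. The offset
  \<open>\<mu>\<close> needs no padding, because it vanishes beyond index \<open>r\<close>.\<close>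
definition \<Xi> :: "(nat \<Rightarrow> real) \<Rightarrow> (nat \<Rightarrow> real)" where
  "\<Xi> bz = btheta p k r f \<theta> (finv (blk p 0 bz)) + mat_vec n (k * p) (D0mat p k r) bz"

lemma f_in_Rn: "i \<le> k \<Longrightarrow> z \<in> Rn p \<Longrightarrow> f i z \<in> Rn p"
  using model by (simp add: var_model_def)

lemma gfun_in_Rn: "z \<in> Rn p \<Longrightarrow> gfun k f j z \<in> Rn p"
  unfolding gfun_def by (intro subspace_neg subspace_sum subspace_Rn f_in_Rn) auto

lemma hfun_in_Rn: "z \<in> Rn p \<Longrightarrow> hfun k f z \<in> Rn p"
  unfolding hfun_def by (intro subspace_diff subspace_sum subspace_Rn f_in_Rn gfun_in_Rn) auto

lemma hbar_in_Rn: "hbar p k f zz \<in> Rn p"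
  unfolding hbar_def by (intro subspace_diff subspace_sum subspace_Rn f_in_Rn gfun_in_Rn) auto

lemma rank: "full_col_rank p r \<alpha>" and mu_in_Rn: "\<mu> \<in> Rn r" and c_eq: "c = mat_vec p r \<alpha> \<mu>"
  and theta_in_Rn: "z \<in> Rn p \<Longrightarrow> \<theta> z \<in> Rn r"
  and pi_eq: "z \<in> Rn p \<Longrightarrow> pifun k f z = mat_vec p r \<alpha> (\<theta> z)"
  using Mr by (auto simp: in_Mr_def)

lemma f0_bij: "bij_betw (f 0) (Rn p) (Rn p)" and finv_continuous: "continuous_on (Rn p) finv"
proof -
  obtain g where g: "homeomorphism (Rn p) (Rn p) (f 0) g" using Mr by (auto simp: in_Mr_def)
  show bij: "bij_betw (f 0) (Rn p) (Rn p)"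
    using g unfolding homeomorphism_def by (intro bij_betw_byWitness[of _ g]) auto
  have "finv x = g x" if "x \<in> Rn p" for x
  proof (rule inv_into_f_eq)
    show "inj_on (f 0) (Rn p)" using bij by (simp add: bij_betw_def)
  qed (use g that in \<open>auto simp: homeomorphism_def\<close>)
  then show "continuous_on (Rn p) finv"
    using g by (simp add: homeomorphism_def cong: continuous_on_cong)
qed

lemma finv_f [simp]: "z \<in> Rn p \<Longrightarrow> finv (f 0 z) = z"
  and f_finv [simp]: "x \<in> Rn p \<Longrightarrow> f 0 (finv x) = x"
  and finv_in_Rn [simp]: "x \<in> Rn p \<Longrightarrow> finv x \<in> Rn p"
  using f0_bij by (auto simp: bij_betw_def inv_into_f_f f_inv_into_f inv_into_into)

lemma Xi_in_Rn: "\<Xi> bz \<in> Rn n"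
  unfolding \<Xi>_def by (intro subspace_add subspace_Rn mat_vec_in_Rn) (auto simp: btheta_def Rn_def)

lemma Xi_top: "l < r \<Longrightarrow> \<Xi> bz l = \<theta> (finv (blk p 0 bz)) l"
  by (simp add: \<Xi>_def btheta_def mat_vec_D0mat_top)

lemma Xi_block:
  assumes "Suc i < k" "m < p" "bz \<in> Rn (k * p)"
  shows "\<Xi> bz (r + i * p + m) = gfun k f (i + 1) (finv (blk p 0 bz)) m - bz ((i + 1) * p + m) + bz ((i + 2) * p + m)"
proof -
  have "i * p + m < p * (k - 1)" using block_index_less[of i "k - 1" m p] assms by (simp add: mult.commute)
  moreover have "(i * p + m) div p = i" "(i * p + m) mod p = m" using assms by auto
  ultimately show ?thesis
    using mat_vec_D0mat_block[OF assms, of r] by (simp add: \<Xi>_def btheta_def add.assoc)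
qed

lemma ba_top: "v \<in> Rn n \<Longrightarrow> m < p \<Longrightarrow> ba v m = mat_vec p r \<alpha> v m + v (r + m)"
  using mat_vec_balpha[of v p k r m \<alpha>] k block_index_less[of 0 k m p] by simp

lemma ba_block: "v \<in> Rn n \<Longrightarrow> Suc i < k \<Longrightarrow> m < p \<Longrightarrow> ba v ((i + 1) * p + m) = v (r + i * p + m)"
  using mat_vec_balpha[of v p k r "(i + 1) * p + m" \<alpha>] k block_index_less[of "i + 1" k m p]
  by (simp add: add.assoc)

text \<open>Extracts from membership in the class what is used later: \<open>\<Xi>\<close> is
  Lipschitz, and along a state difference of the form A v, adding the increment of
  \<open>\<Xi>\<close> to \<open>v\<close> acts as a member of a decaying family. Convergence
  applies it to successive states, injectivity to two steady states.\<close>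

lemma increments:
  obtains \<F> s C b where "0 < s" "s < 1" "grow \<F> (Rn n) (l1norm n) C s"
    "\<forall>bz\<in>Rn (k * p). \<forall>bz'\<in>Rn (k * p). (\<forall>i. \<bar>\<Xi> bz i - \<Xi> bz' i\<bar> \<le> b * l1norm (k * p) (bz - bz')) \<and>
       (\<forall>v\<in>Rn n. bz - bz' = ba v \<longrightarrow> (\<exists>F\<in>\<F>. F v = v + (\<Xi> bz - \<Xi> bz')))"
proof -
  obtain bbar rhobar :: real and \<B> where rho: "rhobar < 1"
    and fro: "\<forall>\<beta>\<in>\<B>. fro_norm (k * p) n \<beta> \<le> bbar"
    and jsr: "jsr n ((\<lambda>\<beta>. \<lambda>i j. idm n i j + mat_mul n (k * p) n (transp \<beta>) (balpha p k r \<alpha>) i j) ` \<B>) \<le> ereal rhobar"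
    and inc': "\<forall>bz\<in>Rn (k * p). \<forall>bz'\<in>Rn (k * p).
      \<exists>\<beta>\<in>\<B>. \<Xi> bz - \<Xi> bz' = mat_vec n (k * p) (transp \<beta>) (bz - bz')"
    using Mr unfolding in_Mr_def by (elim conjE exE) (rule that[unfolded \<Xi>_def], assumption+)
  have inc: "\<exists>\<beta>\<in>\<B>. \<Xi> bz - \<Xi> bz' = mat_vec n (k * p) (transp \<beta>) (bz - bz')"
    if "bz \<in> Rn (k * p)" "bz' \<in> Rn (k * p)" for bz bz'
    using inc'[THEN bspec, OF that(1), THEN bspec, OF that(2)] .
  define T where "T \<beta> = (\<lambda>i j. idm n i j + mat_mul n (k * p) n (transp \<beta>) (balpha p k r \<alpha>) i j)" for \<beta>
  define \<F> where "\<F> = mat_vec n n ` (T ` \<B>)"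
  have ent: "\<bar>\<beta> i j\<bar> \<le> bbar" if "\<beta> \<in> \<B>" "i < k * p" "j < n" for \<beta> i j
    using entry_le_fro_norm[OF that(2,3), of \<beta>] fro that(1) by fastforce
  \<comment> \<open>Entry bound for I + \<beta>^T A from the Frobenius bound on \<beta>; the
    \<open>1\<close> is for the identity.\<close>
  define b where "b = 1 + \<bar>bbar\<bar> * (\<Sum>s<k * p. \<Sum>j<n. \<bar>balpha p k r \<alpha> s j\<bar>)"
  have "\<bar>A i j\<bar> \<le> b" if "A \<in> T ` \<B>" and ij: "i < n" "j < n" for A i j
  proof -
    obtain \<beta> where \<beta>: "\<beta> \<in> \<B>" "A = T \<beta>" using \<open>A \<in> T ` \<B>\<close> by blast
    have "\<bar>\<Sum>s<k * p. \<beta> s i * balpha p k r \<alpha> s j\<bar> \<le> (\<Sum>s<k * p. \<bar>\<beta> s i\<bar> * \<bar>balpha p k r \<alpha> s j\<bar>)"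
      by (rule order_trans[OF sum_abs]) (simp add: abs_mult)
    also have "\<dots> \<le> (\<Sum>s<k * p. \<bar>bbar\<bar> * (\<Sum>j<n. \<bar>balpha p k r \<alpha> s j\<bar>))"
    proof (rule sum_mono)
      fix s assume s: "s \<in> {..<k * p}"
      have "\<bar>\<beta> s i\<bar> \<le> \<bar>bbar\<bar>" using ent[OF \<beta>(1), of s i] s ij by simp
      moreover have "\<bar>balpha p k r \<alpha> s j\<bar> \<le> (\<Sum>j<n. \<bar>balpha p k r \<alpha> s j\<bar>)"
        using ij by (intro member_le_sum) auto
      ultimately show "\<bar>\<beta> s i\<bar> * \<bar>balpha p k r \<alpha> s j\<bar> \<le> \<bar>bbar\<bar> * (\<Sum>j<n. \<bar>balpha p k r \<alpha> s j\<bar>)"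
        by (intro mult_mono) auto
    qed
    also have "\<dots> = b - 1" by (simp add: b_def sum_distrib_left)
    finally show ?thesis using ij by (auto simp: \<beta>(2) T_def idm_def mat_mul_def transp_def)
  qed
  then have "\<exists>s C. 0 < s \<and> s < 1 \<and> grow \<F> (Rn n) (l1norm n) C s"
    unfolding \<F>_def by (rule jsr_less_one_imp_decay[OF jsr[folded T_def] rho])
  then obtain s C where sC: "0 < s" "s < 1" "grow \<F> (Rn n) (l1norm n) C s" by blast
  have "\<bar>\<Xi> bz i - \<Xi> bz' i\<bar> \<le> \<bar>bbar\<bar> * l1norm (k * p) (bz - bz')"
    if bz: "bz \<in> Rn (k * p)" "bz' \<in> Rn (k * p)" for bz bz' i
  proof -
    obtain \<beta> where \<beta>: "\<beta> \<in> \<B>" "\<Xi> bz - \<Xi> bz' = mat_vec n (k * p) (transp \<beta>) (bz - bz')" using inc[OF bz] by blast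
    have eq: "\<Xi> bz i - \<Xi> bz' i = mat_vec n (k * p) (transp \<beta>) (bz - bz') i" using fun_cong[OF \<beta>(2), of i] by simp
    show ?thesis
    proof (cases "i < n")
      case True
      have "\<bar>\<Xi> bz i - \<Xi> bz' i\<bar> \<le> (\<Sum>j<k * p. \<bar>\<beta> j i\<bar> * \<bar>(bz - bz') j\<bar>)"
        unfolding eq using True by (auto simp: mat_vec_def transp_def abs_mult intro!: order_trans[OF sum_abs])
      also have "\<dots> \<le> (\<Sum>j<k * p. \<bar>bbar\<bar> * \<bar>(bz - bz') j\<bar>)"
      proof (intro sum_mono mult_right_mono)
        fix j assume "j \<in> {..<k * p}"
        then show "\<bar>\<beta> j i\<bar> \<le> \<bar>bbar\<bar>" using ent[OF \<beta>(1) _ True, of j] by simp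
      qed simp
      finally show ?thesis by (simp add: l1norm_def sum_distrib_left)
    qed (simp add: eq mat_vec_def seminorm_nonneg[OF seminorm_l1norm])
  qed
  moreover have "\<exists>F\<in>\<F>. F v = v + (\<Xi> bz - \<Xi> bz')"
    if bz: "bz \<in> Rn (k * p)" "bz' \<in> Rn (k * p)" and v: "v \<in> Rn n" "bz - bz' = ba v" for bz bz' v
  proof -
    obtain \<beta> where \<beta>: "\<beta> \<in> \<B>" "\<Xi> bz - \<Xi> bz' = mat_vec n (k * p) (transp \<beta>) (bz - bz')" using inc[OF bz] by blast
    have "mat_vec n n (T \<beta>) v = mat_vec n n (idm n) v + mat_vec n n (mat_mul n (k * p) n (transp \<beta>) (balpha p k r \<alpha>)) v"
      by (auto simp: mat_vec_def T_def distrib_right sum.distrib fun_eq_iff)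
    also have "\<dots> = v + (\<Xi> bz - \<Xi> bz')" by (simp only: mat_vec_idm[OF v(1)] mat_vec_mat_mul \<beta>(2) v(2))
    finally show ?thesis using \<beta>(1) unfolding \<F>_def by blast
  qed
  ultimately show ?thesis using that[OF sC, of "\<bar>bbar\<bar>"] by blast
qed

text \<open>The offset \<open>m\<close> is arbitrary because two iterations need it: the one of a
  trajectory, with \<open>\<mu>\<close>, and the one that solves for a prescribed value of
  \<open>chi\<close>.\<close>

lemma iteration_converges:
  assumes Z0: "Z 0 \<in> Rn (k * p)" and m: "m \<in> Rn n" and step: "\<And>t. Z (Suc t) = Z t + ba (\<Xi> (Z t) + m)"
  shows "\<exists>bz\<in>Rn (k * p). Z \<longlonglongrightarrow> bz \<and> \<Xi> bz + m = 0"
proof -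
  obtain \<F> s C b where s: "0 < s" "s < 1" and gr: "grow \<F> (Rn n) (l1norm n) C s"
    and inc: "\<forall>bz\<in>Rn (k * p). \<forall>bz'\<in>Rn (k * p). (\<forall>i. \<bar>\<Xi> bz i - \<Xi> bz' i\<bar> \<le> b * l1norm (k * p) (bz - bz')) \<and>
       (\<forall>v\<in>Rn n. bz - bz' = ba v \<longrightarrow> (\<exists>F\<in>\<F>. F v = v + (\<Xi> bz - \<Xi> bz')))"
    by (rule increments)
  have Z: "Z t \<in> Rn (k * p)" for t
  proof (induction t)
    case (Suc t)
    then show ?case unfolding step by (intro subspace_add subspace_Rn mat_vec_in_Rn)
  qed (rule Z0)
  define \<xi> where "\<xi> t = \<Xi> (Z t) + m" for t
  have \<xi>R: "\<xi> t \<in> Rn n" for t unfolding \<xi>_def by (intro subspace_add subspace_Rn Xi_in_Rn m)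
  have "\<exists>P\<in>words \<F> t. \<xi> t = P (\<xi> 0)" for t
  proof (induction t)
    case (Suc t)
    then obtain P where P: "P \<in> words \<F> t" "\<xi> t = P (\<xi> 0)" by blast
    have "Z (Suc t) - Z t = ba (\<xi> t)" by (simp add: step \<xi>_def)
    then obtain F where F: "F \<in> \<F>" "F (\<xi> t) = \<xi> t + (\<Xi> (Z (Suc t)) - \<Xi> (Z t))"
      using inc[THEN bspec, OF Z, THEN bspec, OF Z, THEN conjunct2, THEN bspec, OF \<xi>R, THEN mp] by blast
    then have "\<xi> (Suc t) = (F \<circ> P) (\<xi> 0)" using P(2) by (simp add: \<xi>_def)
    then show ?case using words_SucI[OF F(1) P(1)] by blast
  qed auto
  then have decay: "l1norm n (\<xi> t) \<le> C * s ^ t * l1norm n (\<xi> 0)" for t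
    using growD[OF gr _ \<xi>R[of 0], of _ t] by fastforce
  have s0: "(\<lambda>t. a * s ^ t * a') \<longlonglongrightarrow> 0" for a a'
    using s by (intro tendsto_mult_left_zero tendsto_mult_right_zero LIMSEQ_realpow_zero) auto
  have \<xi>0: "(\<lambda>t. \<xi> t i) \<longlonglongrightarrow> 0" for i
  proof (rule Lim_null_comparison[OF always_eventually s0[of C "l1norm n (\<xi> 0)"]], rule allI)
    show "norm (\<xi> t i) \<le> C * s ^ t * l1norm n (\<xi> 0)" for t
      using component_le_l1norm[OF \<xi>R[of t], of i] decay[of t] by simp
  qed
  define K where "K = (\<Sum>i<k * p. \<Sum>j<n. \<bar>balpha p k r \<alpha> i j\<bar>)"
  have K: "0 \<le> K" unfolding K_def by (intro sum_nonneg) auto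
  have inc_bound: "\<bar>ba (\<xi> t) i\<bar> \<le> K * C * l1norm n (\<xi> 0) * s ^ t" for t i
  proof -
    have "\<bar>ba (\<xi> t) i\<bar> \<le> l1norm (k * p) (ba (\<xi> t))" by (rule component_le_l1norm) simp
    also have "\<dots> \<le> K * l1norm n (\<xi> t)" unfolding K_def by (rule l1norm_mat_vec_le)
    also have "\<dots> \<le> K * (C * s ^ t * l1norm n (\<xi> 0))" using decay K by (intro mult_left_mono) auto
    finally show ?thesis by (simp add: mult_ac)
  qed
  have "convergent (\<lambda>t. Z t i)" for i
  proof -
    have "summable (\<lambda>t. ba (\<xi> t) i)"
    proof (rule summable_comparison_test')
      show "summable (\<lambda>t. K * C * l1norm n (\<xi> 0) * s ^ t)" using s by (intro summable_mult summable_geometric) auto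
      show "norm (ba (\<xi> t) i) \<le> K * C * l1norm n (\<xi> 0) * s ^ t" for t using inc_bound by simp
    qed
    then have "convergent (\<lambda>t. \<Sum>u<t. ba (\<xi> u) i)" by (simp add: summable_iff_convergent)
    then have conv: "convergent (\<lambda>t. Z 0 i + (\<Sum>u<t. ba (\<xi> u) i))" by (intro convergent_add convergent_const)
    have "Z t i = Z 0 i + (\<Sum>u<t. ba (\<xi> u) i)" for t
      by (induction t) (simp_all add: step flip: \<xi>_def)
    then have eq: "(\<lambda>t. Z t i) = (\<lambda>t. Z 0 i + (\<Sum>u<t. ba (\<xi> u) i))" by (rule ext)
    show ?thesis by (subst eq) (rule conv)
  qed
  then obtain bz where bz: "\<And>i. (\<lambda>t. Z t i) \<longlonglongrightarrow> bz i" unfolding convergent_def by metis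
  have bzR: "bz \<in> Rn (k * p)"
  proof (rule in_RnI)
    fix i assume i: "k * p \<le> i"
    have "Z t i = 0" for t by (rule Rn_ge[OF Z i])
    then show "bz i = 0" using bz[of i] by (simp add: LIMSEQ_const_iff)
  qed
  have "(\<Xi> bz + m) i = 0" for i
  proof -
    \<comment> \<open>The Lipschitz bound carries \<open>\<Xi>\<close> through the limit.\<close>
    have "(\<lambda>t. b * (\<Sum>i<k * p. \<bar>Z t i - bz i\<bar>)) \<longlonglongrightarrow> b * (\<Sum>i<k * p. \<bar>bz i - bz i\<bar>)"
      by (intro tendsto_intros bz)
    then have lim0: "(\<lambda>t. b * l1norm (k * p) (Z t - bz)) \<longlonglongrightarrow> 0" by (simp add: l1norm_def)
    have bound: "norm (\<Xi> (Z t) i - \<Xi> bz i) \<le> b * l1norm (k * p) (Z t - bz)" for t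
      using inc[THEN bspec, OF Z, THEN bspec, OF bzR] by simp
    have "(\<lambda>t. \<Xi> (Z t) i - \<Xi> bz i) \<longlonglongrightarrow> 0"
      by (rule Lim_null_comparison[OF always_eventually[OF allI[OF bound]] lim0])
    then have "(\<lambda>t. \<xi> t i - (\<Xi> (Z t) i - \<Xi> bz i)) \<longlonglongrightarrow> 0 - 0" by (intro tendsto_diff \<xi>0)
    then have "(\<lambda>t. \<Xi> bz i + m i) \<longlonglongrightarrow> 0" by (simp add: \<xi>_def algebra_simps)
    then show ?thesis by (simp add: LIMSEQ_const_iff)
  qed
  then show ?thesis using bz bzR by (auto simp: tendsto_fun_iff fun_eq_iff)
qed

end

context cointegrated_var
begin

text \<open>Along a path this is \<open>f_0(z_t) - \<Sum> g_j(z_{t-j})\<close>; at rest it is \<open>h(z)\<close>. For \<open>k = 1\<close> block 1 lies outside the vector and is 0.\<close>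
definition level :: "(nat \<Rightarrow> real) \<Rightarrow> (nat \<Rightarrow> real)" where
  "level bz = blk p 0 bz - blk p 1 bz"

lemma Rn_r_subset: "m \<in> Rn r \<Longrightarrow> m \<in> Rn n"
  by (simp add: Rn_def)

text \<open>The block E^T adds to block 0 exactly what the identity part adds to block 1, so in the
  difference only the \<alpha> term is left. For \<open>k = 1\<close> both contributions are
  0.\<close>

lemma level_step:
  assumes v: "v \<in> Rn n"
  shows "level (bz + ba v) = level bz + mat_vec p r \<alpha> v"
proof (rule ext)
  fix m
  show "level (bz + ba v) m = (level bz + mat_vec p r \<alpha> v) m"
  proof (cases "m < p")
    case True
    have "ba v (p + m) = v (r + m)"
    proof (cases "k = 1")
      case True
      then show ?thesis using Rn_ge[OF v, of "r + m"] by (simp add: mat_vec_def)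
    next
      case False
      then show ?thesis using ba_block[OF v, of 0 m] \<open>m < p\<close> k by simp
    qed
    then show ?thesis using True ba_top[OF v True] by (simp add: level_def blk_def)
  qed (simp add: level_def blk_def mat_vec_def)
qed

text \<open>The top entries of the equation give \<open>\<theta>\<close>. The others express each
  g_i(z) as a difference of consecutive blocks, and the sum telescopes to block 1 because block
  \<open>k\<close> is 0.\<close>

lemma equilibrium:
  assumes bz: "bz \<in> Rn (k * p)" and m: "m \<in> Rn r" and eq: "\<Xi> bz + m = 0"
  defines "z \<equiv> finv (blk p 0 bz)"
  shows "\<theta> z = - m" and "level bz = hfun k f z"
proof -
  have z: "z \<in> Rn p" by (simp add: z_def)
  have eq': "\<Xi> bz l = - m l" for l using fun_cong[OF eq, of l] by (simp add: eq_neg_iff_add_eq_0)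
  show "\<theta> z = - m"
  proof (rule Rn_eqI[OF theta_in_Rn[OF z] subspace_neg[OF subspace_Rn m]])
    show "\<theta> z i = (- m) i" if "i < r" for i
      using Xi_top[OF that, of bz] eq'[of i] by (simp add: z_def)
  qed
  show "level bz = hfun k f z"
  proof (rule Rn_eqI[OF _ hfun_in_Rn[OF z]])
    show "level bz \<in> Rn p" unfolding level_def by (intro subspace_diff subspace_Rn blk_in_Rn)
    fix l assume l: "l < p"
    define x where "x j = bz ((j + 1) * p + l)" for j
    have g: "gfun k f (Suc i) z l = x i - x (Suc i)" if "i < k - 1" for i
    proof -
      have i: "Suc i < k" using that by simp
      have "\<Xi> bz (r + i * p + l) = 0" using eq' Rn_ge[OF m] by simp
      then show ?thesis using Xi_block[OF i l bz] by (simp add: x_def z_def)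
    qed
    have "(\<Sum>i\<in>{1..k-1}. gfun k f i z) l = (\<Sum>i<k-1. gfun k f (Suc i) z l)"
      by (simp add: sum.atLeast1_atMost_eq)
    also have "\<dots> = (\<Sum>i<k-1. x i - x (Suc i))" using g by (intro sum.cong) auto
    also have "\<dots> = x 0 - x (k - 1)" by (rule sum_lessThan_telescope')
    also have "x (k - 1) = 0" using k Rn_ge[OF bz] by (simp add: x_def)
    also have "x 0 - 0 = bz (p + l)" by (simp add: x_def)
    finally have "(\<Sum>i\<in>{1..k-1}. gfun k f i z) l = bz (p + l)" by simp
    moreover have "f 0 z = blk p 0 bz" by (simp add: z_def)
    ultimately show "level bz l = hfun k f z l" using l by (simp add: level_def hfun_def blk_apply)
  qed
qed

text \<open>The state of a path that rests at \<open>z\<close>: all lags coincide, so block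
  \<open>i\<close> is a plain tail sum of the g_j.\<close>

definition steady_state :: "(nat \<Rightarrow> real) \<Rightarrow> (nat \<Rightarrow> real)" where
  "steady_state z = join_blocks p k (\<lambda>i. if i = 0 then f 0 z else \<Sum>j\<in>{i..k-1}. gfun k f j z)"

lemma steady_state:
  assumes z: "z \<in> Rn p"
  shows "steady_state z \<in> Rn (k * p)" "blk p 0 (steady_state z) = f 0 z" "\<Xi> (steady_state z) = \<theta> z"
    "level (steady_state z) = hfun k f z"
proof -
  define F where "F i = (if i = 0 then f 0 z else \<Sum>j\<in>{i..k-1}. gfun k f j z)" for i
  have FR: "F i \<in> Rn p" for i
    unfolding F_def using f_in_Rn[of 0 z] z by (auto intro!: subspace_sum subspace_Rn gfun_in_Rn)
  have ss: "steady_state z = join_blocks p k F" by (simp add: steady_state_def F_def[abs_def])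
  show R: "steady_state z \<in> Rn (k * p)" by (simp add: ss)
  have ap: "steady_state z (i * p + m) = F i m" if "1 \<le> i" "m < p" for i m
  proof (cases "i < k")
    case False
    then have "k * p \<le> i * p + m" by (intro trans_le_add1 mult_le_mono1) auto
    then show ?thesis using Rn_ge[OF R] that False by (auto simp: F_def)
  qed (use that in \<open>simp add: ss join_blocks_apply\<close>)
  show b0: "blk p 0 (steady_state z) = f 0 z" using blk_join_blocks[of 0 k F p, OF _ FR] k by (simp add: ss F_def)
  show "\<Xi> (steady_state z) = \<theta> z"
  proof (rule Rn_eqI[OF Xi_in_Rn Rn_r_subset[OF theta_in_Rn[OF z]]])
    fix l assume l: "l < n"
    show "\<Xi> (steady_state z) l = \<theta> z l"
    proof (cases "l < r")
      case True
      then show ?thesis using z by (simp add: Xi_top b0)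
    next
      case False
      define i m where "i = (l - r) div p" and "m = (l - r) mod p"
      have p0: "0 < p" using r_less by simp
      then have m: "m < p" by (simp add: m_def)
      have "l - r < (k - 1) * p" using l False by (simp add: mult.commute)
      then have i: "Suc i < k" unfolding i_def by (metis less_mult_imp_div_less less_diff_conv Suc_eq_plus1)
      have l_eq: "l = r + i * p + m" using False by (simp add: i_def m_def)
      have "{Suc i..k-1} = insert (Suc i) {Suc (Suc i)..k-1}" using i by auto
      then have "F (i + 1) m = gfun k f (i + 1) z m + F (i + 2) m" by (simp add: F_def)
      moreover have "\<theta> z l = 0" using False Rn_ge[OF theta_in_Rn[OF z]] by simp
      ultimately show ?thesis using Xi_block[OF i m R] z ap[of "i + 1" m] ap[of "i + 2" m] m
        by (simp add: l_eq b0)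
    qed
  qed
  show "level (steady_state z) = hfun k f z"
  proof (rule Rn_eqI[OF _ hfun_in_Rn[OF z]])
    show "level (steady_state z) \<in> Rn p" unfolding level_def by (intro subspace_diff subspace_Rn blk_in_Rn)
    fix m assume m: "m < p"
    have "blk p 1 (steady_state z) m = F 1 m" using ap[of 1 m] m by (simp add: blk_def)
    then show "level (steady_state z) m = hfun k f z m" unfolding level_def b0 by (simp add: hfun_def F_def)
  qed
qed

end

section \<open>Bijectivity of the map chi\<close>

locale cointegrated_var_perp = cointegrated_var +
  fixes aperp :: "nat \<Rightarrow> nat \<Rightarrow> real"
  assumes perp: "is_perp p r \<alpha> aperp"
begin

abbreviation bT :: "(nat \<Rightarrow> real) \<Rightarrow> nat \<Rightarrow> real" where "bT \<equiv> mat_vec (p - r) p (transp aperp)"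
abbreviation chi_map :: "(nat \<Rightarrow> real) \<Rightarrow> nat \<Rightarrow> real" where "chi_map \<equiv> chi p k r f aperp \<theta>"

lemma stack_in_Rn: "y \<in> Rn r \<Longrightarrow> stack (p - r) x y \<in> Rn p"
  using r_less by (auto simp: stack_def Rn_def)

lemma stack_eq_iff:
  assumes "x \<in> Rn (p - r)" "x' \<in> Rn (p - r)"
  shows "stack (p - r) x y = stack (p - r) x' y' \<longleftrightarrow> x = x' \<and> y = y'"
proof
  assume eq: "stack (p - r) x y = stack (p - r) x' y'"
  have "x i = x' i" if "i < p - r" for i using fun_cong[OF eq, of i] that by (simp add: stack_def)
  moreover have "y i = y' i" for i using fun_cong[OF eq, of "p - r + i"] by (simp add: stack_def)
  ultimately show "x = x' \<and> y = y'" using Rn_eqI[OF assms] by auto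
qed auto

lemma chi_in_Rn: "z \<in> Rn p \<Longrightarrow> chi_map z \<in> Rn p"
  unfolding chi_def by (intro stack_in_Rn theta_in_Rn)

lemma chi_eq_stack_iff:
  "x \<in> Rn (p - r) \<Longrightarrow> chi_map z = stack (p - r) x y \<longleftrightarrow> bT (hfun k f z) = x \<and> \<theta> z = y"
  unfolding chi_def by (intro stack_eq_iff) auto

text \<open>Every step moves the level within the span of \<open>\<alpha>\<close>, so its image
  under \<open>bT\<close> is constant and passes to the limit. Together with the equilibrium
  equations it determines both parts of \<open>chi\<close>.\<close>

lemma iteration_limit:
  assumes Z0: "Z 0 \<in> Rn (k * p)" and m: "m \<in> Rn r" and step: "\<And>t. Z (Suc t) = Z t + ba (\<Xi> (Z t) + m)"
  shows "\<exists>z\<in>Rn p. (\<lambda>t. finv (blk p 0 (Z t))) \<longlonglongrightarrow> z \<and> chi_map z = stack (p - r) (bT (level (Z 0))) (- m)"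
proof -
  obtain bz where bz: "bz \<in> Rn (k * p)" "Z \<longlonglongrightarrow> bz" "\<Xi> bz + m = 0"
    using iteration_converges[of Z m] Z0 Rn_r_subset[OF m] step by blast
  define z where "z = finv (blk p 0 bz)"
  have comp: "(\<lambda>t. Z t i) \<longlonglongrightarrow> bz i" for i using bz(2) by (simp add: tendsto_fun_iff)
  have blk_lim: "(\<lambda>t. blk p i (Z t)) \<longlonglongrightarrow> blk p i bz" for i
    unfolding tendsto_fun_iff blk_def using comp by auto
  have lim: "(\<lambda>t. finv (blk p 0 (Z t))) \<longlonglongrightarrow> z"
    unfolding z_def by (rule continuous_on_tendsto_compose[OF finv_continuous blk_lim]) auto
  have const: "bT (level (Z t)) = bT (level (Z 0))" for t
  proof (induction t)
    case (Suc t)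
    have "level (Z (Suc t)) = level (Z t) + mat_vec p r \<alpha> (\<Xi> (Z t) + m)"
      unfolding step by (intro level_step subspace_add subspace_Rn Xi_in_Rn Rn_r_subset[OF m])
    then show ?case using Suc by (simp only: linear_add[OF linear_mat_vec, of "p - r"] is_perp_annihilates[OF perp]) simp
  qed simp
  have level_lim: "(\<lambda>t. level (Z t) i) \<longlonglongrightarrow> level bz i" for i
  proof -
    have "(\<lambda>t. blk p 0 (Z t) i - blk p 1 (Z t) i) \<longlonglongrightarrow> blk p 0 bz i - blk p 1 bz i"
      using blk_lim unfolding tendsto_fun_iff by (intro tendsto_diff) auto
    then show ?thesis by (simp add: level_def)
  qed
  have "bT (level bz) = bT (level (Z 0))"
  proof (rule ext)
    fix i
    have "(\<lambda>t. bT (level (Z t)) i) \<longlonglongrightarrow> bT (level bz) i"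
    proof (cases "i < p - r")
      case True
      have "(\<lambda>t. \<Sum>j<p. transp aperp i j * level (Z t) j) \<longlonglongrightarrow> (\<Sum>j<p. transp aperp i j * level bz j)"
        by (intro tendsto_intros level_lim)
      then show ?thesis using True by (simp add: mat_vec_def)
    qed (simp add: mat_vec_def)
    moreover have "(\<lambda>t. bT (level (Z t)) i) = (\<lambda>t. bT (level (Z 0)) i)"
      by (rule ext, rule fun_cong, rule const)
    ultimately have "(\<lambda>t. bT (level (Z 0)) i) \<longlonglongrightarrow> bT (level bz) i" by (rule subst[rotated])
    then show "bT (level bz) i = bT (level (Z 0)) i" by (rule LIMSEQ_unique) (rule tendsto_const)
  qed
  moreover have "\<theta> z = - m" "level bz = hfun k f z"
    unfolding z_def by (rule equilibrium[OF bz(1) m bz(3)])+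
  ultimately have "chi_map z = stack (p - r) (bT (level (Z 0))) (- m)" by (simp only: chi_def)
  moreover have "z \<in> Rn p" by (simp add: z_def)
  ultimately show ?thesis using lim by blast
qed

lemma chi_surjective:
  assumes y: "y \<in> Rn p"
  shows "\<exists>z\<in>Rn p. chi_map z = y"
proof -
  define a b where "a = (\<lambda>j. if j < p - r then y j else 0)" and "b = (\<lambda>j. y (p - r + j))"
  have aR: "a \<in> Rn (p - r)" by (simp add: a_def Rn_def)
  have bR: "b \<in> Rn r" using y r_less by (auto simp: b_def Rn_def)
  have y_eq: "stack (p - r) a b = y" by (auto simp: stack_def a_def b_def)
  obtain x where x: "x \<in> Rn p" "bT x = a" using is_perp_surjective[OF perp aR] by blast
  \<comment> \<open>As a state, \<open>x\<close> has block 0 equal to itself and all other blocks 0,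
    so its level is \<open>x\<close>; the offset \<open>- b\<close> drives \<open>\<theta>\<close>
    to \<open>b\<close>.\<close>
  define Z where "Z = rec_nat x (\<lambda>t bz. bz + ba (\<Xi> bz + - b))"
  have Z0: "Z 0 \<in> Rn (k * p)"
  proof (rule in_RnI)
    fix i assume "k * p \<le> i"
    moreover have "p \<le> k * p" using k by (cases k) auto
    ultimately have "p \<le> i" by linarith
    then show "Z 0 i = 0" using Rn_ge[OF x(1)] by (simp add: Z_def)
  qed
  have step: "Z (Suc t) = Z t + ba (\<Xi> (Z t) + - b)" for t by (simp add: Z_def)
  obtain z where z: "z \<in> Rn p" "chi_map z = stack (p - r) (bT (level (Z 0))) (- (- b))"
    using iteration_limit[of Z "- b", OF Z0 subspace_neg[OF subspace_Rn bR] step] by blast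
  have "level (Z 0) = x" using x(1) by (auto simp: Z_def level_def blk_def fun_eq_iff Rn_def)
  then have "chi_map z = y" using z(2) x(2) y_eq by simp
  then show ?thesis using z(1) by blast
qed

text \<open>The steady states of two points with the same image differ by \<open>A v\<close> with \<open>v\<close> fixed by a map of the decaying family.\<close>
lemma chi_injective:
  assumes z: "z \<in> Rn p" "z' \<in> Rn p" and eq: "chi_map z = chi_map z'"
  shows "z = z'"
proof -
  have perp_eq: "bT (hfun k f z) = bT (hfun k f z')" and \<theta>_eq: "\<theta> z = \<theta> z'"
    using eq chi_eq_stack_iff[of "bT (hfun k f z')" z "\<theta> z'"] by (auto simp: chi_def)
  have "bT (hfun k f z - hfun k f z') = 0" by (simp add: linear_diff[OF linear_mat_vec] perp_eq)
  then obtain y where y: "y \<in> Rn r" "hfun k f z - hfun k f z' = mat_vec p r \<alpha> y"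
    using is_perp_kernel[OF perp rank less_imp_le[OF r_less] subspace_diff[OF subspace_Rn hfun_in_Rn hfun_in_Rn]] z by blast
  define d where "d = steady_state z - steady_state z'"
  note ss = steady_state[OF z(1)] and ss' = steady_state[OF z(2)]
  have dR: "d \<in> Rn (k * p)" unfolding d_def by (intro subspace_diff subspace_Rn ss(1) ss'(1))
  \<comment> \<open>Solves d = A v: the lower part of A is the identity, which forces the last
    entries; block 0 minus block 1 of \<open>d\<close> is the level difference, which the kernel
    lemma wrote as \<alpha> y.\<close>
  define v where "v l = (if l < r then y l else d (p + (l - r)))" for l
  have vR: "v \<in> Rn n"
  proof (rule in_RnI)
    fix i assume i: "n \<le> i"
    have "k * p = p + p * (k - 1)" using k by (cases k) auto
    then have "k * p \<le> p + (i - r)" using i by simp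
    then show "v i = 0" using i Rn_ge[OF dR] y(1) by (auto simp: v_def Rn_def)
  qed
  have "d = ba v"
  proof (rule block_eqI[OF dR mat_vec_in_Rn])
    fix i m assume i: "i < k" and m: "m < p"
    show "d (i * p + m) = ba v (i * p + m)"
    proof (cases i)
      case 0
      have "mat_vec p r \<alpha> v = mat_vec p r \<alpha> y" by (simp add: mat_vec_def v_def fun_eq_iff)
      then have "mat_vec p r \<alpha> v m = level (steady_state z) m - level (steady_state z') m"
        using y(2) ss(4) ss'(4) by (metis fun_diff_def)
      then show ?thesis using ba_top[OF vR m] m 0 by (simp add: level_def blk_def v_def d_def)
    next
      case (Suc i')
      then show ?thesis using ba_block[OF vR, of i' m] i m by (simp add: v_def add.assoc)
    qed
  qed
  obtain \<F> s C b where s: "0 < s" "s < 1" and gr: "grow \<F> (Rn n) (l1norm n) C s"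
    and inc: "\<forall>bz\<in>Rn (k * p). \<forall>bz'\<in>Rn (k * p). (\<forall>i. \<bar>\<Xi> bz i - \<Xi> bz' i\<bar> \<le> b * l1norm (k * p) (bz - bz')) \<and>
       (\<forall>v\<in>Rn n. bz - bz' = ba v \<longrightarrow> (\<exists>F\<in>\<F>. F v = v + (\<Xi> bz - \<Xi> bz')))"
    by (rule increments)
  obtain F where F: "F \<in> \<F>" "F v = v + (\<Xi> (steady_state z) - \<Xi> (steady_state z'))"
    using inc[THEN bspec, OF ss(1), THEN bspec, OF ss'(1), THEN conjunct2, THEN bspec, OF vR, THEN mp]
      \<open>d = ba v\<close> unfolding d_def by blast
  then have Fv: "F v = v" by (simp add: ss(3) ss'(3) \<theta>_eq)
  have "\<exists>P\<in>words \<F> t. P v = v" for t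
  proof (induction t)
    case (Suc t)
    then obtain P where P: "P \<in> words \<F> t" "P v = v" by blast
    then show ?case using words_SucI[OF F(1) P(1)] Fv by (metis comp_apply)
  qed auto
  then have bound: "l1norm n v \<le> C * s ^ t * l1norm n v" for t
    using growD[OF gr _ vR, of _ t] by fastforce
  have "(\<lambda>t. C * s ^ t * l1norm n v) \<longlonglongrightarrow> 0"
    using s by (intro tendsto_mult_left_zero tendsto_mult_right_zero LIMSEQ_realpow_zero) auto
  then have "l1norm n v \<le> 0" by (rule LIMSEQ_le_const) (use bound in blast)
  then have "v i = 0" for i using component_le_l1norm[OF vR, of i] by simp
  then have "v = 0" by (simp add: fun_eq_iff)
  then have "steady_state z = steady_state z'" using \<open>d = ba v\<close> by (simp add: d_def)
  then have "f 0 z = f 0 z'" using ss(2) ss'(2) by metis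
  then show ?thesis using z by (metis finv_f)
qed

lemma chi_bij: "bij_betw chi_map (Rn p) (Rn p)"
proof (rule bij_betw_imageI)
  show "inj_on chi_map (Rn p)" by (rule inj_onI, rule chi_injective)
  show "chi_map ` Rn p = Rn p"
  proof (intro equalityI image_subsetI subsetI chi_in_Rn)
    show "y \<in> chi_map ` Rn p" if "y \<in> Rn p" for y using chi_surjective[OF that] by (metis imageI)
  qed
qed

end

section \<open>Trajectories and their limits\<close>

text \<open>Step \<open>s\<close> of the path is time \<open>\<tau> - k + s\<close>.\<close>
fun var_path :: "nat \<Rightarrow> nat \<Rightarrow> (nat \<Rightarrow> real) \<Rightarrow> (nat \<Rightarrow> (nat \<Rightarrow> real) \<Rightarrow> (nat \<Rightarrow> real)) \<Rightarrow>
    (nat \<Rightarrow> real) \<Rightarrow> (nat \<Rightarrow> real) \<Rightarrow> nat \<Rightarrow> (nat \<Rightarrow> real)" where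
  "var_path p k c f u zz s = (if s < k then blk p (k - Suc s) zz
     else inv_into (Rn p) (f 0) (c + (\<Sum>i\<in>{1..k}. f i (var_path p k c f u zz (s - i))) + (if s = k then u else 0)))"

declare var_path.simps [simp del]

context cointegrated_var
begin

text \<open>Convergence is defined by a statement about all trajectories. Existence keeps it from
  being vacuous and makes the limit unique.\<close>

lemma is_traj_exists:
  assumes u: "u \<in> Rn p"
  shows "\<exists>z. is_traj p k c f \<tau> u zz z"
proof -
  let ?w = "var_path p k c f u zz"
  define z where "z t = ?w (nat (t - (int \<tau> - int k)))" for t
  have rhs: "c + (\<Sum>i\<in>{1..k}. f i (x i)) + (if b then u else 0) \<in> Rn p" if "\<And>i. i \<in> {1..k} \<Longrightarrow> x i \<in> Rn p" for x b
    using that u by (auto simp: c_eq intro!: subspace_add subspace_sum subspace_Rn f_in_Rn)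
  have wR: "?w s \<in> Rn p" for s
  proof (induction s rule: less_induct)
    case (less s)
    show ?case
    proof (cases "s < k")
      case False
      have "?w (s - i) \<in> Rn p" if "i \<in> {1..k}" for i using less[of "s - i"] that False by simp
      then have "finv (c + (\<Sum>i\<in>{1..k}. f i (?w (s - i))) + (if s = k then u else 0)) \<in> Rn p"
        by (intro finv_in_Rn rhs)
      then show ?thesis using False by (simp only: var_path.simps[of p k c f u zz s] if_False)
    qed (simp add: var_path.simps)
  qed
  have "is_traj p k c f \<tau> u zz z" unfolding is_traj_def
  proof (intro conjI allI ballI impI)
    show "z t \<in> Rn p" for t by (simp add: z_def wR)
  next
    fix i assume i: "i \<in> {1..k}"
    have "nat (int \<tau> - int i - (int \<tau> - int k)) = k - i" by arith
    then have "z (int \<tau> - int i) = ?w (k - i)" by (simp only: z_def)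
    moreover have "k - i < k" "k - Suc (k - i) = i - 1" using i by auto
    ultimately show "z (int \<tau> - int i) = blk p (i - 1) zz" by (simp add: var_path.simps)
  next
    fix t assume t: "int \<tau> \<le> t"
    define s where "s = nat (t - (int \<tau> - int k))"
    have s: "\<not> s < k" "s = k \<longleftrightarrow> t = int \<tau>" using t by (auto simp: s_def)
    have "z (t - int i) = ?w (s - i)" for i
    proof -
      have "nat (t - int i - (int \<tau> - int k)) = s - i" unfolding s_def by arith
      then show ?thesis by (simp only: z_def)
    qed
    then have "(\<Sum>i\<in>{1..k}. f i (z (t - int i))) = (\<Sum>i\<in>{1..k}. f i (?w (s - i)))"
      by (intro sum.cong) auto
    moreover have "z t = finv (c + (\<Sum>i\<in>{1..k}. f i (?w (s - i))) + (if s = k then u else 0))"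
      unfolding z_def s_def[symmetric] by (subst var_path.simps) (simp add: s(1))
    ultimately show "f 0 (z t) = c + (\<Sum>i\<in>{1..k}. f i (z (t - int i))) + (if t = int \<tau> then u else 0)"
      using rhs[of "\<lambda>i. ?w (s - i)" "s = k"] wR by (simp add: s(2))
  qed
  then show ?thesis by blast
qed

text \<open>Rewrites the recursion with \<open>k\<close> lags as an autonomous one-step iteration.
  The index of \<open>Z\<close> starts at time \<open>\<tau>\<close>, after the shock.\<close>

lemma trajectory_iteration:
  assumes traj: "is_traj p k c f \<tau> u zz z"
  obtains Z where "Z 0 \<in> Rn (k * p)" "\<forall>t. Z (Suc t) = Z t + ba (\<Xi> (Z t) + \<mu>)"
    "\<forall>t. finv (blk p 0 (Z t)) = z (int \<tau> + int t)"
    "level (Z 0) = hbar p k f zz + mat_vec p r \<alpha> (\<theta> (z (int \<tau> - 1)) + \<mu>) + u"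
proof -
  have zR: "z t \<in> Rn p" if "int \<tau> - int k \<le> t" for t using traj that by (simp add: is_traj_def)
  \<comment> \<open>Block \<open>i\<close> of the state. For \<open>i\<close> at least 1 the oldest
    lag at \<open>t = 0\<close> is no earlier than \<open>\<tau> - k\<close>, so all values belong
    to the given path.\<close>
  define \<zeta> where "\<zeta> t i = (\<Sum>j\<in>{i..k-1}. gfun k f j (z (int \<tau> + int t - 1 - int (j - i))))" for t i
  have \<zeta>R: "\<zeta> t i \<in> Rn p" if "1 \<le> i" for t i
    unfolding \<zeta>_def using that by (intro subspace_sum subspace_Rn gfun_in_Rn zR) auto
  have \<zeta>Suc: "\<zeta> (Suc t) i = gfun k f i (z (int \<tau> + int t)) + \<zeta> t (i + 1)" if "1 \<le> i" "i < k" for t i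
  proof -
    have "{i..k-1} = insert i {i+1..k-1}" using that by auto
    then have "\<zeta> (Suc t) i = gfun k f i (z (int \<tau> + int t))
      + (\<Sum>j\<in>{i+1..k-1}. gfun k f j (z (int \<tau> + int (Suc t) - 1 - int (j - i))))" by (simp add: \<zeta>_def)
    also have "(\<Sum>j\<in>{i+1..k-1}. gfun k f j (z (int \<tau> + int (Suc t) - 1 - int (j - i)))) = \<zeta> t (i + 1)"
      unfolding \<zeta>_def by (intro sum.cong refl arg_cong[of _ _ z] arg_cong2[of _ _ _ _ "gfun k f"]) auto
    finally show ?thesis .
  qed
  have \<zeta>1: "\<zeta> t 1 = (\<Sum>j\<in>{1..k-1}. gfun k f j (z (int \<tau> + int t - int j)))" for t
    unfolding \<zeta>_def by (intro sum.cong refl arg_cong[of _ _ z] arg_cong2[of _ _ _ _ "gfun k f"]) auto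
  \<comment> \<open>The shock occurs only at \<open>T = \<tau>\<close>: it enters the level of
    \<open>Z 0\<close> and no later step.\<close>
  have id: "f 0 (z T) - (\<Sum>j\<in>{1..k-1}. gfun k f j (z (T - int j)))
      = f 0 (z (T - 1)) - (\<Sum>j\<in>{1..k-1}. gfun k f j (z (T - 1 - int j)))
        + mat_vec p r \<alpha> (\<theta> (z (T - 1)) + \<mu>) + (if T = int \<tau> then u else 0)" if T: "int \<tau> \<le> T" for T
  proof -
    have eq: "f 0 (z T) = mat_vec p r \<alpha> \<mu> + (\<Sum>i\<in>{1..k}. f i (z (T - int i))) + (if T = int \<tau> then u else 0)"
      using traj T by (simp add: is_traj_def c_eq)
    have "pifun k f (z (T - 1)) = mat_vec p r \<alpha> (\<theta> (z (T - 1)))" using T k by (intro pi_eq zR) auto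
    then show ?thesis
      using var_identity[OF k, of f "\<lambda>i. z (T - int i)" p r \<alpha> \<theta> \<mu> "if T = int \<tau> then u else 0"] eq
      by (simp add: algebra_simps)
  qed
  define F where "F t i = (if i = 0 then f 0 (z (int \<tau> + int t)) else \<zeta> t i)" for t i
  have FR: "F t i \<in> Rn p" for t i
    using \<zeta>R f_in_Rn[of 0] zR[of "int \<tau> + int t"] by (auto simp: F_def)
  define Z where "Z t = join_blocks p k (F t)" for t
  have ZR: "Z t \<in> Rn (k * p)" for t by (simp add: Z_def)
  have b0: "blk p 0 (Z t) = f 0 (z (int \<tau> + int t))" for t
    using blk_join_blocks[of 0 k "F t" p, OF _ FR] k by (simp add: Z_def F_def)
  have fz: "finv (blk p 0 (Z t)) = z (int \<tau> + int t)" for t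
    unfolding b0 by (intro finv_f zR) auto
  have ap: "Z t (i * p + m) = F t i m" if "1 \<le> i" "m < p" for t i m
  proof (cases "i < k")
    case False
    then have "k * p \<le> i * p + m" by (intro trans_le_add1 mult_le_mono1) auto
    moreover have "F t i = 0" using False that by (auto simp: F_def \<zeta>_def)
    ultimately show ?thesis using Rn_ge[OF ZR] by simp
  qed (use that in \<open>simp add: Z_def join_blocks_apply\<close>)
  have ap0: "Z t m = f 0 (z (int \<tau> + int t)) m" if "m < p" for t m
    using fun_cong[OF b0[of t], of m] that by (simp add: blk_def)
  have lev: "level (Z t) = f 0 (z (int \<tau> + int t)) - \<zeta> t 1" for t
  proof -
    have "blk p 1 (Z t) = \<zeta> t 1"
      by (rule Rn_eqI[OF blk_in_Rn \<zeta>R]) (use ap[of 1 _ t] in \<open>simp_all add: blk_def F_def\<close>)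
    then show ?thesis by (simp add: level_def b0)
  qed
  have block_step: "\<Xi> (Z t) (r + i * p + m) = \<zeta> (Suc t) (i + 1) m - \<zeta> t (i + 1) m" if "Suc i < k" "m < p" for t i m
    using Xi_block[OF that ZR, of t] ap[of "i + 1" m t] ap[of "i + 2" m t] \<zeta>Suc[of "i + 1" t] that
    by (simp add: fz F_def)
  show ?thesis
  proof (rule that[OF ZR allI allI[OF fz]])
    fix t
    define v where "v = \<Xi> (Z t) + \<mu>"
    have vR: "v \<in> Rn n" unfolding v_def by (intro subspace_add subspace_Rn Xi_in_Rn Rn_r_subset mu_in_Rn)
    have v_block: "v (r + i * p + m) = \<zeta> (Suc t) (i + 1) m - \<zeta> t (i + 1) m" if "Suc i < k" "m < p" for i m
      using block_step[OF that, of t] Rn_ge[OF mu_in_Rn] by (simp add: v_def)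
    \<comment> \<open>For \<open>k = 1\<close> there is no g block: \<open>\<zeta>\<close> is an
      empty sum and \<open>v\<close> vanishes from index \<open>r\<close> on.\<close>
    have v_first: "v (r + m) = \<zeta> (Suc t) 1 m - \<zeta> t 1 m" if "m < p" for m
    proof (cases "k = 1")
      case True
      then show ?thesis using Rn_ge[OF vR, of "r + m"] by (simp add: \<zeta>_def)
    next
      case False
      then show ?thesis using v_block[of 0 m] k that by simp
    qed
    have v_top: "mat_vec p r \<alpha> v = mat_vec p r \<alpha> (\<theta> (z (int \<tau> + int t)) + \<mu>)"
    proof -
      have "v l = (\<theta> (z (int \<tau> + int t)) + \<mu>) l" if "l < r" for l
        using that by (simp add: v_def Xi_top fz)
      then show ?thesis by (auto simp: mat_vec_def fun_eq_iff intro!: sum.cong)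
    qed
    have idt: "f 0 (z (int \<tau> + int (Suc t))) - \<zeta> (Suc t) 1
      = f 0 (z (int \<tau> + int t)) - \<zeta> t 1 + mat_vec p r \<alpha> (\<theta> (z (int \<tau> + int t)) + \<mu>)"
      using id[of "int \<tau> + int (Suc t)"] unfolding \<zeta>1 by (simp add: algebra_simps)
    show "Z (Suc t) = Z t + ba (\<Xi> (Z t) + \<mu>)" unfolding v_def[symmetric]
    proof (rule block_eqI[OF ZR subspace_add[OF subspace_Rn ZR mat_vec_in_Rn]])
      fix i m assume i: "i < k" and m: "m < p"
      show "Z (Suc t) (i * p + m) = (Z t + ba v) (i * p + m)"
      proof (cases i)
        case 0
        have "(f 0 (z (int \<tau> + int (Suc t))) - \<zeta> (Suc t) 1) m
          = (f 0 (z (int \<tau> + int t)) - \<zeta> t 1 + mat_vec p r \<alpha> v) m" unfolding idt v_top ..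
        then show ?thesis using 0 ba_top[OF vR m] v_first[OF m] ap0[OF m] by simp
      next
        case (Suc i')
        then show ?thesis
          using ba_block[OF vR, of i' m] v_block[of i' m] i m ap[of i m t] ap[of i m "Suc t"] by (simp add: F_def)
      qed
    qed
  next
    have init: "z (int \<tau> - int i) = blk p (i - 1) zz" if "i \<in> {1..k}" for i using traj that by (simp add: is_traj_def)
    have "f 0 (z (int \<tau> - 1)) = f 0 (blk p 0 zz)" using init[of 1] k by simp
    moreover have "(\<Sum>j\<in>{1..k-1}. gfun k f j (z (int \<tau> - 1 - int j))) = (\<Sum>j\<in>{1..k-1}. gfun k f j (blk p j zz))"
    proof (rule sum.cong[OF refl])
      fix j assume "j \<in> {1..k-1}"
      then have "Suc j \<in> {1..k}" by auto
      then show "gfun k f j (z (int \<tau> - 1 - int j)) = gfun k f j (blk p j zz)"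
        using init[of "Suc j"] by (simp add: algebra_simps)
    qed
    ultimately show "level (Z 0) = hbar p k f zz + mat_vec p r \<alpha> (\<theta> (z (int \<tau> - 1)) + \<mu>) + u"
      using id[of "int \<tau>"] unfolding lev \<zeta>1 by (simp add: hbar_def)
  qed
qed

end

section \<open>Limits of paths and domains of attraction\<close>

context cointegrated_var_perp
begin

definition limit_point :: "(nat \<Rightarrow> real) \<Rightarrow> (nat \<Rightarrow> real) \<Rightarrow> nat \<Rightarrow> real" where
  "limit_point u zz = inv_into (Rn p) chi_map (stack (p - r) (bT (hbar p k f zz + u)) (- \<mu>))"

lemma limit_point:
  shows "limit_point u zz \<in> Rn p" "chi_map (limit_point u zz) = stack (p - r) (bT (hbar p k f zz + u)) (- \<mu>)"
proof -
  have "stack (p - r) (bT (hbar p k f zz + u)) (- \<mu>) \<in> Rn p"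
    by (intro stack_in_Rn subspace_neg subspace_Rn mu_in_Rn)
  then have "stack (p - r) (bT (hbar p k f zz + u)) (- \<mu>) \<in> chi_map ` Rn p"
    using chi_bij by (simp add: bij_betw_def)
  then show "limit_point u zz \<in> Rn p" "chi_map (limit_point u zz) = stack (p - r) (bT (hbar p k f zz + u)) (- \<mu>)"
    unfolding limit_point_def by (rule inv_into_into, rule f_inv_into_f)
qed

lemma limit_point_theta: "\<theta> (limit_point u zz) = - \<mu>"
  and limit_point_perp: "bT (hfun k f (limit_point u zz)) = bT (hbar p k f zz + u)"
  using limit_point(2)[of u zz] chi_eq_stack_iff[of "bT (hbar p k f zz + u)"] by auto

lemma limit_point_eqI:
  assumes "z \<in> Rn p" "\<theta> z = - \<mu>" "bT (hfun k f z) = bT (hbar p k f zz + u)"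
  shows "limit_point u zz = z"
  by (rule chi_injective[OF limit_point(1) assms(1) trans[OF limit_point(2)]]) (simp add: chi_def assms)

lemma converges: "conv_to p k c f \<tau> u zz (limit_point u zz)"
  unfolding conv_to_def
proof (intro allI impI)
  fix z assume "is_traj p k c f \<tau> u zz z"
  then obtain Z where Z: "Z 0 \<in> Rn (k * p)" "\<forall>t. Z (Suc t) = Z t + ba (\<Xi> (Z t) + \<mu>)"
    "\<forall>t. finv (blk p 0 (Z t)) = z (int \<tau> + int t)"
    "level (Z 0) = hbar p k f zz + mat_vec p r \<alpha> (\<theta> (z (int \<tau> - 1)) + \<mu>) + u"
    by (rule trajectory_iteration)
  have lev: "bT (level (Z 0)) = bT (hbar p k f zz + u)"
    unfolding Z(4) by (simp only: linear_add[OF linear_mat_vec, of "p - r"] is_perp_annihilates[OF perp]) simp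
  obtain z' where z': "z' \<in> Rn p" "(\<lambda>t. finv (blk p 0 (Z t))) \<longlonglongrightarrow> z'"
    "chi_map z' = stack (p - r) (bT (level (Z 0))) (- \<mu>)"
    using iteration_limit[OF Z(1) mu_in_Rn spec[OF Z(2)]] by blast
  have "z' = limit_point u zz"
    by (rule chi_injective[OF z'(1) limit_point(1)]) (simp add: z'(3) lev limit_point(2))
  then show "(\<lambda>n. z (int \<tau> + int n)) \<longlonglongrightarrow> limit_point u zz" using z'(2) by (simp add: Z(3))
qed

lemma conv_to_iff:
  assumes "u \<in> Rn p"
  shows "conv_to p k c f \<tau> u zz z \<longleftrightarrow> z = limit_point u zz"
proof
  assume conv: "conv_to p k c f \<tau> u zz z"
  obtain w where "is_traj p k c f \<tau> u zz w" using is_traj_exists[OF assms] by blast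
  then have "(\<lambda>n. w (int \<tau> + int n)) \<longlonglongrightarrow> z" "(\<lambda>n. w (int \<tau> + int n)) \<longlonglongrightarrow> limit_point u zz"
    using conv converges by (simp_all add: conv_to_def)
  then show "z = limit_point u zz" by (rule LIMSEQ_unique)
qed (simp add: converges)

text \<open>A shock leads to \<open>z\<close> exactly when \<open>bT\<close> takes the same value at
  \<open>hbar\<close> plus \<open>u\<close> and at \<open>h(z)\<close>, that is when
  \<open>u\<close> minus their difference lies in the kernel of \<open>bT\<close>, which is the span
  of \<open>\<alpha>\<close>.\<close>

lemma domain:
  assumes z: "z \<in> Rn p" "\<theta> z = - \<mu>"
  shows "{mat_vec p r \<alpha> y + (hfun k f z - hbar p k f zz) | y. y \<in> Rn r} = {u \<in> Rn p. conv_to p k c f \<tau> u zz z}"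
    (is "?U = ?D")
proof (intro equalityI subsetI)
  fix u assume "u \<in> ?U"
  then obtain y where u: "u = mat_vec p r \<alpha> y + (hfun k f z - hbar p k f zz)" by blast
  have uR: "u \<in> Rn p"
    unfolding u by (intro subspace_add subspace_diff subspace_Rn mat_vec_in_Rn hfun_in_Rn z hbar_in_Rn)
  have "hbar p k f zz + u = hfun k f z + mat_vec p r \<alpha> y" by (simp add: u)
  then have "bT (hbar p k f zz + u) = bT (hfun k f z)"
    by (simp only: linear_add[OF linear_mat_vec, of "p - r"] is_perp_annihilates[OF perp]) simp
  then have "limit_point u zz = z" using limit_point_eqI[OF z] by simp
  then show "u \<in> ?D" using uR by (simp add: conv_to_iff)
next
  fix u assume "u \<in> ?D"
  then have u: "u \<in> Rn p" "z = limit_point u zz" by (auto simp: conv_to_iff)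
  have "bT (u - (hfun k f z - hbar p k f zz)) = 0"
    using limit_point_perp[of u zz] by (simp add: u(2) linear_diff[OF linear_mat_vec] linear_add[OF linear_mat_vec])
  moreover have "u - (hfun k f z - hbar p k f zz) \<in> Rn p"
    by (intro subspace_diff subspace_Rn hfun_in_Rn z hbar_in_Rn u)
  ultimately obtain y where "y \<in> Rn r" "u - (hfun k f z - hbar p k f zz) = mat_vec p r \<alpha> y"
    using is_perp_kernel[OF perp rank less_imp_le[OF r_less]] by blast
  then show "u \<in> ?U" by (intro CollectI exI[of _ y]) (simp add: algebra_simps)
qed

lemma domain_nonempty: "{mat_vec p r \<alpha> y + w | y. y \<in> Rn r} \<noteq> {}"
  using subspace_0[OF subspace_Rn, of r] by blast

end

theorem theorem4p1:
  fixes p k r \<tau> :: nat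
    and c \<mu> :: "nat \<Rightarrow> real"
    and f :: "nat \<Rightarrow> (nat \<Rightarrow> real) \<Rightarrow> (nat \<Rightarrow> real)"
    and \<theta> :: "(nat \<Rightarrow> real) \<Rightarrow> (nat \<Rightarrow> real)"
    and \<alpha> aperp :: "nat \<Rightarrow> nat \<Rightarrow> real"
  assumes "1 \<le> p" and "1 \<le> k" and "r < p"
    and "var_model p k c f"
    and "in_Mr p k r c f \<alpha> \<mu> \<theta>"
    and "is_perp p r \<alpha> aperp"
  shows
    "bij_betw (chi p k r f aperp \<theta>) (Rn p) (Rn p) \<and>
     (\<forall>u\<in>Rn p. \<forall>zz\<in>Rn (k * p).
        (let zinf = inv_into (Rn p) (chi p k r f aperp \<theta>)
                 (stack (p - r) (mat_vec (p - r) p (transp aperp) (hbar p k f zz + u)) (- \<mu>))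
         in zinf \<in> {z \<in> Rn p. \<theta> z = - \<mu>} \<and> conv_to p k c f \<tau> u zz zinf)) \<and>
     (\<forall>z\<in>{z \<in> Rn p. \<theta> z = - \<mu>}. \<forall>zz\<in>Rn (k * p).
        domain_of_attraction p k c f \<tau> zz z
          {mat_vec p r \<alpha> y + (hfun k f z - hbar p k f zz) | y. y \<in> Rn r}) \<and>
     strictly_stable p k c f \<tau> {z \<in> Rn p. \<theta> z = - \<mu>}"
proof -
  interpret cointegrated_var_perp p k r c \<mu> f \<theta> \<alpha> aperp
    by unfold_locales (use assms in auto)
  have limit: "limit_point u zz \<in> {z \<in> Rn p. \<theta> z = - \<mu>}" for u zz
    using limit_point(1) limit_point_theta by simp
  have attracted: "domain_of_attraction p k c f \<tau> zz z
      {mat_vec p r \<alpha> y + (hfun k f z - hbar p k f zz) | y. y \<in> Rn r}"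
    if "z \<in> {z \<in> Rn p. \<theta> z = - \<mu>}" for z zz
    unfolding domain_of_attraction_def using that domain domain_nonempty by simp
  have "stable_set p k c f \<tau> {z \<in> Rn p. \<theta> z = - \<mu>}"
    unfolding stable_set_def using limit converges by blast
  moreover have "nontrivial_attractor p k c f \<tau> z" if z: "z \<in> {z \<in> Rn p. \<theta> z = - \<mu>}" for z
    unfolding nontrivial_attractor_def
  proof (intro conjI ballI)
    fix zz assume "zz \<in> Rn (k * p)"
    show "\<exists>U. U \<noteq> {} \<and> U \<subseteq> Rn p \<and> (\<forall>u\<in>U. conv_to p k c f \<tau> u zz z)"
      using attracted[OF z, of zz] unfolding domain_of_attraction_def
      by (intro exI[of _ "{u \<in> Rn p. conv_to p k c f \<tau> u zz z}"]) auto
  qed (use z in simp)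
  ultimately have "strictly_stable p k c f \<tau> {z \<in> Rn p. \<theta> z = - \<mu>}"
    unfolding strictly_stable_def by blast
  then show ?thesis
    using chi_bij limit converges attracted unfolding Let_def limit_point_def by blast
qed

end
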